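(* Let $\Theta\in(0,2\pi)$. Let $E_{\rm a}<E_{\rm b}<E_{\rm c}<E_{\rm d}$ be any four consecutive members of the sequence $(E_j)_{j=1}^\infty$, with corresponding eigenfunctions $\Phi_{\rm a},\Phi_{\rm b},\Phi_{\rm c},\Phi_{\rm d}$, and let $I=[E_{\rm b},E_{\rm c}]$. Let $\mu\in I$ be the solution of $$\frac{|\Phi_{\rm b}(p)|^2}{E_{\rm b}-\mu}+\frac{|\Phi_{\rm c}(p)|^2}{E_{\rm c}-\mu}=0,$$ and let $$\psi=\frac{\overline{\Phi_{\rm b}(p)}}{E_{\rm b}-\mu}\Phi_{\rm b}+\frac{\overline{\Phi_{\rm c}(p)}}{E_{\rm c}-\mu}\Phi_{\rm c}.$$ Then there is a normalised eigenfunction $\phi$ of $H_\Theta$, with eigenvalue in the interval $(E_{\rm a},E_{\rm d})$, such that $$|\langle\phi,\psi\rangle|\ge\frac{\|\psi\|}{\sqrt3}\left(1-\frac{(E_{\rm c}-E_{\rm b})^2}{4\min\{E_{\rm d}-E_{\rm c},\,E_{\rm b}-E_{\rm a}\}^2}\right)^{1/2}$$ (the inequality being considered vacuous if the quantity in the large brackets is negative).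
   Context: Setting. $\mathcal M$ is a compact 2-dimensional Riemannian manifold, possibly with piecewise-smooth boundary, $\Delta$ is a self-adjoint Laplacian on $\mathcal M$, and $p\in\mathcal M$ is a fixed point. $\|\cdot\|$ and $\langle\cdot,\cdot\rangle$ are the norm and inner product (linear in the first argument) of $L^2(\mathcal M)$. $-\Delta$ has an orthonormal basis of eigenfunctions. In each eigenspace the orthonormal basis is chosen so that at most one basis element is nonzero at $p$; basis eigenfunctions vanishing at $p$ are discarded, and the remaining ones are denoted $\Phi_j$, with eigenvalues $E_1<E_2<E_3<\cdots$ (so $\Phi_j(p)\neq0$ and each $E_j$ is listed once). Weyl's law is a standing fact: $N(E):=\sum_{E_j\le E}|\Phi_j(p)|^2=\frac{E}{4\pi}+O(E^{1/2})$. The operator $H_\Theta$. Let $g_{\pm i}:=\sum_{j\ge1}\frac{\overline{\Phi_j(p)}}{E_j\mp i}\Phi_j\in L^2(\mathcal M)$, $\mathcal D_p:=\{f\in\mathrm{Dom}(\Delta): f(p)=0\}$, and let $H_0$ be the symmetric operator $f\mapsto-\Delta f$ with domain $\mathcal D_p$. Its deficiency subspaces are spanned by $g_{i}$ and $g_{-i}$, so $\mathrm{Dom}(H_0^* )=\mathcal D_p\oplus\mathrm{span}\{g_i,g_{-i}\}$; every $\psi\in\mathrm{Dom}(H_0^* )$ is uniquely $\psi=\hat\psi+a_+(\psi)g_i+a_-(\psi)g_{-i}$ with $\hat\psi\in\mathcal D_p$, $a_\pm(\psi)\in\mathbb C$, and $H_0^*\psi=H_0\hat\psi+i\,a_+(\psi)g_i-i\,a_-(\psi)g_{-i}$.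 $H_\Theta$ is the self-adjoint restriction of $H_0^*$ to $\mathrm{Dom}(H_\Theta)=\{\psi\in\mathrm{Dom}(H_0^* ): a_-(\psi)=-e^{i\Theta}a_+(\psi)\}$. *)

theory Defs
  imports "HOL-Analysis.Analysis" "HOL-Library.Landau_Symbols"
begin

section \<open>Smooth maps and Riemannian surfaces\<close>

text \<open>These notions are only used on open sets.\<close>

primrec Ck_on :: "nat \<Rightarrow> 'a::euclidean_space set \<Rightarrow> ('a \<Rightarrow> 'b::real_normed_vector) \<Rightarrow> bool" where
  "Ck_on 0 S f \<longleftrightarrow> continuous_on S f"
| "Ck_on (Suc k) S f \<longleftrightarrow>
     (\<forall>x\<in>S. f differentiable (at x)) \<and>
     (\<forall>v\<in>Basis. Ck_on k S (\<lambda>x. frechet_derivative f (at x) v))"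

definition smooth_on :: "'a::euclidean_space set \<Rightarrow> ('a \<Rightarrow> 'b::real_normed_vector) \<Rightarrow> bool" where
  "smooth_on S f \<longleftrightarrow> (\<forall>k. Ck_on k S f)"

definition pderiv_at :: "2 \<Rightarrow> (real^2 \<Rightarrow> 'b::real_normed_vector) \<Rightarrow> real^2 \<Rightarrow> 'b" where
  "pderiv_at i f y = frechet_derivative f (at y) (axis i 1)"

text \<open>A chart is a coordinate patch together with its coordinate map; the coordinate map is
  relevant only on the patch.\<close>

type_synonym 'a chart = "'a set \<times> ('a \<Rightarrow> real^2)"

definition in_chart :: "'a chart \<Rightarrow> ('a \<Rightarrow> 'b) \<Rightarrow> real^2 \<Rightarrow> 'b" where
  "in_chart c f = f \<circ> inv_into (fst c) (snd c)"

locale riemannian_surface =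
  fixes X :: "'a topology"
    and A :: "'a chart set"
    and g :: "'a chart \<Rightarrow> real^2 \<Rightarrow> real^2^2"
  assumes Hausdorff: "Hausdorff_space X"
    and second_countable: "second_countable X"
    and chart_open: "\<And>U \<phi>. (U, \<phi>) \<in> A \<Longrightarrow> openin X U \<and> open (\<phi> ` U)"
    and chart_homeo:
      "\<And>U \<phi>. (U, \<phi>) \<in> A \<Longrightarrow> homeomorphic_map (subtopology X U) (top_of_set (\<phi> ` U)) \<phi>"
    and charts_cover: "(\<Union>(U, \<phi>)\<in>A. U) = topspace X"
    and transition_smooth:
      "\<And>U \<phi> V \<kappa>. (U, \<phi>) \<in> A \<Longrightarrow> (V, \<kappa>) \<in> A \<Longrightarrow>
         smooth_on (\<phi> ` (U \<inter> V)) (in_chart (U, \<phi>) \<kappa>)"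
    and metric_smooth: "\<And>U \<phi>. (U, \<phi>) \<in> A \<Longrightarrow> smooth_on (\<phi> ` U) (g (U, \<phi>))"
    and metric_symmetric:
      "\<And>U \<phi> y. (U, \<phi>) \<in> A \<Longrightarrow> y \<in> \<phi> ` U \<Longrightarrow> transpose (g (U, \<phi>) y) = g (U, \<phi>) y"
    and metric_positive:
      "\<And>U \<phi> y v. (U, \<phi>) \<in> A \<Longrightarrow> y \<in> \<phi> ` U \<Longrightarrow> v \<noteq> 0 \<Longrightarrow> v \<bullet> (g (U, \<phi>) y *v v) > 0"
    and metric_transform:
      "\<And>U \<phi> V \<kappa> x. (U, \<phi>) \<in> A \<Longrightarrow> (V, \<kappa>) \<in> A \<Longrightarrow> x \<in> U \<inter> V \<Longrightarrow>
         (let J = matrix (frechet_derivative (in_chart (U, \<phi>) \<kappa>) (at (\<phi> x)))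
          in g (U, \<phi>) (\<phi> x) = transpose J ** g (V, \<kappa>) (\<kappa> x) ** J)"

text \<open>A compact surface \<open>M\<close> with piecewise smooth boundary is a compact region of a boundaryless
  surface \<open>X\<close> (a collar added to \<open>M\<close>; \<open>M\<close> may be all of a compact \<open>X\<close>). Regular arcs are smooth up
  to and including their end points, whence the slightly larger parameter interval.\<close>

definition smooth_arc :: "'a topology \<Rightarrow> 'a chart set \<Rightarrow> (real \<Rightarrow> 'a) \<Rightarrow> bool" where
  "smooth_arc X A \<gamma> \<longleftrightarrow>
     inj_on \<gamma> {0..1} \<and>
     (\<exists>\<epsilon>>0. continuous_map (top_of_set {-\<epsilon><..<1+\<epsilon>}) X \<gamma> \<and>
        (\<forall>(U, \<phi>)\<in>A. let T = {t \<in> {-\<epsilon><..<1+\<epsilon>}. \<gamma> t \<in> U} in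
           smooth_on T (\<phi> \<circ> \<gamma>) \<and> (\<forall>t\<in>T. vector_derivative (\<phi> \<circ> \<gamma>) (at t) \<noteq> 0)))"

definition piecewise_smooth_boundary :: "'a topology \<Rightarrow> 'a chart set \<Rightarrow> 'a set \<Rightarrow> bool" where
  "piecewise_smooth_boundary X A M \<longleftrightarrow>
     (\<exists>\<Gamma>. finite \<Gamma> \<and> (\<forall>\<gamma>\<in>\<Gamma>. smooth_arc X A \<gamma>) \<and>
        X frontier_of M = (\<Union>\<gamma>\<in>\<Gamma>. \<gamma> ` {0..1}) \<and>
        (\<forall>\<gamma>\<in>\<Gamma>. \<forall>\<delta>\<in>\<Gamma>. \<gamma> \<noteq> \<delta> \<longrightarrow>
           \<gamma> ` {0..1} \<inter> \<delta> ` {0..1} \<subseteq> {\<gamma> 0, \<gamma> 1} \<inter> {\<delta> 0, \<delta> 1})) \<and>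
     (\<forall>q \<in> X frontier_of M. \<exists>W (h :: 'a \<Rightarrow> real^2).
        openin X W \<and> q \<in> W \<and> open (h ` W) \<and>
        homeomorphic_map (subtopology X W) (top_of_set (h ` W)) h \<and>
        (\<forall>x\<in>W. x \<in> M \<longleftrightarrow> h x $ 2 \<ge> 0))"

definition compact_surface ::
  "'a topology \<Rightarrow> 'a chart set \<Rightarrow> ('a chart \<Rightarrow> real^2 \<Rightarrow> real^2^2) \<Rightarrow> 'a set \<Rightarrow> bool" where
  "compact_surface X A g M \<longleftrightarrow>
     riemannian_surface X A g \<and> compactin X M \<and> piecewise_smooth_boundary X A M"

definition riemannian_measure ::
  "'a topology \<Rightarrow> 'a chart set \<Rightarrow> ('a chart \<Rightarrow> real^2 \<Rightarrow> real^2^2) \<Rightarrow> 'a set \<Rightarrow> 'a measure \<Rightarrow> bool" where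
  "riemannian_measure X A g M vol \<longleftrightarrow>
     space vol = M \<and> sets vol = sigma_sets M {W \<inter> M | W. openin X W} \<and>
     (\<forall>(U, \<phi>)\<in>A. \<forall>S\<in>sets vol. S \<subseteq> U \<longrightarrow>
        emeasure vol S =
          (\<integral>\<^sup>+ y. ennreal (sqrt (det (g (U, \<phi>) y))) * indicator (\<phi> ` S) y \<partial>lborel))"

text \<open>The Laplace--Beltrami operator; the coordinate expression does not depend on the chart.\<close>

definition coord_laplacian ::
  "(real^2 \<Rightarrow> real^2^2) \<Rightarrow> (real^2 \<Rightarrow> complex) \<Rightarrow> real^2 \<Rightarrow> complex" where
  "coord_laplacian G u y =
     (1 / sqrt (det (G y))) *\<^sub>R
     (\<Sum>i\<in>UNIV. pderiv_at i
        (\<lambda>z. \<Sum>k\<in>UNIV. (sqrt (det (G z)) * matrix_inv (G z) $ i $ k) *\<^sub>R pderiv_at k u z) y)"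

definition laplace_beltrami ::
  "'a chart set \<Rightarrow> ('a chart \<Rightarrow> real^2 \<Rightarrow> real^2^2) \<Rightarrow> ('a \<Rightarrow> complex) \<Rightarrow> 'a \<Rightarrow> complex" where
  "laplace_beltrami A g u x =
     (let c = (SOME c. c \<in> A \<and> x \<in> fst c) in coord_laplacian (g c) (in_chart c u) (snd c x))"

definition test_function ::
  "'a topology \<Rightarrow> 'a chart set \<Rightarrow> 'a set \<Rightarrow> ('a \<Rightarrow> complex) \<Rightarrow> bool" where
  "test_function X A M u \<longleftrightarrow>
     (\<forall>(U, \<phi>)\<in>A. smooth_on (\<phi> ` U) (in_chart (U, \<phi>) u)) \<and>
     (\<exists>K. compactin X K \<and> K \<subseteq> X interior_of M \<and> (\<forall>x \<in> topspace X - K. u x = 0))"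


section \<open>The Hilbert space of square-integrable functions and its operators\<close>

text \<open>Elements of the Hilbert space are represented by functions, equality being equality almost
  everywhere.\<close>

definition L2 :: "'a measure \<Rightarrow> ('a \<Rightarrow> complex) set" where
  "L2 \<mu> = {f \<in> borel_measurable \<mu>. integrable \<mu> (\<lambda>x. (cmod (f x))\<^sup>2)}"

definition L2_inner :: "'a measure \<Rightarrow> ('a \<Rightarrow> complex) \<Rightarrow> ('a \<Rightarrow> complex) \<Rightarrow> complex" where
  "L2_inner \<mu> f h = (\<integral>x. f x * cnj (h x) \<partial>\<mu>)"

definition L2_norm :: "'a measure \<Rightarrow> ('a \<Rightarrow> complex) \<Rightarrow> real" where
  "L2_norm \<mu> f = sqrt (\<integral>x. (cmod (f x))\<^sup>2 \<partial>\<mu>)"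

definition L2_sums :: "'a measure \<Rightarrow> (nat \<Rightarrow> 'a \<Rightarrow> complex) \<Rightarrow> ('a \<Rightarrow> complex) \<Rightarrow> bool" where
  "L2_sums \<mu> F s \<longleftrightarrow>
     (\<forall>j. F j \<in> L2 \<mu>) \<and> s \<in> L2 \<mu> \<and> (\<lambda>n. L2_norm \<mu> (\<lambda>x. s x - (\<Sum>j<n. F j x))) \<longlonglongrightarrow> 0"

definition orthonormal_basis :: "'a measure \<Rightarrow> ('a \<Rightarrow> complex) set \<Rightarrow> bool" where
  "orthonormal_basis \<mu> B \<longleftrightarrow>
     B \<subseteq> L2 \<mu> \<and> (\<forall>b\<in>B. \<forall>c\<in>B. L2_inner \<mu> b c = (if b = c then 1 else 0)) \<and>
     (\<forall>f\<in>L2 \<mu>. (\<forall>b\<in>B. L2_inner \<mu> f b = 0) \<longrightarrow> (AE x in \<mu>. f x = 0))"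

text \<open>An operator is given by its graph.\<close>

type_synonym 'a op = "(('a \<Rightarrow> complex) \<times> ('a \<Rightarrow> complex)) set"

definition op_neg :: "'a op \<Rightarrow> 'a op" where
  "op_neg T = {(f, \<lambda>x. - h x) | f h. (f, h) \<in> T}"

definition op_adjoint :: "'a measure \<Rightarrow> 'a op \<Rightarrow> 'a op" where
  "op_adjoint \<mu> T =
     {(f, h). f \<in> L2 \<mu> \<and> h \<in> L2 \<mu> \<and> (\<forall>(u, v)\<in>T. L2_inner \<mu> v f = L2_inner \<mu> u h)}"

text \<open>Linearity, closedness and invariance under equality almost everywhere of a self-adjoint
  operator follow from its being an adjoint, and single-valuedness from density of the domain.\<close>

definition self_adjoint :: "'a measure \<Rightarrow> 'a op \<Rightarrow> bool" where
  "self_adjoint \<mu> T \<longleftrightarrow>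
     T = op_adjoint \<mu> T \<and>
     (\<forall>f\<in>L2 \<mu>. \<forall>\<epsilon>>0. \<exists>u\<in>Domain T. L2_norm \<mu> (\<lambda>x. f x - u x) < \<epsilon>)"

definition eigenfunction :: "'a measure \<Rightarrow> 'a op \<Rightarrow> real \<Rightarrow> ('a \<Rightarrow> complex) \<Rightarrow> bool" where
  "eigenfunction \<mu> T e f \<longleftrightarrow> (f, \<lambda>x. complex_of_real e * f x) \<in> T \<and> L2_norm \<mu> f \<noteq> 0"

text \<open>A self-adjoint Laplacian: any self-adjoint extension of the Laplace--Beltrami operator on
  smooth functions with compact support inside \<open>M\<close>. The choice of extension is the choice of the
  boundary conditions.\<close>

definition self_adjoint_laplacian ::
  "'a topology \<Rightarrow> 'a chart set \<Rightarrow> ('a chart \<Rightarrow> real^2 \<Rightarrow> real^2^2) \<Rightarrow> 'a set \<Rightarrow> 'a measure \<Rightarrow> 'a op \<Rightarrow> bool"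
  where
  "self_adjoint_laplacian X A g M vol L \<longleftrightarrow>
     self_adjoint vol L \<and> (\<forall>u. test_function X A M u \<longrightarrow> (u, laplace_beltrami A g u) \<in> L)"


section \<open>Values at a point and eigenbases\<close>

text \<open>The value at \<open>p\<close> of a class of functions modulo null sets is the value at \<open>p\<close> of a
  representative that is continuous at \<open>p\<close>, i.e. an essential limit at \<open>p\<close>.\<close>

definition has_value_at ::
  "'a topology \<Rightarrow> 'a measure \<Rightarrow> 'a \<Rightarrow> ('a \<Rightarrow> complex) \<Rightarrow> complex \<Rightarrow> bool" where
  "has_value_at X vol p f z \<longleftrightarrow>
     (\<forall>\<epsilon>>0. \<exists>W. openin X W \<and> p \<in> W \<and> (AE x in vol. x \<in> W \<longrightarrow> cmod (f x - z) < \<epsilon>))"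

definition adapted_eigenbasis ::
  "'a topology \<Rightarrow> 'a measure \<Rightarrow> 'a op \<Rightarrow> 'a \<Rightarrow> ('a \<Rightarrow> complex) set \<Rightarrow> bool" where
  "adapted_eigenbasis X vol L p B \<longleftrightarrow>
     orthonormal_basis vol B \<and>
     (\<forall>b\<in>B. \<exists>e. eigenfunction vol (op_neg L) e b) \<and>
     (\<forall>b\<in>B. has_value_at X vol p b (b p)) \<and>
     (\<forall>b\<in>B. \<forall>c\<in>B. \<forall>e. eigenfunction vol (op_neg L) e b \<and> eigenfunction vol (op_neg L) e c \<and> b \<noteq> c
        \<longrightarrow> b p = 0 \<or> c p = 0)"

text \<open>The sequences are indexed from 0.\<close>

definition nonvanishing_part ::
  "'a measure \<Rightarrow> 'a op \<Rightarrow> 'a \<Rightarrow> ('a \<Rightarrow> complex) set \<Rightarrow> (nat \<Rightarrow> 'a \<Rightarrow> complex) \<Rightarrow> (nat \<Rightarrow> real) \<Rightarrow> bool" where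
  "nonvanishing_part vol L p B \<Phi> E \<longleftrightarrow>
     range \<Phi> = {b \<in> B. b p \<noteq> 0} \<and> strict_mono E \<and>
     (\<forall>j. eigenfunction vol (op_neg L) (E j) (\<Phi> j))"

definition weyl_law :: "'a \<Rightarrow> (nat \<Rightarrow> 'a \<Rightarrow> complex) \<Rightarrow> (nat \<Rightarrow> real) \<Rightarrow> bool" where
  "weyl_law p \<Phi> E \<longleftrightarrow>
     (\<forall>e. finite {j. E j \<le> e}) \<and>
     (\<lambda>e. (\<Sum>j | E j \<le> e. (cmod (\<Phi> j p))\<^sup>2) - e / (4 * pi)) \<in> O(\<lambda>e. sqrt e)"


section \<open>Point scatterers\<close>

definition op_H0 :: "'a topology \<Rightarrow> 'a measure \<Rightarrow> 'a op \<Rightarrow> 'a \<Rightarrow> 'a op" where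
  "op_H0 X vol L p = {(f, h) \<in> op_neg L. has_value_at X vol p f 0}"

text \<open>\<open>green_sum z\<close> describes \<open>g\<^sub>i\<close> for \<open>z = i\<close> and \<open>g\<^sub>-\<^sub>i\<close> for \<open>z = -i\<close>.\<close>

definition green_sum ::
  "'a measure \<Rightarrow> 'a \<Rightarrow> (nat \<Rightarrow> 'a \<Rightarrow> complex) \<Rightarrow> (nat \<Rightarrow> real) \<Rightarrow> complex \<Rightarrow> ('a \<Rightarrow> complex) \<Rightarrow> bool" where
  "green_sum vol p \<Phi> E z G \<longleftrightarrow>
     L2_sums vol (\<lambda>j x. cnj (\<Phi> j p) / (complex_of_real (E j) - z) * \<Phi> j x) G"

definition op_HTheta ::
  "'a topology \<Rightarrow> 'a measure \<Rightarrow> 'a op \<Rightarrow> 'a \<Rightarrow> ('a \<Rightarrow> complex) \<Rightarrow> ('a \<Rightarrow> complex) \<Rightarrow> real \<Rightarrow> 'a op" where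
  "op_HTheta X vol L p gp gm \<Theta> =
     {(\<psi>, \<eta>) \<in> op_adjoint vol (op_H0 X vol L p).
        \<exists>f ap am. f \<in> Domain (op_H0 X vol L p) \<and>
          (AE x in vol. \<psi> x = f x + ap * gp x + am * gm x) \<and> am = - exp (\<i> * \<Theta>) * ap}"

end

(* Expanding over the Phi_j, every root l of the secular function
     F(z) = sum_j |Phi_j(p)|^2 (1/(E_j - z) - (E_j - t)/(E_j^2 + 1))
   gives the eigenfunction G_l = sum_j conj(Phi_j(p))/(E_j - l) Phi_j of H_Theta, where t = cot(Theta/2),
   and F has a root in each gap (E_n, E_(n+1)). Let l run over roots in the three gaps between E_a and E_d,
   and let p_l be the squared overlap of psi with the normalised G_l. As psi lies in the domain of H_Theta,
   two inequalities bound its spectral mass outside (E_a, E_d). Bessel's inequality for (H - s) psi gives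
     sum_l (l - s)^2 p_l <= |(H - s) psi|^2,
   and a min-max argument gives
     sum_l (l - E_a)(l - E_d) p_l <= <(H - E_a) psi, (H - E_d) psi>:
   some psi + sum_l x_l G_l with sum_l x_l = 0 has no component along Phi_b and Phi_c, so the form on the
   right is nonnegative there. A convex combination turns the two into
     sum_l p_l >= (1 - delta^2/D^2) |psi|^2, with delta = (E_c - E_b)/2 and
     D = delta + min(E_d - E_c, E_b - E_a),
   and the largest of the three p_l satisfies the claim.

   That G_l lies in the domain of H_Theta needs u(p) = sum_j <u, Phi_j> Phi_j(p) on the domain of the
   Laplacian. The value at p is a pointwise limit of averages over shrinking neighbourhoods, and a gliding
   hump argument allows the limit to be exchanged with the series. *)
theory Submission
  imports Defs
begin

section \<open>Square-integrable functions\<close>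

text \<open>What shapes the proof is that values at p are essential limits: each function in the
  domain of the Laplacian is known to have one, but no bound on u -> u(p) is given. The averages
  near p are therefore controlled only by their convergence on each single function, and this has to
  replace a uniform bound. The function F arises from the boundary condition. Subtracting from G_l
  the combination of g_i and g_-i that Theta allows leaves the coefficients conj(Phi_j(p)) times the
  j-th bracket in F. These decay fast enough for the domain of the Laplacian, and the value of the
  remainder at p is F(l). The equation for mu says that psi(p) = 0. Likewise sum_l x_l = 0 cancels
  the singular parts of the G_l, so that H acts on the combination by multiplying its coefficients
  by E_j. D is chosen so that (z - m)^2 - D^2, with m the midpoint of I, vanishes at whichever of
  E_a and E_d is nearer to I. The 3 under the root is the number of gaps between E_a and
  E_d.\<close>

lemma L2_integrable_mult:
  assumes "f \<in> L2 N" "h \<in> L2 N"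
  shows "integrable N (\<lambda>x. f x * cnj (h x))"
proof (rule Bochner_Integration.integrable_bound)
  show "integrable N (\<lambda>x. (cmod (f x))\<^sup>2 + (cmod (h x))\<^sup>2)"
    using assms by (auto simp: L2_def)
  have "(\<lambda>x. cnj (h x)) \<in> borel_measurable N"
    using assms by (intro borel_measurable_continuous_on[OF continuous_on_cnj[OF continuous_on_id]]) (auto simp: L2_def)
  then show "(\<lambda>x. f x * cnj (h x)) \<in> borel_measurable N"
    using assms by (auto simp: L2_def)
  have "u * v \<le> u\<^sup>2 + v\<^sup>2" if "u \<ge> 0" "v \<ge> 0" for u v :: real
  proof -
    have "0 \<le> (u - v)\<^sup>2 + u * v" using that by simp
    then show ?thesis by (simp add: power2_eq_square algebra_simps)
  qed
  then show "AE x in N. norm (f x * cnj (h x)) \<le> norm ((cmod (f x))\<^sup>2 + (cmod (h x))\<^sup>2)"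
    by (intro AE_I2) (simp add: norm_mult)
qed

lemma L2_scale: "f \<in> L2 N \<Longrightarrow> (\<lambda>x. c * f x) \<in> L2 N"
  by (auto simp: L2_def norm_mult power_mult_distrib)

lemma L2_add:
  assumes "f \<in> L2 N" "h \<in> L2 N"
  shows "(\<lambda>x. f x + h x) \<in> L2 N"
proof -
  have "integrable N (\<lambda>x. (cmod (f x + h x))\<^sup>2)"
  proof (rule Bochner_Integration.integrable_bound)
    show "integrable N (\<lambda>x. 2 * (cmod (f x))\<^sup>2 + 2 * (cmod (h x))\<^sup>2)"
      using assms by (auto simp: L2_def)
    show "(\<lambda>x. (cmod (f x + h x))\<^sup>2) \<in> borel_measurable N"
      using assms by (auto simp: L2_def)
    have "(cmod (u + v))\<^sup>2 \<le> 2 * (cmod u)\<^sup>2 + 2 * (cmod v)\<^sup>2" for u v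
    proof -
      have "(cmod (u + v))\<^sup>2 \<le> (cmod u + cmod v)\<^sup>2"
        by (intro power_mono norm_triangle_ineq) auto
      also have "\<dots> \<le> 2 * (cmod u)\<^sup>2 + 2 * (cmod v)\<^sup>2"
        using sum_squares_bound[of "cmod u" "cmod v"] by (simp add: power2_sum)
      finally show ?thesis .
    qed
    then show "AE x in N. norm ((cmod (f x + h x))\<^sup>2) \<le> norm (2 * (cmod (f x))\<^sup>2 + 2 * (cmod (h x))\<^sup>2)"
      by (intro AE_I2) simp
  qed
  then show ?thesis using assms by (auto simp: L2_def)
qed

lemma L2_uminus: "f \<in> L2 N \<Longrightarrow> (\<lambda>x. - f x) \<in> L2 N"
  using L2_scale[of f N "-1"] by simp

lemma L2_diff: "f \<in> L2 N \<Longrightarrow> h \<in> L2 N \<Longrightarrow> (\<lambda>x. f x - h x) \<in> L2 N"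
  using L2_add[OF _ L2_uminus] by fastforce

lemma L2_zero: "(\<lambda>x. 0) \<in> L2 N"
  by (simp add: L2_def)

lemma L2_sum: "(\<And>j. j \<in> I \<Longrightarrow> F j \<in> L2 N) \<Longrightarrow> (\<lambda>x. \<Sum>j\<in>I. F j x) \<in> L2 N"
  by (induction I rule: infinite_finite_induct) (auto intro: L2_add L2_zero)

lemma L2_inner_commute: "L2_inner N h f = cnj (L2_inner N f h)"
  unfolding L2_inner_def by (subst Bochner_Integration.integral_cnj[symmetric]) (simp add: mult.commute)

lemma L2_inner_scale: "L2_inner N (\<lambda>x. c * f x) h = c * L2_inner N f h"
  unfolding L2_inner_def by (simp add: mult.assoc)

lemma L2_inner_scale_right: "L2_inner N f (\<lambda>x. c * h x) = cnj c * L2_inner N f h"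
  by (simp add: L2_inner_commute[of N f] L2_inner_scale)

lemma L2_inner_add:
  "f \<in> L2 N \<Longrightarrow> f' \<in> L2 N \<Longrightarrow> h \<in> L2 N \<Longrightarrow>
    L2_inner N (\<lambda>x. f x + f' x) h = L2_inner N f h + L2_inner N f' h"
  unfolding L2_inner_def by (simp add: distrib_right L2_integrable_mult)

lemma L2_inner_add_right:
  "f \<in> L2 N \<Longrightarrow> f' \<in> L2 N \<Longrightarrow> h \<in> L2 N \<Longrightarrow>
    L2_inner N h (\<lambda>x. f x + f' x) = L2_inner N h f + L2_inner N h f'"
  by (simp add: L2_inner_commute[of N h] L2_inner_add)

lemma L2_inner_diff:
  "f \<in> L2 N \<Longrightarrow> f' \<in> L2 N \<Longrightarrow> h \<in> L2 N \<Longrightarrow>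
    L2_inner N (\<lambda>x. f x - f' x) h = L2_inner N f h - L2_inner N f' h"
  unfolding L2_inner_def by (simp add: left_diff_distrib L2_integrable_mult)

lemma L2_inner_diff_right:
  "f \<in> L2 N \<Longrightarrow> f' \<in> L2 N \<Longrightarrow> h \<in> L2 N \<Longrightarrow>
    L2_inner N h (\<lambda>x. f x - f' x) = L2_inner N h f - L2_inner N h f'"
  by (simp add: L2_inner_commute[of N h] L2_inner_diff)

lemma L2_inner_sum:
  assumes "\<And>j. j \<in> I \<Longrightarrow> F j \<in> L2 N" "h \<in> L2 N"
  shows "L2_inner N (\<lambda>x. \<Sum>j\<in>I. F j x) h = (\<Sum>j\<in>I. L2_inner N (F j) h)"
  using assms(1)
proof (induction I rule: infinite_finite_induct)
  case (insert i I)
  then show ?case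
    using L2_inner_add[of "F i" N "\<lambda>x. \<Sum>j\<in>I. F j x" h] L2_sum[of I F N] assms(2) by simp
qed (auto simp: L2_inner_def)


section \<open>The norm and the Cauchy-Schwarz inequality\<close>

lemma L2_norm_nonneg: "L2_norm N f \<ge> 0"
  by (simp add: L2_norm_def)

lemma L2_norm_sq: "(L2_norm N f)\<^sup>2 = (\<integral>x. (cmod (f x))\<^sup>2 \<partial>N)"
  by (simp add: L2_norm_def)

lemma L2_inner_self: "L2_inner N f f = complex_of_real ((L2_norm N f)\<^sup>2)"
  unfolding L2_inner_def L2_norm_sq complex_norm_square[symmetric]
  by (rule integral_complex_of_real)

lemma L2_norm_scale: "L2_norm N (\<lambda>x. c * f x) = cmod c * L2_norm N f"
  by (simp add: L2_norm_def norm_mult power_mult_distrib real_sqrt_mult)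

lemma L2_norm_diff_sq:
  assumes "f \<in> L2 N" "h \<in> L2 N"
  shows "(L2_norm N (\<lambda>x. f x - h x))\<^sup>2
    = (L2_norm N f)\<^sup>2 - 2 * Re (L2_inner N f h) + (L2_norm N h)\<^sup>2"
proof -
  have "complex_of_real ((L2_norm N (\<lambda>x. f x - h x))\<^sup>2)
     = L2_inner N f f - L2_inner N h f - (L2_inner N f h - L2_inner N h h)"
    unfolding L2_inner_self[symmetric] using assms
    by (simp add: L2_inner_diff L2_inner_diff_right L2_diff)
  also have "\<dots> = complex_of_real ((L2_norm N f)\<^sup>2 - 2 * Re (L2_inner N f h) + (L2_norm N h)\<^sup>2)"
    by (simp add: L2_inner_self L2_inner_commute[of N h f] complex_eq_iff)
  finally show ?thesis using of_real_eq_iff by blast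
qed

lemma L2_Cauchy_Schwarz:
  assumes "f \<in> L2 N" "h \<in> L2 N"
  shows "cmod (L2_inner N f h) \<le> L2_norm N f * L2_norm N h"
proof -
  define t where "t = L2_inner N f h"
  define A B where "A = (L2_norm N f)\<^sup>2" and "B = (L2_norm N h)\<^sup>2"
  \<comment> \<open>Scaling \<open>h\<close> by \<open>s * t\<close>, with \<open>t\<close> the
    inner product itself, makes the cross term real and leaves a quadratic polynomial in the real
    number \<open>s\<close>.\<close>
  have main: "0 \<le> A - 2 * s * (cmod t)\<^sup>2 + s\<^sup>2 * (cmod t)\<^sup>2 * B" for s :: real
  proof -
    let ?g = "\<lambda>x. (complex_of_real s * t) * h x"
    have "0 \<le> (L2_norm N (\<lambda>x. f x - ?g x))\<^sup>2" by simp
    also have "\<dots> = A - 2 * Re (L2_inner N f ?g) + (L2_norm N ?g)\<^sup>2"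
      unfolding A_def by (rule L2_norm_diff_sq) (use assms L2_scale in auto)
    also have "L2_inner N f ?g = complex_of_real (s * (cmod t)\<^sup>2)"
      unfolding L2_inner_scale_right t_def[symmetric]
      by (simp add: complex_norm_square del: of_real_power)
    also have "(L2_norm N ?g)\<^sup>2 = s\<^sup>2 * (cmod t)\<^sup>2 * B"
      unfolding L2_norm_scale B_def by (simp add: norm_mult power_mult_distrib)
    finally show ?thesis by simp
  qed
  have "(cmod t)\<^sup>2 \<le> A * B"
  proof (cases "B = 0")
    case True
    have "(cmod t)\<^sup>2 = 0"
    proof (rule ccontr)
      assume "(cmod t)\<^sup>2 \<noteq> 0"
      \<comment> \<open>For \<open>B = 0\<close> the polynomial is affine in \<open>s\<close>; at
        this \<open>s\<close> it equals \<open>A - 2 * (A + 1)\<close>, which is negative.\<close>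
      then show False using main[of "(A + 1) / (cmod t)\<^sup>2"] True
        by (simp add: A_def) (smt (verit) zero_le_power2)
    qed
    then show ?thesis using True by simp
  next
    case False
    then have "B > 0" by (simp add: B_def)
    then show ?thesis using main[of "1 / B"] by (simp add: field_simps power2_eq_square)
  qed
  then have "cmod t \<le> sqrt (A * B)" using real_le_rsqrt by blast
  then show ?thesis by (simp add: t_def A_def B_def real_sqrt_mult L2_norm_nonneg)
qed


section \<open>Series in norm and orthonormal sequences\<close>

lemma L2_sums_inner:
  assumes "L2_sums N F s" "h \<in> L2 N"
  shows "(\<lambda>j. L2_inner N (F j) h) sums L2_inner N s h"
proof -
  have F: "\<And>j. F j \<in> L2 N" and s: "s \<in> L2 N"
    and lim: "(\<lambda>n. L2_norm N (\<lambda>x. s x - (\<Sum>j<n. F j x))) \<longlonglongrightarrow> 0"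
    using assms(1) by (auto simp: L2_sums_def)
  have "(\<lambda>n. L2_inner N s h - (\<Sum>j<n. L2_inner N (F j) h)) \<longlonglongrightarrow> 0"
  proof (rule Lim_null_comparison)
    show "(\<lambda>n. L2_norm N (\<lambda>x. s x - (\<Sum>j<n. F j x)) * L2_norm N h) \<longlonglongrightarrow> 0"
      using tendsto_mult_right[OF lim, of "L2_norm N h"] by simp
    show "\<forall>\<^sub>F n in sequentially. norm (L2_inner N s h - (\<Sum>j<n. L2_inner N (F j) h))
        \<le> L2_norm N (\<lambda>x. s x - (\<Sum>j<n. F j x)) * L2_norm N h"
    proof (intro always_eventually allI)
      fix n
      have "L2_inner N s h - (\<Sum>j<n. L2_inner N (F j) h) = L2_inner N (\<lambda>x. s x - (\<Sum>j<n. F j x)) h"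
        using F s assms(2) by (simp add: L2_inner_diff L2_inner_sum L2_sum)
      then show "norm (L2_inner N s h - (\<Sum>j<n. L2_inner N (F j) h))
        \<le> L2_norm N (\<lambda>x. s x - (\<Sum>j<n. F j x)) * L2_norm N h"
        using L2_Cauchy_Schwarz[of "\<lambda>x. s x - (\<Sum>j<n. F j x)" N h] F s assms(2)
        by (simp add: L2_diff L2_sum)
    qed
  qed
  then have "(\<lambda>n. L2_inner N s h - (L2_inner N s h - (\<Sum>j<n. L2_inner N (F j) h))) \<longlonglongrightarrow> L2_inner N s h - 0"
    by (intro tendsto_diff tendsto_const)
  then show ?thesis by (simp add: sums_def)
qed

lemma L2_sums_inner_right:
  assumes "L2_sums N F s" "h \<in> L2 N"
  shows "(\<lambda>j. L2_inner N h (F j)) sums L2_inner N h s"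
  using L2_sums_inner[OF assms] unfolding L2_inner_commute[of N h] sums_cnj .

text \<open>Completeness is left out on purpose: the main instance is the sequence \<Phi>, from
  which the basis functions vanishing at \<open>p\<close> have been discarded.\<close>

definition orthonormal_seq :: "'a measure \<Rightarrow> (nat \<Rightarrow> 'a \<Rightarrow> complex) \<Rightarrow> bool" where
  "orthonormal_seq N e \<longleftrightarrow>
     (\<forall>j. e j \<in> L2 N) \<and> (\<forall>i j. L2_inner N (e i) (e j) = (if i = j then 1 else 0))"

lemma orthonormal_norm_sum:
  assumes "finite I" and e: "\<And>i. i \<in> I \<Longrightarrow> e i \<in> L2 N"
    and inner: "\<And>i j. i \<in> I \<Longrightarrow> j \<in> I \<Longrightarrow> L2_inner N (e i) (e j) = (if i = j then 1 else 0)"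
  shows "(L2_norm N (\<lambda>x. \<Sum>j\<in>I. c j * e j x))\<^sup>2 = (\<Sum>j\<in>I. (cmod (c j))\<^sup>2)"
proof -
  have "L2_inner N (e i) (\<lambda>x. \<Sum>j\<in>I. c j * e j x) = cnj (c i)" if "i \<in> I" for i
  proof -
    have "L2_inner N (\<lambda>x. \<Sum>j\<in>I. c j * e j x) (e i) = (\<Sum>j\<in>I. if j = i then c j else 0)"
      using e inner that by (subst L2_inner_sum) (auto simp: L2_scale L2_inner_scale intro!: sum.cong)
    also have "\<dots> = c i" using that assms(1) by simp
    finally show ?thesis by (metis L2_inner_commute)
  qed
  then have "L2_inner N (\<lambda>x. \<Sum>j\<in>I. c j * e j x) (\<lambda>x. \<Sum>j\<in>I. c j * e j x) = (\<Sum>j\<in>I. c j * cnj (c j))"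
    using e by (subst L2_inner_sum) (auto simp: L2_scale L2_inner_scale L2_sum intro!: sum.cong)
  also have "\<dots> = complex_of_real (\<Sum>j\<in>I. (cmod (c j))\<^sup>2)"
    unfolding of_real_sum complex_norm_square ..
  finally show ?thesis unfolding L2_inner_self of_real_eq_iff .
qed

text \<open>Expanding the squared distance from \<open>f\<close> to \<open>?s\<close> gives the
  difference of the two sides. The index type is arbitrary so that a finite subset of an orthonormal
  basis can be indexed by its own elements.\<close>

lemma Bessel_finite:
  assumes "finite I" and e: "\<And>i. i \<in> I \<Longrightarrow> e i \<in> L2 N"
    and inner: "\<And>i j. i \<in> I \<Longrightarrow> j \<in> I \<Longrightarrow> L2_inner N (e i) (e j) = (if i = j then 1 else 0)"
    and f: "f \<in> L2 N"
  shows "(\<Sum>j\<in>I. (cmod (L2_inner N f (e j)))\<^sup>2) \<le> (L2_norm N f)\<^sup>2"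
proof -
  let ?c = "\<lambda>j. L2_inner N f (e j)"
  let ?s = "\<lambda>x. \<Sum>j\<in>I. ?c j * e j x"
  have s: "?s \<in> L2 N" using e by (intro L2_sum L2_scale)
  have "L2_inner N ?s f = (\<Sum>j\<in>I. ?c j * cnj (?c j))"
    using e f L2_inner_commute[of N _ f]
    by (subst L2_inner_sum) (auto simp: L2_scale L2_inner_scale intro!: sum.cong)
  also have "\<dots> = complex_of_real (\<Sum>j\<in>I. (cmod (?c j))\<^sup>2)"
    unfolding of_real_sum complex_norm_square ..
  finally have "Re (L2_inner N f ?s) = (\<Sum>j\<in>I. (cmod (?c j))\<^sup>2)"
    by (simp add: L2_inner_commute[of N f ?s])
  moreover have "0 \<le> (L2_norm N f)\<^sup>2 - 2 * Re (L2_inner N f ?s) + (L2_norm N ?s)\<^sup>2"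
    unfolding L2_norm_diff_sq[OF f s, symmetric] by simp
  moreover have "(L2_norm N ?s)\<^sup>2 = (\<Sum>j\<in>I. (cmod (?c j))\<^sup>2)"
    by (rule orthonormal_norm_sum[OF assms(1) e inner])
  ultimately show ?thesis by linarith
qed

lemma Bessel:
  assumes "orthonormal_seq N e" "f \<in> L2 N"
  shows "summable (\<lambda>j. (cmod (L2_inner N f (e j)))\<^sup>2)"
proof (rule bounded_imp_summable[where B = "(L2_norm N f)\<^sup>2"])
  show "(\<Sum>j\<le>n. (cmod (L2_inner N f (e j)))\<^sup>2) \<le> (L2_norm N f)\<^sup>2" for n
    using assms by (intro Bessel_finite) (auto simp: orthonormal_seq_def)
qed simp

lemma L2_sums_orthonormal_coeff:
  assumes "orthonormal_seq N e" "L2_sums N (\<lambda>j x. c j * e j x) f"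
  shows "L2_inner N f (e i) = c i"
proof -
  have e: "\<And>j. e j \<in> L2 N" "\<And>i j. L2_inner N (e i) (e j) = (if i = j then 1 else 0)"
    using assms(1) by (auto simp: orthonormal_seq_def)
  have "(\<lambda>j. L2_inner N (\<lambda>x. c j * e j x) (e i)) sums L2_inner N f (e i)"
    using L2_sums_inner[OF assms(2) e(1)] .
  moreover have "(\<lambda>j. L2_inner N (\<lambda>x. c j * e j x) (e i)) = (\<lambda>j. if j = i then c j else 0)"
    unfolding L2_inner_scale e(2) by auto
  ultimately have "(\<lambda>j. if j = i then c j else 0) sums L2_inner N f (e i)" by metis
  with sums_single[of i c] show ?thesis using sums_unique2 by blast
qed

lemma L2_sums_Parseval:
  assumes "orthonormal_seq N e" "L2_sums N (\<lambda>j x. c j * e j x) f"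
  shows "(\<lambda>j. (cmod (c j))\<^sup>2) sums (L2_norm N f)\<^sup>2"
proof -
  have f: "f \<in> L2 N" using assms(2) by (simp add: L2_sums_def)
  have "L2_inner N (\<lambda>x. c j * e j x) f = complex_of_real ((cmod (c j))\<^sup>2)" for j
    unfolding L2_inner_scale L2_inner_commute[of N "e j" f] L2_sums_orthonormal_coeff[OF assms]
    by (rule complex_norm_square[symmetric, unfolded of_real_power[symmetric]])
  then have "(\<lambda>j. complex_of_real ((cmod (c j))\<^sup>2)) sums complex_of_real ((L2_norm N f)\<^sup>2)"
    using L2_sums_inner[OF assms(2) f] by (simp only: L2_inner_self)
  then show ?thesis by (simp only: sums_of_real_iff)
qed

text \<open>Take \<open>h\<close> to be \<open>f - g\<close>. Since \<open>L2_sums\<close> fixes a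
  sum only up to a null set, identities between sums of series are obtained by testing against every
  \<open>h\<close>.\<close>

lemma L2_eq_AE_of_inner:
  assumes "f \<in> L2 N" "g \<in> L2 N" "\<And>h. h \<in> L2 N \<Longrightarrow> L2_inner N f h = L2_inner N g h"
  shows "AE x in N. f x = g x"
proof -
  have h: "(\<lambda>x. f x - g x) \<in> L2 N" using assms by (simp add: L2_diff)
  have "L2_inner N (\<lambda>x. f x - g x) (\<lambda>x. f x - g x) = 0"
    using assms h by (simp add: L2_inner_diff)
  then have "(L2_norm N (\<lambda>x. f x - g x))\<^sup>2 = 0" by (simp add: L2_inner_self)
  then have "(\<integral>x. (cmod (f x - g x))\<^sup>2 \<partial>N) = 0" unfolding L2_norm_sq .
  then have "AE x in N. (cmod (f x - g x))\<^sup>2 = 0"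
    using h by (subst (asm) integral_nonneg_eq_0_iff_AE) (auto simp: L2_def)
  then show ?thesis by eventually_elim simp
qed

section \<open>Almost everywhere limits and completeness\<close>

lemma L2_norm_sq_nn_integral:
  assumes "f \<in> L2 N"
  shows "(\<integral>\<^sup>+x. ennreal ((cmod (f x))\<^sup>2) \<partial>N) = ennreal ((L2_norm N f)\<^sup>2)"
  unfolding L2_norm_sq using assms by (intro nn_integral_eq_integral) (auto simp: L2_def)

text \<open>Fatou's lemma for the squared moduli. Asking for the bound only eventually suits
  differences of a subsequence with a fixed partial sum, which are controlled once the subsequence
  has passed it.\<close>

lemma L2_Fatou:
  fixes s :: "nat \<Rightarrow> 'a \<Rightarrow> complex"
  assumes s: "\<And>k. s k \<in> L2 N" and f: "f \<in> borel_measurable N"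
    and lim: "AE x in N. (\<lambda>k. s k x) \<longlonglongrightarrow> f x"
    and bound: "\<forall>\<^sub>F k in sequentially. (L2_norm N (s k))\<^sup>2 \<le> C" and C: "C \<ge> 0"
  shows "f \<in> L2 N" "(L2_norm N f)\<^sup>2 \<le> C"
proof -
  have sm: "s k \<in> borel_measurable N" for k using s by (auto simp: L2_def)
  have "(\<integral>\<^sup>+x. ennreal ((cmod (f x))\<^sup>2) \<partial>N)
      = (\<integral>\<^sup>+x. liminf (\<lambda>k. ennreal ((cmod (s k x))\<^sup>2)) \<partial>N)"
  proof (rule nn_integral_cong_AE)
    show "AE x in N. ennreal ((cmod (f x))\<^sup>2) = liminf (\<lambda>k. ennreal ((cmod (s k x))\<^sup>2))"
      using lim
    proof eventually_elim
      case (elim x)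
      then have "(\<lambda>k. ennreal ((cmod (s k x))\<^sup>2)) \<longlonglongrightarrow> ennreal ((cmod (f x))\<^sup>2)"
        by (intro tendsto_ennrealI tendsto_intros)
      from lim_imp_Liminf[OF sequentially_bot this] show ?case by simp
    qed
  qed
  also have "\<dots> \<le> liminf (\<lambda>k. \<integral>\<^sup>+x. ennreal ((cmod (s k x))\<^sup>2) \<partial>N)"
    using sm by (intro nn_integral_liminf) auto
  also have "\<dots> = liminf (\<lambda>k. ennreal ((L2_norm N (s k))\<^sup>2))"
    using s by (simp add: L2_norm_sq_nn_integral)
  also have "\<dots> \<le> ennreal C"
    using bound by (intro Liminf_le) (auto elim: eventually_mono simp: ennreal_leI)
  finally have le: "(\<integral>\<^sup>+x. ennreal ((cmod (f x))\<^sup>2) \<partial>N) \<le> ennreal C" .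
  have "integrable N (\<lambda>x. (cmod (f x))\<^sup>2)"
    using f le by (intro integrableI_nonneg) (auto simp: top.extremum_strict intro: order.strict_trans1)
  then show "f \<in> L2 N" using f by (auto simp: L2_def)
  then show "(L2_norm N f)\<^sup>2 \<le> C" using le C by (simp add: L2_norm_sq_nn_integral)
qed

text \<open>A sequence with rapidly shrinking increments converges almost everywhere, since
  \<open>2 |h| \<le> 2\<^sup>-\<^sup>k + 2\<^sup>k |h|\<^sup>2\<close>.\<close>

lemma L2_AE_convergent:
  fixes s :: "nat \<Rightarrow> 'a \<Rightarrow> complex"
  assumes s: "\<And>k. s k \<in> L2 N"
    and inc: "\<And>k. (L2_norm N (\<lambda>x. s (Suc k) x - s k x))\<^sup>2 \<le> (1/4) ^ k"
  shows "AE x in N. convergent (\<lambda>k. s k x)"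
proof -
  define h where "h k x = s (Suc k) x - s k x" for k x
  have h: "h k \<in> L2 N" for k unfolding h_def[abs_def] using s by (intro L2_diff)
  then have hm: "h k \<in> borel_measurable N" for k by (auto simp: L2_def)
  \<comment> \<open>The weight \<open>2 ^ k\<close> turns the increments \<open>(1/4) ^ k\<close>
    into the still summable \<open>(1/2) ^ k\<close>; a finite integral makes the weighted sum
    finite almost everywhere.\<close>
  have "(\<integral>\<^sup>+x. (\<Sum>k. ennreal (2 ^ k * (cmod (h k x))\<^sup>2)) \<partial>N)
      = (\<Sum>k. \<integral>\<^sup>+x. ennreal (2 ^ k * (cmod (h k x))\<^sup>2) \<partial>N)"
    using hm by (intro nn_integral_suminf) auto
  also have "\<dots> \<le> (\<Sum>k. ennreal ((1/2) ^ k))"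
  proof (intro suminf_le allI summableI)
    fix k
    have "(\<integral>\<^sup>+x. ennreal (2 ^ k * (cmod (h k x))\<^sup>2) \<partial>N)
        = ennreal (2 ^ k) * (\<integral>\<^sup>+x. ennreal ((cmod (h k x))\<^sup>2) \<partial>N)"
      using hm by (subst nn_integral_cmult[symmetric]) (auto simp: ennreal_mult)
    also have "\<dots> = ennreal (2 ^ k * (L2_norm N (h k))\<^sup>2)"
      using h by (simp add: L2_norm_sq_nn_integral ennreal_mult)
    also have "\<dots> \<le> ennreal (2 ^ k * (1/4) ^ k)"
      using inc by (intro ennreal_leI mult_left_mono) (auto simp: h_def[abs_def])
    also have "2 ^ k * (1/4) ^ k = ((1/2) ^ k :: real)"
      by (simp add: power_mult_distrib[symmetric])
    finally show "(\<integral>\<^sup>+x. ennreal (2 ^ k * (cmod (h k x))\<^sup>2) \<partial>N) \<le> ennreal ((1/2) ^ k)" .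
  qed
  also have "\<dots> = ennreal (\<Sum>k. (1/2) ^ k)"
    by (intro suminf_ennreal2 summable_geometric) auto
  also have "\<dots> < \<infinity>" by simp
  finally have fin: "(\<integral>\<^sup>+x. (\<Sum>k. ennreal (2 ^ k * (cmod (h k x))\<^sup>2)) \<partial>N) \<noteq> \<infinity>" by simp
  have "AE x in N. (\<Sum>k. ennreal (2 ^ k * (cmod (h k x))\<^sup>2)) \<noteq> \<infinity>"
    using hm by (intro nn_integral_PInf_AE fin) auto
  then show ?thesis
  proof eventually_elim
    case (elim x)
    then have "summable (\<lambda>k. 2 ^ k * (cmod (h k x))\<^sup>2)"
      by (intro summable_suminf_not_top) auto
    moreover have "summable (\<lambda>k. (1/2) ^ k :: real)" by (intro summable_geometric) auto
    ultimately have "summable (\<lambda>k. (1/2) ^ k + 2 ^ k * (cmod (h k x))\<^sup>2)"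
      using summable_add by blast
    then have "summable (\<lambda>k. h k x)"
    proof (rule summable_comparison_test')
      fix k
      define t where "t = cmod (h k x)"
      have "0 \<le> 2 ^ k * (1 / 2 ^ k - t)\<^sup>2 + 1 / 2 ^ k + 2 ^ k * t\<^sup>2" by simp
      also have "\<dots> = 2 * ((1 / 2 ^ k) + 2 ^ k * t\<^sup>2) - 2 * t"
        by (simp add: power2_eq_square field_simps)
      finally show "cmod (h k x) \<le> (1/2) ^ k + 2 ^ k * (cmod (h k x))\<^sup>2"
        by (simp add: t_def power_one_over)
    qed
    then have "convergent (\<lambda>n. \<Sum>k<n. h k x)" by (simp add: summable_iff_convergent)
    moreover have "(\<Sum>k<n. h k x) = s n x - s 0 x" for n
      unfolding h_def by (rule sum_lessThan_telescope)
    ultimately show ?case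
      using convergent_add[of "\<lambda>n. s n x - s 0 x" "\<lambda>n. s 0 x"] by (simp add: convergent_const)
  qed
qed

text \<open>The tails \<open>T n\<close> dominate all later increments of the partial sums. A
  subsequence with tails at most \<open>(1/4) ^ k\<close> converges almost everywhere, and Fatou
  places its limit within \<open>sqrt (T m)\<close> of the \<open>m\<close>-th partial sum, for
  every \<open>m\<close>; so the whole sequence converges in norm.\<close>

lemma Riesz_Fischer:
  assumes e: "orthonormal_seq N e" and c: "summable (\<lambda>j. (cmod (c j))\<^sup>2)"
  shows "\<exists>f. L2_sums N (\<lambda>j x. c j * e j x) f"
proof -
  have eL: "\<And>j. e j \<in> L2 N" using e by (auto simp: orthonormal_seq_def)
  define S where "S n x = (\<Sum>j<n. c j * e j x)" for n x
  have S: "S n \<in> L2 N" for n unfolding S_def[abs_def] using eL by (intro L2_sum L2_scale)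
  define T where "T n = (\<Sum>j. (cmod (c (j + n)))\<^sup>2)" for n
  have T0: "T n \<ge> 0" for n
    unfolding T_def by (intro suminf_nonneg summable_ignore_initial_segment c) auto
  have Tlim: "T \<longlonglongrightarrow> 0" unfolding T_def by (rule suminf_exist_split2[OF c])
  have diff: "(L2_norm N (\<lambda>x. S m x - S n x))\<^sup>2 \<le> T n" if "n \<le> m" for m n
  proof -
    have "S m x - S n x = (\<Sum>j\<in>{n..<m}. c j * e j x)" for x
      unfolding S_def by (metis sum_diff_nat_ivl lessThan_atLeast0 that zero_le)
    then have "(L2_norm N (\<lambda>x. S m x - S n x))\<^sup>2 = (\<Sum>j\<in>{n..<m}. (cmod (c j))\<^sup>2)"
      using orthonormal_norm_sum[of "{n..<m}" e N c] e by (simp add: orthonormal_seq_def)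
    also have "\<dots> = (\<Sum>j<m - n. (cmod (c (j + n)))\<^sup>2)"
      using sum.shift_bounds_nat_ivl[of "\<lambda>j. (cmod (c j))\<^sup>2" 0 n "m - n"] that
      by (simp add: atLeast0LessThan)
    also have "\<dots> \<le> T n"
      unfolding T_def by (intro sum_le_suminf summable_ignore_initial_segment c) auto
    finally show ?thesis .
  qed
  have "\<exists>n. \<forall>k. (T (n k) \<le> (1/4) ^ k) \<and> n k < n (Suc k)"
  proof (rule dependent_nat_choice)
    have ex: "\<exists>n>m. T n \<le> (1/4) ^ k" for m k
    proof -
      have "\<forall>\<^sub>F n in sequentially. T n < (1/4) ^ k"
        using order_tendstoD(2)[OF Tlim, of "(1/4) ^ k"] by simp
      then have "\<forall>\<^sub>F n in sequentially. T n < (1/4) ^ k \<and> n > m"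
        using eventually_gt_at_top[of m] by eventually_elim simp
      then show ?thesis using eventually_happens'[OF sequentially_bot] less_imp_le by blast
    qed
    show "\<exists>n. T n \<le> (1/4) ^ 0" using ex by blast
    show "\<exists>n'. T n' \<le> (1/4) ^ Suc k \<and> n < n'" for n k using ex by blast
  qed
  then obtain n where n: "\<And>k. T (n k) \<le> (1/4) ^ k" "\<And>k. n k < n (Suc k)" by blast
  then have mono: "strict_mono n" by (simp add: strict_mono_Suc_iff)
  \<comment> \<open>Where the subsequence diverges, \<open>lim\<close> has an unspecified value;
    this happens only on a null set.\<close>
  define f where "f x = lim (\<lambda>k. S (n k) x)" for x
  have "AE x in N. convergent (\<lambda>k. S (n k) x)"
    using S by (intro L2_AE_convergent order_trans[OF diff n(1)]) (auto simp: n(2) less_imp_le)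
  then have flim: "AE x in N. (\<lambda>k. S (n k) x) \<longlonglongrightarrow> f x"
    by eventually_elim (simp add: f_def convergent_LIMSEQ_iff)
  have fm: "f \<in> borel_measurable N"
    unfolding f_def[abs_def] using S by (intro borel_measurable_lim_metric) (auto simp: L2_def)
  have main: "(\<lambda>x. f x - S m x) \<in> L2 N \<and> (L2_norm N (\<lambda>x. f x - S m x))\<^sup>2 \<le> T m" for m
  proof -
    have "\<forall>\<^sub>F k in sequentially. m \<le> n k"
      using mono by (metis eventually_sequentially le_trans seq_suble)
    then have *: "\<forall>\<^sub>F k in sequentially. (L2_norm N (\<lambda>x. S (n k) x - S m x))\<^sup>2 \<le> T m"
      by eventually_elim (rule diff)
    have "AE x in N. (\<lambda>k. S (n k) x - S m x) \<longlonglongrightarrow> f x - S m x"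
      using flim by eventually_elim (intro tendsto_intros)
    moreover have "(\<lambda>x. f x - S m x) \<in> borel_measurable N"
      using fm S[of m] by (auto simp: L2_def)
    ultimately show ?thesis
      using L2_Fatou[of "\<lambda>k x. S (n k) x - S m x" N "\<lambda>x. f x - S m x" "T m"] S * T0
      by (auto simp: L2_diff)
  qed
  have "f \<in> L2 N" using L2_add[OF conjunct1[OF main[of 0]] S[of 0]] by simp
  moreover have "(\<lambda>m. L2_norm N (\<lambda>x. f x - S m x)) \<longlonglongrightarrow> 0"
  proof (rule Lim_null_comparison)
    show "\<forall>\<^sub>F m in sequentially. norm (L2_norm N (\<lambda>x. f x - S m x)) \<le> sqrt (T m)"
      using main by (auto intro!: always_eventually real_le_rsqrt simp: L2_norm_nonneg)
    show "(\<lambda>m. sqrt (T m)) \<longlonglongrightarrow> 0" using tendsto_real_sqrt[OF Tlim] by simp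
  qed
  ultimately show ?thesis
    unfolding L2_sums_def S_def using eL by (intro exI[of _ f]) (simp add: L2_scale)
qed

section \<open>Exchange of limit and sum\<close>

text \<open>If the sums tended to some \<open>d\<close> other than 0, one could pick rows whose mass
  sits essentially in disjoint consecutive blocks of columns. Let \<open>S\<close> consist of every
  other block: along the chosen rows the sums over \<open>S\<close> are alternately close to
  \<open>d\<close> and to 0, against their convergence. Convergence for all \<open>S\<close> thus
  takes the place of a uniform bound on the rows.\<close>

lemma gliding_hump:
  fixes z :: "nat \<Rightarrow> nat \<Rightarrow> complex"
  assumes sum: "\<And>n. summable (\<lambda>j. cmod (z n j))"
    and coord: "\<And>j. (\<lambda>n. z n j) \<longlonglongrightarrow> 0"
    and conv: "\<And>S. convergent (\<lambda>n. \<Sum>j. if j \<in> S then z n j else 0)"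
  shows "(\<lambda>n. \<Sum>j. z n j) \<longlonglongrightarrow> 0"
proof -
  obtain d where d: "(\<lambda>n. \<Sum>j. z n j) \<longlonglongrightarrow> d"
    using conv[of UNIV] by (auto simp: convergent_def)
  have "d = 0"
  proof (rule ccontr)
    assume "d \<noteq> 0"
    \<comment> \<open>The errors in the final comparison add up to less than seven
      \<epsilon>.\<close>
    define \<epsilon> where "\<epsilon> = cmod d / 8"
    have \<epsilon>: "\<epsilon> > 0" using \<open>d \<noteq> 0\<close> by (simp add: \<epsilon>_def)
    \<comment> \<open>A state holds the last row used and the column where the next block begins. A
      step selects a later row with little mass before that column, then a column after which this
      row has little mass.\<close>
    define P where "P = (\<lambda>(m::nat, N::nat) (n, N'::nat). m < n \<and> N < N' \<and>
        (\<Sum>j<N. cmod (z n j)) < \<epsilon> \<and> (\<Sum>j. cmod (z n (j + N'))) < \<epsilon> \<and> cmod ((\<Sum>j. z n j) - d) < \<epsilon>)"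
    have "\<exists>y. P x y" for x
    proof -
      obtain m N where x: "x = (m, N)" by fastforce
      have "(\<lambda>n. \<Sum>j<N. cmod (z n j)) \<longlonglongrightarrow> (\<Sum>j<N. 0)"
        using coord by (intro tendsto_sum tendsto_norm_zero) auto
      then have "\<forall>\<^sub>F n in sequentially. (\<Sum>j<N. cmod (z n j)) < \<epsilon>"
        using \<epsilon> by (intro order_tendstoD(2)) auto
      moreover have "\<forall>\<^sub>F n in sequentially. cmod ((\<Sum>j. z n j) - d) < \<epsilon>"
        using tendstoD[OF d \<epsilon>] by (simp add: dist_norm)
      ultimately have "\<forall>\<^sub>F n in sequentially. m < n \<and> (\<Sum>j<N. cmod (z n j)) < \<epsilon> \<and> cmod ((\<Sum>j. z n j) - d) < \<epsilon>"
        using eventually_gt_at_top[of m] by eventually_elim simp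
      then obtain n where n: "m < n" "(\<Sum>j<N. cmod (z n j)) < \<epsilon>" "cmod ((\<Sum>j. z n j) - d) < \<epsilon>"
        using eventually_happens'[OF sequentially_bot] by blast
      have "\<forall>\<^sub>F N' in sequentially. (\<Sum>j. cmod (z n (j + N'))) < \<epsilon>"
        using suminf_exist_split2[OF sum] \<epsilon> by (intro order_tendstoD(2)) auto
      then have "\<forall>\<^sub>F N' in sequentially. N < N' \<and> (\<Sum>j. cmod (z n (j + N'))) < \<epsilon>"
        using eventually_gt_at_top[of N] by eventually_elim simp
      then obtain N' where "N < N'" "(\<Sum>j. cmod (z n (j + N'))) < \<epsilon>"
        using eventually_happens'[OF sequentially_bot] by blast
      with n x show ?thesis by (auto simp: P_def)
    qed
    then have "\<exists>g. \<forall>k. P (g k) (g (Suc k))"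
      by (intro dependent_nat_choice[where P = "\<lambda>_ _. True" and Q = "\<lambda>_. P", simplified]) auto
    then obtain g where g: "\<And>k. P (g k) (g (Suc k))" by blast
    \<comment> \<open>The shift pairs row \<open>n k\<close> with the block from \<open>N k\<close>
      up to \<open>N (Suc k)\<close>, since a state stores its row together with the end of that
      row's block.\<close>
    define n N where "n k = fst (g (Suc k))" and "N k = snd (g k)" for k
    have gl: "n k < n (Suc k)" "N k < N (Suc k)" "(\<Sum>j<N k. cmod (z (n k) j)) < \<epsilon>"
      "(\<Sum>j. cmod (z (n k) (j + N (Suc k)))) < \<epsilon>" "cmod ((\<Sum>j. z (n k) j) - d) < \<epsilon>" for k
      using g[of k] g[of "Suc k"] by (auto simp: P_def n_def N_def split: prod.splits)
    have nm: "strict_mono n" and Nm: "strict_mono N"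
      using gl by (auto simp: strict_mono_Suc_iff)
    define S where "S = (\<Union>k. {N (2 * k)..<N (Suc (2 * k))})"
    let ?s = "\<lambda>n. \<Sum>j. if j \<in> S then z n j else 0"
    have block: "j \<in> S \<longleftrightarrow> even k" if "N k \<le> j" "j < N (Suc k)" for j k
    proof
      assume "j \<in> S"
      then obtain i where i: "N (2 * i) \<le> j" "j < N (Suc (2 * i))" by (auto simp: S_def)
      have "2 * i < Suc k" using i(1) that(2) Nm by (metis le_less_trans strict_mono_less)
      moreover have "k < Suc (2 * i)" using i(2) that(1) Nm by (metis le_less_trans strict_mono_less)
      ultimately show "even k" by (metis dvd_triv_left less_Suc_eq not_less_eq)
    next
      assume "even k"
      then show "j \<in> S" using that by (auto simp: S_def elim!: evenE)
    qed
    have est: "cmod (?s (n k) - (if even k then (\<Sum>j. z (n k) j) else 0)) \<le> 2 * \<epsilon>" for k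
    proof -
      let ?z = "z (n k)"
      let ?a = "\<lambda>j. if j \<in> S then ?z j else 0"
      let ?b = "\<lambda>j. if even k then ?z j else 0"
      have sz: "summable ?z" "summable (\<lambda>j. cmod (?z j))" using sum summable_norm_cancel by blast+
      have sa: "summable ?a" "summable ?b"
        using sz(1) by (auto intro!: summable_comparison_test'[OF sz(2), of 0])
      have sab: "summable (\<lambda>j. cmod (?a j - ?b j))"
        by (intro summable_comparison_test'[OF sz(2), of 0]) auto
      have "?s (n k) - (if even k then (\<Sum>j. z (n k) j) else 0) = (\<Sum>j. ?a j - ?b j)"
        using suminf_diff[OF sa] by auto
      also have "cmod \<dots> \<le> (\<Sum>j. cmod (?a j - ?b j))" by (rule summable_norm[OF sab])
      also have "\<dots> = (\<Sum>j. cmod (?a (j + N (Suc k)) - ?b (j + N (Suc k)))) + (\<Sum>j<N (Suc k). cmod (?a j - ?b j))"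
        by (rule suminf_split_initial_segment[OF sab])
      also have "(\<Sum>j. cmod (?a (j + N (Suc k)) - ?b (j + N (Suc k)))) \<le> (\<Sum>j. cmod (?z (j + N (Suc k))))"
        using summable_ignore_initial_segment[OF sab, of "N (Suc k)"]
          summable_ignore_initial_segment[OF sz(2), of "N (Suc k)"]
        by (intro suminf_le) auto
      also have "(\<Sum>j<N (Suc k). cmod (?a j - ?b j)) \<le> (\<Sum>j<N k. cmod (?z j))"
      proof -
        have "(\<Sum>j<N (Suc k). cmod (?a j - ?b j)) = (\<Sum>j<N k. cmod (?a j - ?b j))"
          using block[of k] gl(2)[of k] by (intro sum.mono_neutral_right) auto
        also have "\<dots> \<le> (\<Sum>j<N k. cmod (?z j))" by (intro sum_mono) auto
        finally show ?thesis .
      qed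
      finally show ?thesis using gl(3,4)[of k] by linarith
    qed
    obtain l where l: "?s \<longlonglongrightarrow> l" using conv[of S] by (auto simp: convergent_def)
    have "\<forall>\<^sub>F m in sequentially. cmod (?s m - l) < \<epsilon>" using tendstoD[OF l \<epsilon>] by (simp add: dist_norm)
    then obtain m0 where m0: "\<And>m. m \<ge> m0 \<Longrightarrow> cmod (?s m - l) < \<epsilon>"
      unfolding eventually_sequentially by blast
    \<comment> \<open>An even index, so that \<open>k\<close> and \<open>Suc k\<close> are of
      opposite parity, and large enough for both rows to lie beyond \<open>m0\<close>.\<close>
    define k where "k = 2 * m0"
    have "m0 \<le> n k" "m0 \<le> n (Suc k)" using seq_suble[OF nm, of k] seq_suble[OF nm, of "Suc k"] by (auto simp: k_def)
    then have 1: "cmod (?s (n k) - l) < \<epsilon>" "cmod (?s (n (Suc k)) - l) < \<epsilon>" using m0 by auto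
    have 2: "cmod (?s (n k) - (\<Sum>j. z (n k) j)) \<le> 2 * \<epsilon>" using est[of k] by (simp add: k_def)
    have 3: "cmod (?s (n (Suc k))) \<le> 2 * \<epsilon>" using est[of "Suc k"] by (simp add: k_def)
    have tri: "cmod d \<le> cmod u + cmod (u - l) + cmod (v - l) + cmod (v - w) + cmod (w - d)" for u v w
    proof -
      have eq: "u - (u - l) + (v - l) - (v - w) - (w - d) = d" by (simp add: algebra_simps)
      have "cmod (u - (u - l) + (v - l) - (v - w) - (w - d))
          \<le> cmod u + cmod (u - l) + cmod (v - l) + cmod (v - w) + cmod (w - d)"
        using norm_triangle_ineq4[of "u - (u - l) + (v - l) - (v - w)" "w - d"]
          norm_triangle_ineq4[of "u - (u - l) + (v - l)" "v - w"]
          norm_triangle_ineq[of "u - (u - l)" "v - l"] norm_triangle_ineq4[of u "u - l"] by linarith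
      then show ?thesis unfolding eq .
    qed
    have "cmod d < 8 * \<epsilon>"
      using tri[of "?s (n (Suc k))" "?s (n k)" "\<Sum>j. z (n k) j"] 1 2 3 gl(5)[of k] \<epsilon> by linarith
    then show False by (simp add: \<epsilon>_def)
  qed
  with d show ?thesis by simp
qed

section \<open>The real quadratic form inequality\<close>

text \<open>Let \<kappa> be the cubic with roots \<open>l1\<close>, \<open>l2\<close>,
  \<open>l3\<close>. For an affine polynomial \<open>q\<close>, partial fractions of
  \<open>q / \<kappa>\<close> have residues \<open>q(l_i) / \<kappa>'(l_i)\<close>, which sum to 0
  because of the degree. These residues are the solution, once \<open>q\<close> is chosen to take
  the values \<open>s * \<kappa> B\<close> at \<open>B\<close> and \<open>t * \<kappa> C\<close> at
  \<open>C\<close>.\<close>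

lemma cauchy_system_solvable:
  fixes l1 l2 l3 B C :: real
  assumes "l1 < B" "B < l2" "l2 < C" "C < l3"
  shows "\<exists>x1 x2 x3. x1 + x2 + x3 = 0 \<and>
    x1 / (B - l1) + x2 / (B - l2) + x3 / (B - l3) = s \<and>
    x1 / (C - l1) + x2 / (C - l2) + x3 / (C - l3) = t"
proof -
  \<comment> \<open>The reciprocals of the derivative of \<kappa> at its three roots.\<close>
  define y1 y2 y3 where "y1 = 1 / ((l2 - l1) * (l3 - l1))" and "y2 = 1 / ((l1 - l2) * (l3 - l2))"
    and "y3 = 1 / ((l1 - l3) * (l2 - l3))"
  define D where "D = (l2 - l1) * (l3 - l1) * (l3 - l2)"
  have ne: "l2 - l1 \<noteq> 0" "l3 - l1 \<noteq> 0" "l3 - l2 \<noteq> 0" using assms by auto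
  then have D: "D \<noteq> 0" by (simp add: D_def)
  have yD: "y1 = (l3 - l2) / D" "y2 = - (l3 - l1) / D" "y3 = (l2 - l1) / D"
    using ne unfolding y1_def y2_def y3_def D_def by (auto simp: divide_simps) (simp_all add: algebra_simps)
  have y0: "y1 + y2 + y3 = 0"
    unfolding yD using D by (simp add: divide_simps)
  have y1': "y1 * l1 + y2 * l2 + y3 * l3 = 0"
    unfolding yD using D by (simp add: divide_simps) (simp add: algebra_simps)
  define \<kappa> where "\<kappa> z = (z - l1) * (z - l2) * (z - l3)" for z
  have part: "y1 / (z - l1) + y2 / (z - l2) + y3 / (z - l3) = 1 / \<kappa> z" if "\<kappa> z \<noteq> 0" for z
  proof -
    have nz: "z - l1 \<noteq> 0" "z - l2 \<noteq> 0" "z - l3 \<noteq> 0" using that by (auto simp: \<kappa>_def)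
    have "y1 / (z - l1) + y2 / (z - l2) + y3 / (z - l3)
      = (y1 * ((z - l2) * (z - l3)) + y2 * ((z - l1) * (z - l3)) + y3 * ((z - l1) * (z - l2))) / \<kappa> z"
      using nz by (simp add: \<kappa>_def divide_simps) (simp add: algebra_simps)
    also have "y1 * ((z - l2) * (z - l3)) + y2 * ((z - l1) * (z - l3)) + y3 * ((z - l1) * (z - l2))
      = ((l3 - l2) * ((z - l2) * (z - l3)) - (l3 - l1) * ((z - l1) * (z - l3)) + (l2 - l1) * ((z - l1) * (z - l2))) / D"
      unfolding yD using D by (simp add: divide_simps) (simp add: algebra_simps)
    also have "\<dots> = 1"
      using D by (simp add: D_def) (simp add: algebra_simps)
    finally show ?thesis .
  qed
  have lin: "y1 * (l1 - v) / (z - l1) + y2 * (l2 - v) / (z - l2) + y3 * (l3 - v) / (z - l3) = (z - v) / \<kappa> z"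
    if "\<kappa> z \<noteq> 0" for z v
  proof -
    have nz: "z - l1 \<noteq> 0" "z - l2 \<noteq> 0" "z - l3 \<noteq> 0" using that by (auto simp: \<kappa>_def)
    have *: "y * (l - v) / (z - l) = (z - v) * (y / (z - l)) - y" if "z - l \<noteq> 0" for y l :: real
      using that by (simp add: field_simps)
    have "y1 * (l1 - v) / (z - l1) + y2 * (l2 - v) / (z - l2) + y3 * (l3 - v) / (z - l3)
      = (z - v) * (y1 / (z - l1) + y2 / (z - l2) + y3 / (z - l3)) - (y1 + y2 + y3)"
      unfolding *[OF nz(1)] *[OF nz(2)] *[OF nz(3)] by (simp add: algebra_simps)
    then show ?thesis using part[OF that] y0 by simp
  qed
  have \<kappa>: "\<kappa> B \<noteq> 0" "\<kappa> C \<noteq> 0" using assms by (auto simp: \<kappa>_def)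
  \<comment> \<open>Lagrange interpolation:
    \<open>q(z) = \<alpha> * (z - C) + \<beta> * (z - B)\<close>, and \<open>x y l\<close> below is
    the residue \<open>y * q(l)\<close>.\<close>
  define \<alpha> \<beta> where "\<alpha> = s * \<kappa> B / (B - C)" and "\<beta> = t * \<kappa> C / (C - B)"
  define x where "x y l = \<alpha> * (y * (l - C)) + \<beta> * (y * (l - B))" for y l :: real
  have xs: "x y1 l1 / (z - l1) + x y2 l2 / (z - l2) + x y3 l3 / (z - l3)
      = \<alpha> * ((z - C) / \<kappa> z) + \<beta> * ((z - B) / \<kappa> z)" if "\<kappa> z \<noteq> 0" for z
    unfolding x_def lin[OF that, symmetric]
    by (simp only: add_divide_distrib distrib_left times_divide_eq_right add_ac)
  have "x y1 l1 + x y2 l2 + x y3 l3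
      = (\<alpha> + \<beta>) * (y1 * l1 + y2 * l2 + y3 * l3) - (\<alpha> * C + \<beta> * B) * (y1 + y2 + y3)"
    by (simp add: x_def algebra_simps)
  then have "x y1 l1 + x y2 l2 + x y3 l3 = 0" using y0 y1' by simp
  moreover have "\<alpha> * ((B - C) / \<kappa> B) + \<beta> * ((B - B) / \<kappa> B) = s"
    "\<alpha> * ((C - C) / \<kappa> C) + \<beta> * ((C - B) / \<kappa> C) = t"
    using \<kappa> assms by (auto simp: \<alpha>_def \<beta>_def)
  ultimately show ?thesis using xs[OF \<kappa>(1)] xs[OF \<kappa>(2)] by metis
qed

text \<open>Dictionary: \<open>w j\<close> is the squared modulus of Phi_j(p), \<open>r j\<close>
  the coefficient of psi along Phi_j divided by conj(Phi_j(p)), \<open>N k\<close> the squared norm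
  of the eigenfunction G_k with eigenvalue \<open>l k\<close>, and \<open>C k\<close> its inner
  product with psi. For f = psi + sum_k x_k G_k the series is the inner product of (H - s) f and (H
  - t) f. The right side is diagonal in \<open>k\<close> because the G_k are orthogonal, and
  \<open>r0\<close>, which says psi(p) = 0, lets H be moved from psi onto G_k.\<close>

lemma sums_quadratic_expansion:
  fixes w E r l :: "nat \<Rightarrow> real" and K :: "nat set"
  assumes K: "finite K" and bc: "b \<noteq> c"
    and r: "\<And>j. j \<notin> {b, c} \<Longrightarrow> r j = 0" and r0: "w b * r b + w c * r c = 0"
    and El: "\<And>j k. k \<in> K \<Longrightarrow> E j \<noteq> l k"
    and orth: "\<And>k k'. k \<in> K \<Longrightarrow> k' \<in> K \<Longrightarrow> k \<noteq> k' \<Longrightarrow> (\<lambda>j. w j / ((E j - l k) * (E j - l k'))) sums 0"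
    and nrm: "\<And>k. k \<in> K \<Longrightarrow> (\<lambda>j. w j / (E j - l k)\<^sup>2) sums N k"
    and Ck: "\<And>k. k \<in> K \<Longrightarrow> C k = w b * r b / (E b - l k) + w c * r c / (E c - l k)"
  shows "(\<lambda>j. w j * ((E j - s) * r j + (\<Sum>k\<in>K. x k * (l k - s) / (E j - l k)))
                  * ((E j - t) * r j + (\<Sum>k\<in>K. x k * (l k - t) / (E j - l k))))
     sums ((E b - s) * (E b - t) * (w b * (r b)\<^sup>2) + (E c - s) * (E c - t) * (w c * (r c)\<^sup>2)
            + (\<Sum>k\<in>K. (l k - s) * (l k - t) * (2 * x k * C k + (x k)\<^sup>2 * N k)))"
proof -
  define g where "g k j = 1 / (E j - l k)" for k j
  have supp: "f sums (f b + f c)" if "\<And>j. j \<notin> {b, c} \<Longrightarrow> f j = 0" for f :: "nat \<Rightarrow> real"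
    using sums_finite[of "{b, c}" f] that bc by simp
  have cross: "(\<lambda>j. w j * (E j - v) * r j * g k j) sums ((l k - v) * C k)" if "k \<in> K" for k v
  proof -
    \<comment> \<open>The constant 1 contributes \<open>w b * r b + w c * r c\<close>, which
      vanishes by \<open>r0\<close>.\<close>
    have *: "(e - v) / (e - l k) = 1 + (l k - v) / (e - l k)" if "e \<noteq> l k" for e
      using that by (simp add: field_simps)
    have summand: "w j * (E j - v) * r j * g k j = w j * r j + (l k - v) * (w j * r j / (E j - l k))" for j
    proof -
      have "w j * (E j - v) * r j * g k j = w j * r j * ((E j - v) / (E j - l k))" by (simp add: g_def)
      also have "\<dots> = w j * r j + (l k - v) * (w j * r j / (E j - l k))"
        unfolding *[OF El[OF that]] by (simp add: algebra_simps)
      finally show ?thesis .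
    qed
    have "(\<lambda>j. w j * (E j - v) * r j * g k j) sums
        (w b * (E b - v) * r b * g k b + w c * (E c - v) * r c * g k c)"
      by (rule supp) (simp add: r)
    also have "w b * (E b - v) * r b * g k b + w c * (E c - v) * r c * g k c
        = (w b * r b + w c * r c) + (l k - v) * C k"
      unfolding summand Ck[OF that] by (simp add: algebra_simps)
    finally show ?thesis using r0 by simp
  qed
  have gg: "(\<lambda>j. w j * g k j * g k' j) sums (if k = k' then N k else 0)" if "k \<in> K" "k' \<in> K" for k k'
    using orth[OF that] nrm[OF that(1)] by (auto simp: g_def power2_eq_square)
  have "(\<lambda>j. w j * (E j - s) * (E j - t) * (r j)\<^sup>2
        + (\<Sum>k\<in>K. x k * (l k - t) * (w j * (E j - s) * r j * g k j))
        + (\<Sum>k\<in>K. x k * (l k - s) * (w j * (E j - t) * r j * g k j))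
        + (\<Sum>k\<in>K. \<Sum>k'\<in>K. x k * (l k - s) * (x k' * (l k' - t)) * (w j * g k j * g k' j)))
      sums (w b * (E b - s) * (E b - t) * (r b)\<^sup>2 + w c * (E c - s) * (E c - t) * (r c)\<^sup>2
        + (\<Sum>k\<in>K. x k * (l k - t) * ((l k - s) * C k))
        + (\<Sum>k\<in>K. x k * (l k - s) * ((l k - t) * C k))
        + (\<Sum>k\<in>K. \<Sum>k'\<in>K. x k * (l k - s) * (x k' * (l k' - t)) * (if k = k' then N k else 0)))"
    by (intro sums_add sums_sum sums_mult cross gg supp) (auto simp: r)
  also have "(\<lambda>j. w j * (E j - s) * (E j - t) * (r j)\<^sup>2
        + (\<Sum>k\<in>K. x k * (l k - t) * (w j * (E j - s) * r j * g k j))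
        + (\<Sum>k\<in>K. x k * (l k - s) * (w j * (E j - t) * r j * g k j))
        + (\<Sum>k\<in>K. \<Sum>k'\<in>K. x k * (l k - s) * (x k' * (l k' - t)) * (w j * g k j * g k' j)))
      = (\<lambda>j. w j * ((E j - s) * r j + (\<Sum>k\<in>K. x k * (l k - s) / (E j - l k)))
                  * ((E j - t) * r j + (\<Sum>k\<in>K. x k * (l k - t) / (E j - l k))))"
  proof
    fix j
    define U V where "U = (\<Sum>k\<in>K. x k * (l k - s) * g k j)" and "V = (\<Sum>k\<in>K. x k * (l k - t) * g k j)"
    have 1: "(\<Sum>k\<in>K. x k * (l k - t) * (w j * (E j - s) * r j * g k j)) = w j * (E j - s) * r j * V"
      "(\<Sum>k\<in>K. x k * (l k - s) * (w j * (E j - t) * r j * g k j)) = w j * (E j - t) * r j * U"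
      unfolding U_def V_def sum_distrib_left by (auto intro!: sum.cong simp: mult_ac)
    have 2: "(\<Sum>k\<in>K. \<Sum>k'\<in>K. x k * (l k - s) * (x k' * (l k' - t)) * (w j * g k j * g k' j)) = w j * (U * V)"
      unfolding U_def V_def sum_product unfolding sum_distrib_left by (auto intro!: sum.cong simp: mult_ac)
    have 3: "(\<Sum>k\<in>K. x k * (l k - s) / (E j - l k)) = U" "(\<Sum>k\<in>K. x k * (l k - t) / (E j - l k)) = V"
      by (auto simp: U_def V_def g_def)
    show "w j * (E j - s) * (E j - t) * (r j)\<^sup>2
        + (\<Sum>k\<in>K. x k * (l k - t) * (w j * (E j - s) * r j * g k j))
        + (\<Sum>k\<in>K. x k * (l k - s) * (w j * (E j - t) * r j * g k j))
        + (\<Sum>k\<in>K. \<Sum>k'\<in>K. x k * (l k - s) * (x k' * (l k' - t)) * (w j * g k j * g k' j))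
      = w j * ((E j - s) * r j + (\<Sum>k\<in>K. x k * (l k - s) / (E j - l k)))
                  * ((E j - t) * r j + (\<Sum>k\<in>K. x k * (l k - t) / (E j - l k)))"
      unfolding 1 2 3 by (simp add: algebra_simps power2_eq_square)
  qed
  also have "w b * (E b - s) * (E b - t) * (r b)\<^sup>2 + w c * (E c - s) * (E c - t) * (r c)\<^sup>2
        + (\<Sum>k\<in>K. x k * (l k - t) * ((l k - s) * C k))
        + (\<Sum>k\<in>K. x k * (l k - s) * ((l k - t) * C k))
        + (\<Sum>k\<in>K. \<Sum>k'\<in>K. x k * (l k - s) * (x k' * (l k' - t)) * (if k = k' then N k else 0))
     = (E b - s) * (E b - t) * (w b * (r b)\<^sup>2) + (E c - s) * (E c - t) * (w c * (r c)\<^sup>2)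
            + (\<Sum>k\<in>K. (l k - s) * (l k - t) * (2 * x k * C k + (x k)\<^sup>2 * N k))"
  proof -
    have "(\<Sum>k'\<in>K. x k * (l k - s) * (x k' * (l k' - t)) * (if k = k' then N k else 0))
        = x k * (l k - s) * (x k * (l k - t)) * N k" if "k \<in> K" for k
    proof -
      have "(\<Sum>k'\<in>K. x k * (l k - s) * (x k' * (l k' - t)) * (if k = k' then N k else 0))
        = (\<Sum>k'\<in>K. if k = k' then x k * (l k - s) * (x k * (l k - t)) * N k else 0)"
        by (intro sum.cong) auto
      then show ?thesis using K that by simp
    qed
    then have "(\<Sum>k\<in>K. \<Sum>k'\<in>K. x k * (l k - s) * (x k' * (l k' - t)) * (if k = k' then N k else 0))
        = (\<Sum>k\<in>K. x k * (l k - s) * (x k * (l k - t)) * N k)" by (intro sum.cong) auto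
    moreover have "(\<Sum>k\<in>K. (l k - s) * (l k - t) * (2 * x k * C k + (x k)\<^sup>2 * N k))
       = (\<Sum>k\<in>K. x k * (l k - t) * ((l k - s) * C k)) + (\<Sum>k\<in>K. x k * (l k - s) * ((l k - t) * C k))
         + (\<Sum>k\<in>K. x k * (l k - s) * (x k * (l k - t)) * N k)"
      unfolding sum.distrib[symmetric] by (intro sum.cong) (auto simp: algebra_simps power2_eq_square)
    ultimately show ?thesis by (simp add: mult_ac)
  qed
  finally show ?thesis .
qed

text \<open>The parabola \<open>(z - m)\<^sup>2 - D\<^sup>2\<close> is a convex combination of
  \<open>(z - Ea) * (z - Ed)\<close> and \<open>(z - s)\<^sup>2\<close>, where \<open>s\<close> is
  the outer level nearer to the middle gap. It takes the same value at \<open>Eb\<close> and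
  \<open>Ec\<close>, both at distance \<delta> from \<open>m\<close>, and it is at least
  \<open>- (D\<^sup>2)\<close> everywhere.\<close>

lemma spectral_window_bound:
  fixes Ea Eb Ec Ed :: real and l P :: "nat \<Rightarrow> real"
  assumes E: "Ea < Eb" "Eb < Ec" "Ec < Ed" and P: "\<And>k. k \<in> K \<Longrightarrow> P k \<ge> 0" and W: "Wb \<ge> 0" "Wc \<ge> 0"
    and prod: "(\<Sum>k\<in>K. (l k - Ea) * (l k - Ed) * P k) \<le> (Eb - Ea) * (Eb - Ed) * Wb + (Ec - Ea) * (Ec - Ed) * Wc"
    and sq: "\<And>s. (\<Sum>k\<in>K. (l k - s)\<^sup>2 * P k) \<le> (Eb - s)\<^sup>2 * Wb + (Ec - s)\<^sup>2 * Wc"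
  shows "(1 - (Ec - Eb)\<^sup>2 / (4 * (min (Ed - Ec) (Eb - Ea))\<^sup>2)) * (Wb + Wc) \<le> (\<Sum>k\<in>K. P k)"
proof -
  define m \<delta> m0 D where "m = (Eb + Ec) / 2" and "\<delta> = (Ec - Eb) / 2"
    and "m0 = min (Ed - Ec) (Eb - Ea)" and "D = \<delta> + m0"
  have pos: "\<delta> > 0" "m0 > 0" using E by (auto simp: \<delta>_def m0_def)
  then have D: "D > 0" by (simp add: D_def)
  have main: "(\<Sum>k\<in>K. ((l k - m)\<^sup>2 - D\<^sup>2) * P k) \<le> (\<delta>\<^sup>2 - D\<^sup>2) * (Wb + Wc)"
  proof -
    \<comment> \<open>All three polynomials vanish at \<open>s\<close>; comparing the remaining
      linear factors forces this weight. It is at most 1 because \<open>2 * D\<close> is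
      \<open>Ec - Eb\<close> plus twice the smaller outer gap.\<close>
    define \<theta> where "\<theta> = 2 * D / (Ed - Ea)"
    have m0le: "m0 \<le> Ed - Ec" "m0 \<le> Eb - Ea" by (auto simp: m0_def)
    have \<theta>: "0 \<le> \<theta>" "\<theta> \<le> 1" "\<theta> * (Ed - Ea) = 2 * D"
      using E pos D m0le by (auto simp: \<theta>_def field_simps D_def \<delta>_def)
    define s where "s = (if m0 = Ed - Ec then Ed else Ea)"
    have quad: "(z - m)\<^sup>2 - D\<^sup>2 = \<theta> * ((z - Ea) * (z - Ed)) + (1 - \<theta>) * (z - s)\<^sup>2" for z
    proof (cases "m0 = Ed - Ec")
      case True
      then have "m + D = Ed" by (simp add: m_def D_def \<delta>_def field_simps)
      have "\<theta> * ((z - Ea) * (z - Ed)) + (1 - \<theta>) * (z - Ed)\<^sup>2 = (z - Ed) * (\<theta> * (Ed - Ea) + z - Ed)"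
        by (simp add: algebra_simps power2_eq_square)
      also have "\<dots> = (z - m)\<^sup>2 - D\<^sup>2"
        unfolding \<theta>(3) unfolding \<open>m + D = Ed\<close>[symmetric] by (simp add: algebra_simps power2_eq_square)
      finally show ?thesis using True by (simp add: s_def)
    next
      case False
      then have "m0 = Eb - Ea" by (auto simp: m0_def min_def)
      then have "m - D = Ea" by (simp add: m_def D_def \<delta>_def field_simps)
      have "\<theta> * ((z - Ea) * (z - Ed)) + (1 - \<theta>) * (z - Ea)\<^sup>2 = (z - Ea) * (z - Ea - \<theta> * (Ed - Ea))"
        by (simp add: algebra_simps power2_eq_square)
      also have "\<dots> = (z - m)\<^sup>2 - D\<^sup>2"
        unfolding \<theta>(3) unfolding \<open>m - D = Ea\<close>[symmetric] by (simp add: algebra_simps power2_eq_square)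
      finally show ?thesis using False by (simp add: s_def)
    qed
    have "(\<Sum>k\<in>K. ((l k - m)\<^sup>2 - D\<^sup>2) * P k)
        = \<theta> * (\<Sum>k\<in>K. (l k - Ea) * (l k - Ed) * P k) + (1 - \<theta>) * (\<Sum>k\<in>K. (l k - s)\<^sup>2 * P k)"
      unfolding sum_distrib_left sum.distrib[symmetric] quad by (intro sum.cong) (auto simp: algebra_simps)
    also have "\<dots> \<le> \<theta> * ((Eb - Ea) * (Eb - Ed) * Wb + (Ec - Ea) * (Ec - Ed) * Wc)
        + (1 - \<theta>) * ((Eb - s)\<^sup>2 * Wb + (Ec - s)\<^sup>2 * Wc)"
      using \<theta> by (intro add_mono mult_left_mono prod sq) auto
    also have "\<dots> = ((Eb - m)\<^sup>2 - D\<^sup>2) * Wb + ((Ec - m)\<^sup>2 - D\<^sup>2) * Wc"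
      unfolding quad by (simp add: algebra_simps)
    also have "(Eb - m)\<^sup>2 = \<delta>\<^sup>2" by (simp add: m_def \<delta>_def power2_eq_square field_simps)
    also have "(Ec - m)\<^sup>2 = \<delta>\<^sup>2" by (simp add: m_def \<delta>_def power2_eq_square field_simps)
    finally show ?thesis by (simp add: algebra_simps)
  qed
  have "- (D\<^sup>2) * (\<Sum>k\<in>K. P k) \<le> (\<Sum>k\<in>K. ((l k - m)\<^sup>2 - D\<^sup>2) * P k)"
    unfolding sum_distrib_left using P by (intro sum_mono mult_right_mono) auto
  with main have *: "(D\<^sup>2 - \<delta>\<^sup>2) * (Wb + Wc) \<le> D\<^sup>2 * (\<Sum>k\<in>K. P k)" by (simp add: algebra_simps)
  have "(1 - \<delta>\<^sup>2 / D\<^sup>2) * (Wb + Wc) \<le> (\<Sum>k\<in>K. P k)"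
    using * D by (simp add: field_simps)
  \<comment> \<open>Here the estimate with \<open>D\<close> is weakened to the stated one with
    \<open>m0\<close>, using \<open>D \<ge> m0\<close>.\<close>
  moreover have "\<delta>\<^sup>2 / D\<^sup>2 \<le> \<delta>\<^sup>2 / m0\<^sup>2"
    using pos by (intro divide_left_mono power_mono) (auto simp: D_def)
  then have "(1 - \<delta>\<^sup>2 / m0\<^sup>2) * (Wb + Wc) \<le> (1 - \<delta>\<^sup>2 / D\<^sup>2) * (Wb + Wc)"
    using W by (intro mult_right_mono) auto
  moreover have "\<delta>\<^sup>2 / m0\<^sup>2 = (Ec - Eb)\<^sup>2 / (4 * m0\<^sup>2)"
    by (simp add: \<delta>_def power_divide)
  ultimately show ?thesis unfolding m0_def[symmetric] by simp
qed

text \<open>With the dictionary of \<open>sums_quadratic_expansion\<close>,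
  \<open>(C k)\<^sup>2 / N k\<close> is the squared overlap of psi with the normalised G_k. The two
  hypotheses of \<open>spectral_window_bound\<close> come from the same expansion with two different
  choices of the coefficients \<open>x\<close>.\<close>

lemma overlap_lower_bound:
  fixes w E r l N C :: "nat \<Rightarrow> real"
  assumes abcd: "b = Suc a" "c = Suc b" "d = Suc c"
    and w: "\<And>j. w j > 0" and E: "strict_mono E"
    and gap: "\<And>k. k \<in> {a, b, c} \<Longrightarrow> E k < l k \<and> l k < E (Suc k)"
    and r: "\<And>j. j \<notin> {b, c} \<Longrightarrow> r j = 0" and r0: "w b * r b + w c * r c = 0"
    and orth: "\<And>k k'. k \<in> {a, b, c} \<Longrightarrow> k' \<in> {a, b, c} \<Longrightarrow> k \<noteq> k' \<Longrightarrow>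
      (\<lambda>j. w j / ((E j - l k) * (E j - l k'))) sums 0"
    and nrm: "\<And>k. k \<in> {a, b, c} \<Longrightarrow> (\<lambda>j. w j / (E j - l k)\<^sup>2) sums N k"
    and Ck: "\<And>k. k \<in> {a, b, c} \<Longrightarrow> C k = w b * r b / (E b - l k) + w c * r c / (E c - l k)"
  shows "\<exists>k\<in>{a, b, c}. (1 - (E c - E b)\<^sup>2 / (4 * (min (E d - E c) (E b - E a))\<^sup>2))
      * (w b * (r b)\<^sup>2 + w c * (r c)\<^sup>2) \<le> 3 * ((C k)\<^sup>2 / N k)"
proof -
  let ?K = "{a, b, c}"
  have bc: "b \<noteq> c" using abcd by simp
  have mono: "\<And>i j. i \<le> j \<Longrightarrow> E i \<le> E j" using E by (simp add: strict_mono_less_eq)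
  have El: "E j \<noteq> l k" if "k \<in> ?K" for j k
    using gap[OF that] mono[of j k] mono[of "Suc k" j] by (cases "j \<le> k") auto
  have N: "N k > 0" if "k \<in> ?K" for k
    using suminf_pos[OF sums_summable[OF nrm[OF that]]] sums_unique[OF nrm[OF that]] w El[OF that]
    by simp
  note expand = sums_quadratic_expansion[where K = ?K, OF _ bc r r0 El orth nrm Ck]
  define P where "P k = (C k)\<^sup>2 / N k" for k
  have sq: "(\<Sum>k\<in>?K. (l k - s)\<^sup>2 * P k) \<le> (E b - s)\<^sup>2 * (w b * (r b)\<^sup>2) + (E c - s)\<^sup>2 * (w c * (r c)\<^sup>2)" for s
  proof -
    \<comment> \<open>This subtracts from psi its projection onto the G_k: the minimiser of
      \<open>2 * x k * C k + (x k)\<^sup>2 * N k\<close>.\<close>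
    define x where "x k = - C k / N k" for k
    have "0 \<le> (E b - s) * (E b - s) * (w b * (r b)\<^sup>2) + (E c - s) * (E c - s) * (w c * (r c)\<^sup>2)
            + (\<Sum>k\<in>?K. (l k - s) * (l k - s) * (2 * x k * C k + (x k)\<^sup>2 * N k))"
      by (rule sums_le[OF _ sums_zero expand]) (use w in \<open>auto simp: mult.assoc less_imp_le\<close>)
    moreover have "(\<Sum>k\<in>?K. (l k - s) * (l k - s) * (2 * x k * C k + (x k)\<^sup>2 * N k)) = - (\<Sum>k\<in>?K. (l k - s)\<^sup>2 * P k)"
      unfolding sum_negf[symmetric]
    proof (rule sum.cong[OF refl])
      fix k assume "k \<in> ?K"
      from N[OF this] have "2 * x k * C k + (x k)\<^sup>2 * N k = - P k"
        by (simp add: x_def P_def power2_eq_square field_simps)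
      then show "(l k - s) * (l k - s) * (2 * x k * C k + (x k)\<^sup>2 * N k) = - ((l k - s)\<^sup>2 * P k)"
        by (simp add: power2_eq_square)
    qed
    ultimately show ?thesis by (simp add: power2_eq_square)
  qed
  have prod: "(\<Sum>k\<in>?K. (l k - E a) * (l k - E d) * P k)
      \<le> (E b - E a) * (E b - E d) * (w b * (r b)\<^sup>2) + (E c - E a) * (E c - E d) * (w c * (r c)\<^sup>2)"
  proof -
    \<comment> \<open>The two equations cancel the components along Phi_b and Phi_c; they are
      solvable since the roots interlace with \<open>E b\<close> and \<open>E c\<close>.\<close>
    obtain x1 x2 x3 where xx: "x1 + x2 + x3 = 0"
      "x1 / (E b - l a) + x2 / (E b - l b) + x3 / (E b - l c) = - r b"
      "x1 / (E c - l a) + x2 / (E c - l b) + x3 / (E c - l c) = - r c"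
      using cauchy_system_solvable[of "l a" "E b" "l b" "E c" "l c" "- r b" "- r c"]
        gap[of a] gap[of b] gap[of c] abcd by auto
    define x where "x k = (if k = a then x1 else if k = b then x2 else x3)" for k
    have sumK: "(\<Sum>k\<in>?K. f k) = f a + f b + f c" for f :: "nat \<Rightarrow> real" using abcd by simp
    have xK: "x a = x1" "x b = x2" "x c = x3" using abcd by (auto simp: x_def)
    have x0: "(\<Sum>k\<in>?K. x k) = 0" unfolding sumK xK using xx(1) by simp
    have xb: "r j + (\<Sum>k\<in>?K. x k / (E j - l k)) = 0" if "j \<in> {b, c}" for j
      unfolding sumK xK using xx that by auto
    \<comment> \<open>Replacing the eigenvalue \<open>l k\<close> by \<open>E j\<close> changes each
      summand by \<open>x k\<close>, and these changes sum to 0.\<close>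
    have factor: "(E j - s) * r j + (\<Sum>k\<in>?K. x k * (l k - s) / (E j - l k))
        = (E j - s) * (r j + (\<Sum>k\<in>?K. x k / (E j - l k)))" for j s
    proof -
      have "x k * (l k - s) / (E j - l k) = (E j - s) * (x k / (E j - l k)) - x k" if "k \<in> ?K" for k
        using El[OF that, of j] by (simp add: field_simps)
      then have "(\<Sum>k\<in>?K. x k * (l k - s) / (E j - l k)) = (\<Sum>k\<in>?K. (E j - s) * (x k / (E j - l k)) - x k)"
        by (intro sum.cong) auto
      also have "\<dots> = (E j - s) * (\<Sum>k\<in>?K. x k / (E j - l k))"
        by (simp only: sum_subtractf sum_distrib_left[symmetric] x0 diff_zero)
      finally show ?thesis by (simp add: distrib_left)
    qed
    have "0 \<le> (E b - E a) * (E b - E d) * (w b * (r b)\<^sup>2) + (E c - E a) * (E c - E d) * (w c * (r c)\<^sup>2)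
            + (\<Sum>k\<in>?K. (l k - E a) * (l k - E d) * (2 * x k * C k + (x k)\<^sup>2 * N k))"
    proof (rule sums_le[OF _ sums_zero expand])
      fix j
      \<comment> \<open>The product is negative only strictly between \<open>E a\<close> and
        \<open>E d\<close>, that is for the two indices whose components were cancelled.\<close>
      have "0 \<le> (E j - E a) * (E j - E d) \<or> j \<in> {b, c}"
      proof (cases "j \<le> a")
        case True
        then show ?thesis using mono[of j a] mono[of j d] abcd by (auto intro: mult_nonpos_nonpos)
      next
        case False
        then have "j \<in> {b, c} \<or> d \<le> j" using abcd by auto
        then show ?thesis using mono[of d j] mono[of a j] abcd False by auto
      qed
      then have "0 \<le> w j * ((E j - E a) * (E j - E d)) * (r j + (\<Sum>k\<in>?K. x k / (E j - l k)))\<^sup>2"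
      proof
        assume "0 \<le> (E j - E a) * (E j - E d)"
        then show ?thesis using less_imp_le[OF w[of j]] by (intro mult_nonneg_nonneg[OF mult_nonneg_nonneg] zero_le_power2)
      next
        assume "j \<in> {b, c}"
        from xb[OF this] show ?thesis by (simp only: power2_eq_square mult_zero_right order_refl)
      qed
      then show "0 \<le> w j * ((E j - E a) * r j + (\<Sum>k\<in>?K. x k * (l k - E a) / (E j - l k)))
          * ((E j - E d) * r j + (\<Sum>k\<in>?K. x k * (l k - E d) / (E j - l k)))"
        unfolding factor by (simp only: power2_eq_square mult_ac)
    qed simp_all
    moreover have "(\<Sum>k\<in>?K. (l k - E a) * (l k - E d) * (2 * x k * C k + (x k)\<^sup>2 * N k))
        \<le> (\<Sum>k\<in>?K. - ((l k - E a) * (l k - E d) * P k))"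
    proof (rule sum_mono)
      fix k assume k: "k \<in> ?K"
      have "E a \<le> E k" "E (Suc k) \<le> E d" using k abcd by (auto intro!: mono)
      \<comment> \<open>This sign turns the lower bound \<open>- P k\<close>, valid for every choice
        of \<open>x k\<close>, into an upper bound for the product.\<close>
      then have f: "(l k - E a) * (l k - E d) \<le> 0"
        using gap[OF k] by (intro mult_nonneg_nonpos) auto
      have "0 \<le> (x k * N k + C k)\<^sup>2 / N k" using N[OF k] by simp
      also have "\<dots> = 2 * x k * C k + (x k)\<^sup>2 * N k + P k"
        using N[OF k] by (simp add: P_def power2_eq_square field_simps)
      finally have "- P k \<le> 2 * x k * C k + (x k)\<^sup>2 * N k" by simp
      from mult_left_mono_neg[OF this f]
      show "(l k - E a) * (l k - E d) * (2 * x k * C k + (x k)\<^sup>2 * N k) \<le> - ((l k - E a) * (l k - E d) * P k)"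
        by simp
    qed
    ultimately show ?thesis by (simp only: sum_negf)
  qed
  have "(1 - (E c - E b)\<^sup>2 / (4 * (min (E d - E c) (E b - E a))\<^sup>2)) * (w b * (r b)\<^sup>2 + w c * (r c)\<^sup>2)
      \<le> (\<Sum>k\<in>?K. P k)"
  proof (rule spectral_window_bound[OF _ _ _ _ _ _ prod sq])
    show "E a < E b" "E b < E c" "E c < E d" using E abcd by (auto simp: strict_mono_Suc_iff)
    show "P k \<ge> 0" if "k \<in> ?K" for k using N[OF that] by (simp add: P_def)
  qed (use w in \<open>auto simp: less_imp_le\<close>)
  also have "(\<Sum>k\<in>?K. P k) = P a + P b + P c" using abcd by simp
  finally have *: "(1 - (E c - E b)\<^sup>2 / (4 * (min (E d - E c) (E b - E a))\<^sup>2))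
      * (w b * (r b)\<^sup>2 + w c * (r c)\<^sup>2) \<le> P a + P b + P c" .
  have pigeonhole: "q \<le> 3 * u \<or> q \<le> 3 * v \<or> q \<le> 3 * z" if "q \<le> u + v + z" for q u v z :: real
    using that by linarith
  show ?thesis using pigeonhole[OF *] unfolding P_def by blast
qed

section \<open>Roots of the secular function\<close>

text \<open>The subtracted fraction cancels the leading \<open>1 / e\<close>, and the common
  denominator displays the decay that matches the summable weights
  \<open>w j / ((E j)\<^sup>2 + 1)\<close>.\<close>

lemma secular_term:
  fixes e z t :: real
  assumes "e \<noteq> z"
  shows "1 / (e - z) - (e - t) / (e\<^sup>2 + 1) = ((1 + z\<^sup>2) / (e - z) + (t + z)) / (e\<^sup>2 + 1)"
proof -
  have "e\<^sup>2 + 1 \<noteq> 0" by (smt (verit) zero_le_power2)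
  then show ?thesis using assms by (simp add: divide_simps) (simp add: algebra_simps power2_eq_square)
qed

lemma secular_term_bound:
  fixes e z t :: real
  assumes "\<bar>e - z\<bar> \<ge> \<delta>" "\<delta> > 0" "\<bar>z\<bar> \<le> R"
  shows "\<bar>1 / (e - z) - (e - t) / (e\<^sup>2 + 1)\<bar> \<le> ((1 + R\<^sup>2) / \<delta> + \<bar>t\<bar> + R) / (e\<^sup>2 + 1)"
proof -
  have ne: "e \<noteq> z" using assms by auto
  have "\<bar>(1 + z\<^sup>2) / (e - z)\<bar> = (1 + z\<^sup>2) / \<bar>e - z\<bar>" by (simp add: abs_divide)
  also have "\<dots> \<le> (1 + R\<^sup>2) / \<delta>"
    using assms power_mono[of "\<bar>z\<bar>" R 2] by (intro frac_le) auto
  finally have "\<bar>(1 + z\<^sup>2) / (e - z) + (t + z)\<bar> \<le> (1 + R\<^sup>2) / \<delta> + \<bar>t\<bar> + R"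
    using assms(3) by linarith
  then show ?thesis
    unfolding secular_term[OF ne] abs_divide by (simp add: divide_right_mono)
qed

text \<open>Inside a gap the secular function runs from minus infinity at the left pole to plus
  infinity at the right one. Removing the two terms with these poles leaves a series that converges
  uniformly on the closed gap, so the intermediate value theorem applies after multiplication by
  both linear factors.\<close>

lemma secular_root:
  fixes w E :: "nat \<Rightarrow> real" and t :: real
  assumes w: "\<And>j. w j > 0" and E: "strict_mono E" and sw: "summable (\<lambda>j. w j / ((E j)\<^sup>2 + 1))"
  shows "\<exists>l. E n < l \<and> l < E (Suc n) \<and>
    (\<lambda>j. w j * (1 / (E j - l) - (E j - t) / ((E j)\<^sup>2 + 1))) sums 0"
proof -
  define k where "k j = (E j - t) / ((E j)\<^sup>2 + 1)" for j
  have less: "\<And>i j. i < j \<Longrightarrow> E i < E j" and le: "\<And>i j. i \<le> j \<Longrightarrow> E i \<le> E j"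
    using E by (auto simp: strict_mono_less strict_mono_less_eq)
  define S where "S = {E n..E (Suc n)}"
  define u where "u j z = (if j \<in> {n, Suc n} then 0 else w j * (1 / (E j - z) - k j))" for j z
  \<comment> \<open>A lower bound for the distance from the closed gap to all other
    \<open>E j\<close>. For \<open>n = 0\<close> nothing lies to the left, and 1 is an arbitrary
    positive value.\<close>
  define \<delta> where "\<delta> = min (E (Suc (Suc n)) - E (Suc n)) (if n = 0 then 1 else E n - E (n - 1))"
  have \<delta>: "\<delta> > 0" by (auto simp: \<delta>_def less)
  have far: "\<bar>E j - z\<bar> \<ge> \<delta>" if "j \<notin> {n, Suc n}" "z \<in> S" for j z
  proof (cases "j < n")
    case True
    then have "E j \<le> E (n - 1)" "n \<noteq> 0" by (auto intro: le)
    then show ?thesis using that by (auto simp: \<delta>_def S_def)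
  next
    case False
    then have "E (Suc (Suc n)) \<le> E j" using that by (intro le) auto
    then show ?thesis using that by (auto simp: \<delta>_def S_def)
  qed
  define R where "R = \<bar>E n\<bar> + \<bar>E (Suc n)\<bar>"
  have R: "\<bar>z\<bar> \<le> R" if "z \<in> S" for z using that by (auto simp: S_def R_def)
  define M where "M = (1 + R\<^sup>2) / \<delta> + \<bar>t\<bar> + R"
  have "M \<ge> 0" using \<delta> by (auto simp: M_def R_def)
  have ub: "norm (u j z) \<le> M * (w j / ((E j)\<^sup>2 + 1))" if "z \<in> S" for j z
  proof (cases "j \<in> {n, Suc n}")
    case True
    then show ?thesis using \<open>M \<ge> 0\<close> w[of j] by (auto simp: u_def intro!: mult_nonneg_nonneg divide_nonneg_nonneg)
  next
    case False
    have "norm (u j z) = w j * \<bar>1 / (E j - z) - k j\<bar>"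
      using False w[of j] by (simp add: u_def abs_mult)
    also have "\<dots> \<le> w j * (M / ((E j)\<^sup>2 + 1))"
      unfolding k_def M_def using w[of j] secular_term_bound[OF far[OF False that] \<delta> R[OF that]]
      by (intro mult_left_mono) auto
    finally show ?thesis by (simp add: mult_ac)
  qed
  have unif: "uniform_limit S (\<lambda>n z. \<Sum>j<n. u j z) (\<lambda>z. \<Sum>j. u j z) sequentially"
    by (rule Weierstrass_m_test[OF ub summable_mult[OF sw]])
  have "continuous_on S (\<lambda>z. \<Sum>j. u j z)"
  proof (rule uniform_limit_theorem[OF _ unif])
    have "continuous_on S (u j)" for j
    proof (cases "j \<in> {n, Suc n}")
      case True
      then show ?thesis by (simp add: u_def[abs_def])
    next
      case False
      then have "continuous_on S (\<lambda>z. w j * (1 / (E j - z) - k j))"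
        using far[OF False] \<delta> by (intro continuous_intros) fastforce
      then show ?thesis using False by (simp add: u_def[abs_def])
    qed
    then show "\<forall>\<^sub>F n in sequentially. continuous_on S (\<lambda>z. \<Sum>j<n. u j z)"
      by (intro always_eventually allI continuous_on_sum) auto
  qed simp
  then have contU: "continuous_on S (\<lambda>z. \<Sum>j. u j z)" .
  text \<open>Clearing the two poles of the secular function leaves a continuous function on the closed gap.\<close>
  define H where "H z = w (Suc n) * (z - E n) - w n * (E (Suc n) - z)
      + (z - E n) * (E (Suc n) - z) * ((\<Sum>j. u j z) - w n * k n - w (Suc n) * k (Suc n))" for z
  have "continuous_on S H" unfolding H_def[abs_def] by (intro continuous_intros contU)
  moreover have gap: "E n < E (Suc n)" by (simp add: less)
  have Hn: "H (E n) < 0" "H (E (Suc n)) > 0" using gap w by (auto simp: H_def)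
  ultimately obtain l where l: "E n \<le> l" "l \<le> E (Suc n)" "H l = 0"
    using IVT'[of H "E n" 0 "E (Suc n)"] gap unfolding S_def by fastforce
  then have l': "E n < l" "l < E (Suc n)" using Hn by (metis less_eq_real_def less_irrefl)+
  have nz: "E n - l \<noteq> 0" "E (Suc n) - l \<noteq> 0" using l' by auto
  have "l \<in> S" using l by (simp add: S_def)
  have "summable (\<lambda>j. u j l)"
    by (rule summable_comparison_test'[OF summable_mult[OF sw] ub[OF \<open>l \<in> S\<close>]])
  then have "(\<lambda>j. u j l) sums (\<Sum>j. u j l)" by (rule summable_sums)
  moreover have "(\<lambda>j. if j \<in> {n, Suc n} then w j * (1 / (E j - l) - k j) else 0)
      sums (\<Sum>j\<in>{n, Suc n}. w j * (1 / (E j - l) - k j))"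
    by (rule sums_If_finite_set) simp
  ultimately have "(\<lambda>j. u j l + (if j \<in> {n, Suc n} then w j * (1 / (E j - l) - k j) else 0))
      sums ((\<Sum>j. u j l) + (\<Sum>j\<in>{n, Suc n}. w j * (1 / (E j - l) - k j)))"
    by (rule sums_add)
  moreover have "(\<lambda>j. u j l + (if j \<in> {n, Suc n} then w j * (1 / (E j - l) - k j) else 0))
     = (\<lambda>j. w j * (1 / (E j - l) - (E j - t) / ((E j)\<^sup>2 + 1)))"
    by (auto simp: u_def k_def)
  moreover have "(\<Sum>j. u j l) + (\<Sum>j\<in>{n, Suc n}. w j * (1 / (E j - l) - k j)) = 0"
  proof -
    define U where "U = (\<Sum>j. u j l) - w n * k n - w (Suc n) * k (Suc n)"
    have "w (Suc n) * (l - E n) - w n * (E (Suc n) - l) + (l - E n) * (E (Suc n) - l) * U = 0"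
      using l(3) by (simp add: H_def U_def)
    then have "w n / (E n - l) + w (Suc n) / (E (Suc n) - l) + U = 0"
      using nz by (simp add: divide_simps) (simp add: algebra_simps)
    then show ?thesis by (simp add: U_def algebra_simps)
  qed
  ultimately show ?thesis using l' by auto
qed

text \<open>The series is the squared norm of G_l. A distance \<delta> from \<open>l\<close> to all
  \<open>E j\<close> makes \<open>(E j)\<^sup>2 + 1\<close> at most a constant times
  \<open>(E j - l)\<^sup>2\<close>.\<close>

lemma summable_resolvent_sq:
  fixes w E :: "nat \<Rightarrow> real"
  assumes w: "\<And>j. w j > 0" and sw: "summable (\<lambda>j. w j / ((E j)\<^sup>2 + 1))"
    and far: "\<And>j. \<bar>E j - l\<bar> \<ge> \<delta>" and \<delta>: "\<delta> > 0"
  shows "summable (\<lambda>j. w j / (E j - l)\<^sup>2)"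
proof (rule summable_comparison_test'[OF summable_mult[OF sw]])
  fix j
  define M where "M = 2 + (2 * l\<^sup>2 + 1) / \<delta>\<^sup>2"
  have d2: "\<delta>\<^sup>2 \<le> (E j - l)\<^sup>2" using far[of j] \<delta> by (simp add: abs_le_square_iff[symmetric])
  have pos: "(E j - l)\<^sup>2 > 0" "(E j)\<^sup>2 + 1 > 0"
    using d2 \<delta> by (smt (verit) zero_less_power) (smt (verit) zero_le_power2)
  have "(E j)\<^sup>2 \<le> 2 * (E j - l)\<^sup>2 + 2 * l\<^sup>2"
    using zero_le_power2[of "E j - 2 * l"] by (simp add: power2_eq_square algebra_simps)
  moreover have "2 * l\<^sup>2 + 1 \<le> (2 * l\<^sup>2 + 1) / \<delta>\<^sup>2 * (E j - l)\<^sup>2"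
  proof -
    have "(2 * l\<^sup>2 + 1) * \<delta>\<^sup>2 \<le> (2 * l\<^sup>2 + 1) * (E j - l)\<^sup>2" by (intro mult_left_mono d2) auto
    then show ?thesis using \<delta> by (simp add: field_simps)
  qed
  ultimately have "(E j)\<^sup>2 + 1 \<le> M * (E j - l)\<^sup>2" by (simp add: M_def algebra_simps)
  then have "1 / (E j - l)\<^sup>2 \<le> M * (1 / ((E j)\<^sup>2 + 1))" using pos by (simp add: field_simps)
  from mult_left_mono[OF this less_imp_le[OF w[of j]]]
  show "norm (w j / (E j - l)\<^sup>2) \<le> (2 + (2 * l\<^sup>2 + 1) / \<delta>\<^sup>2) * (w j / ((E j)\<^sup>2 + 1))"
    using w[of j] by (simp add: M_def mult_ac)
qed

text \<open>The resolvent identity: subtracting the two secular equations cancels the regularising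
  terms \<open>k j\<close>, and division by \<open>l - l'\<close> leaves the inner product of G_l
  and G_l'.\<close>

lemma secular_orthogonality:
  fixes w E :: "nat \<Rightarrow> real"
  assumes "(\<lambda>j. w j * (1 / (E j - l) - k j)) sums 0" "(\<lambda>j. w j * (1 / (E j - l') - k j)) sums 0"
    and "l \<noteq> l'" "\<And>j. E j \<noteq> l" "\<And>j. E j \<noteq> l'"
  shows "(\<lambda>j. w j / ((E j - l) * (E j - l'))) sums 0"
proof -
  have "(\<lambda>j. (w j * (1 / (E j - l) - k j) - w j * (1 / (E j - l') - k j)) / (l - l')) sums ((0 - 0) / (l - l'))"
    by (intro sums_divide sums_diff assms)
  moreover have "(w j * (1 / (E j - l) - k j) - w j * (1 / (E j - l') - k j)) / (l - l')
      = w j / ((E j - l) * (E j - l'))" for j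
  proof -
    have "1 / (E j - l) - 1 / (E j - l') = (l - l') / ((E j - l) * (E j - l'))"
      using assms(4,5)[of j] by (simp add: field_simps)
    moreover have "w j * (1 / (E j - l) - k j) - w j * (1 / (E j - l') - k j)
        = w j * (1 / (E j - l) - 1 / (E j - l'))" by (simp add: algebra_simps)
    ultimately show ?thesis using assms(3) by simp
  qed
  ultimately show ?thesis by simp
qed

section \<open>Operators and values at a point\<close>

lemma mem_op_neg: "(f, h) \<in> op_neg T \<longleftrightarrow> (f, \<lambda>x. - h x) \<in> T"
proof
  assume "(f, \<lambda>x. - h x) \<in> T"
  then show "(f, h) \<in> op_neg T"
    unfolding op_neg_def mem_Collect_eq by (intro exI[of _ f] exI[of _ "\<lambda>x. - h x"]) simp
next
  assume "(f, h) \<in> op_neg T"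
  then obtain h' where "h = (\<lambda>x. - h' x)" "(f, h') \<in> T" unfolding op_neg_def by blast
  then show "(f, \<lambda>x. - h x) \<in> T" by simp
qed

lemma Domain_op_neg: "Domain (op_neg T) = Domain T"
proof (intro set_eqI iffI)
  fix f assume "f \<in> Domain T"
  then obtain h where "(f, h) \<in> T" by blast
  then have "(f, \<lambda>x. - h x) \<in> op_neg T" by (simp add: mem_op_neg)
  then show "f \<in> Domain (op_neg T)" by blast
next
  fix f assume "f \<in> Domain (op_neg T)"
  then obtain h where "(f, h) \<in> op_neg T" by blast
  then show "f \<in> Domain T" unfolding mem_op_neg by blast
qed

lemma op_neg_self_adjoint:
  assumes "T = op_adjoint N T"
  shows "op_neg T = op_adjoint N (op_neg T)"
proof (rule set_eqI)
  fix z :: "('a \<Rightarrow> complex) \<times> ('a \<Rightarrow> complex)"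
  obtain f h where z: "z = (f, h)" by fastforce
  have neg: "L2_inner N (\<lambda>x. - v x) f = - L2_inner N v f"
    "L2_inner N u (\<lambda>x. - h x) = - L2_inner N u h" for u v
    using L2_inner_scale[of N "-1" v f] L2_inner_scale_right[of N u "-1" h] by auto
  have hL: "(\<lambda>x. - h x) \<in> L2 N \<longleftrightarrow> h \<in> L2 N"
    using L2_uminus[of h N] L2_uminus[of "\<lambda>x. - h x" N] unfolding minus_minus by blast
  have ball: "(\<forall>(u, v)\<in>op_neg T. L2_inner N v f = L2_inner N u h)
      \<longleftrightarrow> (\<forall>(u, v)\<in>T. L2_inner N v f = L2_inner N u (\<lambda>x. - h x))"
  proof (intro iffI ballI; clarify)
    fix u v assume "\<forall>(u, v)\<in>op_neg T. L2_inner N v f = L2_inner N u h" "(u, v) \<in> T"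
    moreover from this(2) have "(u, \<lambda>x. - v x) \<in> op_neg T" by (simp add: mem_op_neg)
    ultimately have "L2_inner N (\<lambda>x. - v x) f = L2_inner N u h" by fast
    then show "L2_inner N v f = L2_inner N u (\<lambda>x. - h x)" unfolding neg by (metis minus_minus)
  next
    fix u v assume "\<forall>(u, v)\<in>T. L2_inner N v f = L2_inner N u (\<lambda>x. - h x)" "(u, v) \<in> op_neg T"
    moreover from this(2) have "(u, \<lambda>x. - v x) \<in> T" by (simp add: mem_op_neg)
    ultimately have "L2_inner N (\<lambda>x. - v x) f = L2_inner N u (\<lambda>x. - h x)" by fast
    then show "L2_inner N v f = L2_inner N u h" unfolding neg by simp
  qed
  have "(f, \<lambda>x. - h x) \<in> T \<longleftrightarrow> (f, \<lambda>x. - h x) \<in> op_adjoint N T" using assms by simp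
  also have "\<dots> \<longleftrightarrow> (f, h) \<in> op_adjoint N (op_neg T)"
    unfolding op_adjoint_def by (simp only: mem_Collect_eq prod.case hL ball)
  finally show "z \<in> op_neg T \<longleftrightarrow> z \<in> op_adjoint N (op_neg T)" unfolding z mem_op_neg .
qed

lemma op_adjoint_diff:
  assumes "(f, h) \<in> op_adjoint N T" "(f', h') \<in> op_adjoint N T" "T \<subseteq> L2 N \<times> L2 N"
  shows "(\<lambda>x. f x - f' x, \<lambda>x. h x - h' x) \<in> op_adjoint N T"
proof -
  have L2: "f \<in> L2 N" "f' \<in> L2 N" "h \<in> L2 N" "h' \<in> L2 N"
    using assms by (auto simp: op_adjoint_def)
  have "L2_inner N v (\<lambda>x. f x - f' x) = L2_inner N u (\<lambda>x. h x - h' x)" if "(u, v) \<in> T" for u v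
  proof -
    have "u \<in> L2 N" "v \<in> L2 N" "L2_inner N v f = L2_inner N u h" "L2_inner N v f' = L2_inner N u h'"
      using that assms by (auto simp: op_adjoint_def)
    then show ?thesis using L2 by (simp add: L2_inner_diff_right)
  qed
  then show ?thesis using L2 by (auto simp: op_adjoint_def L2_diff)
qed

section \<open>Essential values at a point and their recovery from averages\<close>

lemma has_value_at_cong_AE:
  assumes "has_value_at X N p f z" "AE x in N. f x = g x"
  shows "has_value_at X N p g z"
  unfolding has_value_at_def
proof (intro allI impI)
  fix \<epsilon> :: real assume "\<epsilon> > 0"
  then obtain W where W: "openin X W" "p \<in> W" "AE x in N. x \<in> W \<longrightarrow> cmod (f x - z) < \<epsilon>"
    using assms(1) unfolding has_value_at_def by blast
  have "AE x in N. x \<in> W \<longrightarrow> cmod (g x - z) < \<epsilon>"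
    using W(3) assms(2) by eventually_elim auto
  with W show "\<exists>W. openin X W \<and> p \<in> W \<and> (AE x in N. x \<in> W \<longrightarrow> cmod (g x - z) < \<epsilon>)" by blast
qed

text \<open>An essential limit is vacuous when the point has a null neighbourhood: every number is
  then a value. The theorem treats this degenerate case separately.\<close>

lemma has_value_at_null:
  assumes "openin X W" "p \<in> W" "AE x in N. x \<notin> W"
  shows "has_value_at X N p f z"
  unfolding has_value_at_def
proof (intro allI impI exI conjI)
  show "AE x in N. x \<in> W \<longrightarrow> cmod (f x - z) < \<epsilon>" for \<epsilon> using assms(3) by eventually_elim auto
qed (use assms in auto)

text \<open>This makes an essential limit, which ranges over all neighbourhoods, accessible along a
  sequence. Staying inside \<open>W0\<close> will keep the measures of the neighbourhoods
  finite.\<close>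

lemma decreasing_neighbourhoods:
  assumes "first_countable X" "openin X W0" "p \<in> W0"
  obtains W :: "nat \<Rightarrow> 'a set" where "\<And>n. openin X (W n)" "\<And>n. p \<in> W n" "\<And>n. W n \<subseteq> W0"
    "\<And>U. openin X U \<Longrightarrow> p \<in> U \<Longrightarrow> \<forall>\<^sub>F n in sequentially. W n \<subseteq> U"
proof -
  have p: "p \<in> topspace X" using assms openin_subset by blast
  then obtain \<B> where \<B>: "countable \<B>" "\<And>V. V \<in> \<B> \<Longrightarrow> openin X V"
    "\<And>U. openin X U \<Longrightarrow> p \<in> U \<Longrightarrow> \<exists>V\<in>\<B>. p \<in> V \<and> V \<subseteq> U"
    using assms(1) unfolding first_countable_def by meson
  define \<C> where "\<C> = {V \<in> \<B>. p \<in> V}"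
  have \<C>: "countable \<C>" "\<C> \<noteq> {}"
    using \<B>(1) \<B>(3)[OF openin_topspace p] by (auto simp: \<C>_def)
  define V where "V = from_nat_into \<C>"
  have V: "V n \<in> \<C>" for n unfolding V_def by (rule from_nat_into[OF \<C>(2)])
  define W where "W n = W0 \<inter> (\<Inter>i\<le>n. V i)" for n
  show thesis
  proof
    show "openin X (W n)" for n
      unfolding W_def using V \<B>(2) assms by (intro openin_Int openin_INT2) (auto simp: \<C>_def)
    show "p \<in> W n" for n using V assms by (auto simp: W_def \<C>_def)
    show "W n \<subseteq> W0" for n by (auto simp: W_def)
    fix U assume "openin X U" "p \<in> U"
    then obtain V' where V': "V' \<in> \<C>" "V' \<subseteq> U" using \<B>(3) by (auto simp: \<C>_def)
    then obtain m where "V m = V'" using from_nat_into_surj[OF \<C>(1)] V_def by metis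
    then have "W n \<subseteq> U" if "m \<le> n" for n using V' that by (auto simp: W_def)
    then show "\<forall>\<^sub>F n in sequentially. W n \<subseteq> U" unfolding eventually_sequentially by blast
  qed
qed

text \<open>The functionals are averages over shrinking neighbourhoods, which have finite measure because
  some square-integrable function has a nonzero value at the point.\<close>

lemma averaging_functionals:
  assumes X: "first_countable X" and M: "space N = M"
    and sets: "sets N = sigma_sets M {W \<inter> M | W. openin X W}"
    and g: "g \<in> L2 N" "has_value_at X N p g z0" "z0 \<noteq> 0"
    and nonnull: "\<And>W. openin X W \<Longrightarrow> p \<in> W \<Longrightarrow> \<not> (AE x in N. x \<notin> W)"
  obtains k :: "nat \<Rightarrow> 'a \<Rightarrow> complex" where "\<And>n. k n \<in> L2 N"
    "\<And>f z. f \<in> L2 N \<Longrightarrow> has_value_at X N p f z \<Longrightarrow> (\<lambda>n. L2_inner N f (k n)) \<longlonglongrightarrow> z"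
proof -
  \<comment> \<open>Near \<open>p\<close> the modulus of \<open>g\<close> is at least half of
    \<open>cmod z0\<close>, so Chebyshev's inequality bounds the measure by the squared norm of
    \<open>g\<close> over \<open>\<rho>\<^sup>2\<close>.\<close>
  define \<rho> where "\<rho> = cmod z0 / 2"
  have \<rho>: "\<rho> > 0" using g(3) by (simp add: \<rho>_def)
  obtain W0 where W0: "openin X W0" "p \<in> W0" "AE x in N. x \<in> W0 \<longrightarrow> cmod (g x - z0) < \<rho>"
    using g(2) \<rho> unfolding has_value_at_def by blast
  obtain W where W: "\<And>n. openin X (W n)" "\<And>n. p \<in> W n" "\<And>n. W n \<subseteq> W0"
    "\<And>U. openin X U \<Longrightarrow> p \<in> U \<Longrightarrow> \<forall>\<^sub>F n in sequentially. W n \<subseteq> U"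
    using decreasing_neighbourhoods[OF X W0(1,2)] by blast
  define A where "A n = W n \<inter> M" for n
  have A: "A n \<in> sets N" for n
    unfolding sets A_def using W(1) by (intro sigma_sets.Basic) blast
  have fin: "emeasure N (A n) < \<infinity>" for n
  proof -
    have "AE x in N. indicator (A n) x \<le> ennreal (1 / \<rho>\<^sup>2) * ennreal ((cmod (g x))\<^sup>2)"
      using W0(3)
    proof eventually_elim
      case (elim x)
      show ?case
      proof (cases "x \<in> A n")
        case True
        then have "cmod (g x - z0) < \<rho>" using elim W(3) by (auto simp: A_def)
        then have "\<rho> \<le> cmod (g x)"
          using norm_triangle_ineq2[of z0 "g x"] by (simp add: \<rho>_def norm_minus_commute)
        then have "1 \<le> (1 / \<rho>\<^sup>2) * (cmod (g x))\<^sup>2"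
          using \<rho> power_mono[of \<rho> "cmod (g x)" 2] by (simp add: field_simps)
        then show ?thesis using True
          by (simp add: ennreal_mult[symmetric] ennreal_1[symmetric] ennreal_leI del: ennreal_1)
      qed simp
    qed
    then have "emeasure N (A n) \<le> (\<integral>\<^sup>+x. ennreal (1 / \<rho>\<^sup>2) * ennreal ((cmod (g x))\<^sup>2) \<partial>N)"
      unfolding nn_integral_indicator[OF A, symmetric] by (rule nn_integral_mono_AE)
    also have "\<dots> = ennreal (1 / \<rho>\<^sup>2) * ennreal ((L2_norm N g)\<^sup>2)"
      using g(1) by (subst nn_integral_cmult) (auto simp: L2_norm_sq_nn_integral L2_def)
    also have "\<dots> < \<infinity>" by (simp add: ennreal_mult[symmetric])
    finally show ?thesis .
  qed
  define m where "m n = measure N (A n)" for n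
  have m: "m n > 0" for n
  proof (rule ccontr)
    assume "\<not> m n > 0"
    then have "m n = 0" by (simp add: m_def zero_less_measure_iff)
    then have "emeasure N (A n) = 0"
      using fin[of n] by (simp add: m_def emeasure_eq_ennreal_measure)
    then have "AE x in N. x \<notin> A n" using A by (intro AE_not_in) (auto simp: null_sets_def)
    then have "AE x in N. x \<notin> W n" using AE_space by eventually_elim (auto simp: A_def M)
    then show False using nonnull W by blast
  qed
  \<comment> \<open>The normalised indicator, of integral 1; it is real, so the conjugation in the
    inner product disappears.\<close>
  define k where "k n x = complex_of_real (indicator (A n) x / m n)" for n x
  have int1: "integrable N (\<lambda>x. indicator (A n) x :: real)" for n
    using A fin[of n] by (intro integrable_real_indicator) auto
  have kL: "k n \<in> L2 N" for n
  proof -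
    have "(cmod (k n x))\<^sup>2 = indicator (A n) x * (1 / (m n)\<^sup>2)" for x
      by (simp add: k_def norm_divide power_divide split: split_indicator)
    then have "integrable N (\<lambda>x. (cmod (k n x))\<^sup>2)"
      using integrable_mult_left[OF int1[of n], of "1 / (m n)\<^sup>2"] by simp
    moreover have "k n \<in> borel_measurable N" unfolding k_def[abs_def] using A by measurable
    ultimately show ?thesis by (simp add: L2_def)
  qed
  have lim: "(\<lambda>n. L2_inner N f (k n)) \<longlonglongrightarrow> z" if f: "f \<in> L2 N" "has_value_at X N p f z" for f z
  proof (rule tendstoI)
    fix \<epsilon> :: real assume "\<epsilon> > 0"
    define \<eta> where "\<eta> = \<epsilon> / 2"
    have "\<eta> > 0" using \<open>\<epsilon> > 0\<close> by (simp add: \<eta>_def)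
    then obtain U where U: "openin X U" "p \<in> U" "AE x in N. x \<in> U \<longrightarrow> cmod (f x - z) < \<eta>"
      using f(2) unfolding has_value_at_def by blast
    have "\<forall>\<^sub>F n in sequentially. W n \<subseteq> U" using W(4) U by blast
    then show "\<forall>\<^sub>F n in sequentially. dist (L2_inner N f (k n)) z < \<epsilon>"
    proof eventually_elim
      case (elim n)
      have i1: "integrable N (\<lambda>x. f x * k n x)"
        using L2_integrable_mult[OF f(1) kL[of n]] by (simp add: k_def)
      have i2: "integrable N (k n)"
        unfolding k_def[abs_def] using int1[of n] by (intro integrable_of_real) simp
      have "(\<integral>x. k n x \<partial>N) = complex_of_real ((\<integral>x. indicator (A n) x \<partial>N) / m n)"
        unfolding k_def[abs_def] by (subst integral_complex_of_real) simp
      also have "\<dots> = 1" using m[of n] A fin[of n] by (simp add: m_def)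
      finally have "(\<integral>x. k n x \<partial>N) = 1" .
      then have "L2_inner N f (k n) - z = (\<integral>x. f x * k n x \<partial>N) - (\<integral>x. z * k n x \<partial>N)"
        by (simp add: L2_inner_def k_def)
      also have "\<dots> = (\<integral>x. f x * k n x - z * k n x \<partial>N)"
        using i1 i2 by (intro Bochner_Integration.integral_diff[symmetric]) auto
      finally have "cmod (L2_inner N f (k n) - z) \<le> (\<integral>x. cmod (f x * k n x - z * k n x) \<partial>N)"
        by (simp only: integral_norm_bound)
      also have "\<dots> \<le> (\<integral>x. \<eta> * (indicator (A n) x / m n) \<partial>N)"
      proof (rule integral_mono_AE)
        show "integrable N (\<lambda>x. cmod (f x * k n x - z * k n x))" using i1 i2 by auto
        show "integrable N (\<lambda>x. \<eta> * (indicator (A n) x / m n))" using int1[of n] by auto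
        show "AE x in N. cmod (f x * k n x - z * k n x) \<le> \<eta> * (indicator (A n) x / m n)"
          using U(3)
        proof eventually_elim
          case (elim x)
          have "f x * k n x - z * k n x = (f x - z) * complex_of_real (indicator (A n) x / m n)"
            by (simp only: k_def left_diff_distrib)
          then have "cmod (f x * k n x - z * k n x) = cmod (f x - z) * \<bar>indicator (A n) x / m n\<bar>"
            by (simp only: norm_mult norm_of_real)
          then have "cmod (f x * k n x - z * k n x) = cmod (f x - z) * (indicator (A n) x / m n)"
            using m[of n] by (simp add: abs_divide)
          also have "\<dots> \<le> \<eta> * (indicator (A n) x / m n)"
            using elim \<open>W n \<subseteq> U\<close> m[of n] by (auto simp: A_def divide_right_mono less_imp_le split: split_indicator)
          finally show ?case .
        qed
      qed
      also have "\<dots> = \<eta>" using m[of n] A fin[of n] by (simp add: m_def)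
      finally show ?case using \<open>\<epsilon> > 0\<close> by (simp add: dist_norm \<eta>_def)
    qed
  qed
  show thesis using that kL lim by blast
qed

text \<open>No uniform bound on the \<open>k n\<close> is assumed, so the exchange of limit and sum
  cannot rest on continuity. What is available is convergence for every subseries, which is the
  hypothesis of \<open>gliding_hump\<close> for the deviations \<open>z n j\<close>.\<close>

lemma series_limit_at_point:
  assumes e: "orthonormal_seq N e" and k: "\<And>n. k n \<in> L2 N"
    and ev: "\<And>j. (\<lambda>n. L2_inner N (e j) (k n)) \<longlonglongrightarrow> v j"
    and c: "summable (\<lambda>j. (cmod (c j))\<^sup>2)" and cv: "summable (\<lambda>j. cmod (c j * v j))"
    and conv: "\<And>S f. L2_sums N (\<lambda>j x. (if j \<in> S then c j else 0) * e j x) f \<Longrightarrow>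
      convergent (\<lambda>n. L2_inner N f (k n))"
    and f: "L2_sums N (\<lambda>j x. c j * e j x) f"
  shows "(\<lambda>n. L2_inner N f (k n)) \<longlonglongrightarrow> (\<Sum>j. c j * v j)"
proof -
  define z where "z n j = c j * (L2_inner N (e j) (k n) - v j)" for n j
  have eL: "\<And>j. e j \<in> L2 N" using e by (simp add: orthonormal_seq_def)
  have ck: "summable (\<lambda>j. cmod (c j * L2_inner N (e j) (k n)))" for n
  proof (rule summable_comparison_test'[OF summable_add[OF c Bessel[OF e k[of n]]]])
    fix j
    have "0 \<le> (cmod (c j) - cmod (L2_inner N (e j) (k n)))\<^sup>2" by simp
    moreover have "0 \<le> cmod (c j) * cmod (L2_inner N (e j) (k n))" by simp
    ultimately have "cmod (c j) * cmod (L2_inner N (e j) (k n)) \<le> (cmod (c j))\<^sup>2 + (cmod (L2_inner N (e j) (k n)))\<^sup>2"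
      unfolding power2_diff by linarith
    then show "norm (cmod (c j * L2_inner N (e j) (k n))) \<le> (cmod (c j))\<^sup>2 + (cmod (L2_inner N (k n) (e j)))\<^sup>2"
      by (simp add: norm_mult L2_inner_commute[of N "k n" "e j"])
  qed
  have split: "(\<lambda>n. L2_inner N g (k n)) = (\<lambda>n. (\<Sum>j. if j \<in> S then z n j else 0) + (\<Sum>j. if j \<in> S then c j * v j else 0))"
    if g: "L2_sums N (\<lambda>j x. (if j \<in> S then c j else 0) * e j x) g" for S g
  proof
    fix n
    have "(\<lambda>j. (if j \<in> S then c j else 0) * L2_inner N (e j) (k n)) sums L2_inner N g (k n)"
      using L2_sums_inner[OF g k[of n]] by (simp only: L2_inner_scale)
    moreover have sv: "summable (\<lambda>j. if j \<in> S then c j * v j else 0)"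
      by (rule summable_comparison_test'[OF cv, of 0]) auto
    ultimately have "(\<lambda>j. (if j \<in> S then c j else 0) * L2_inner N (e j) (k n) - (if j \<in> S then c j * v j else 0))
        sums (L2_inner N g (k n) - (\<Sum>j. if j \<in> S then c j * v j else 0))"
      by (intro sums_diff summable_sums)
    moreover have "(\<lambda>j. (if j \<in> S then c j else 0) * L2_inner N (e j) (k n) - (if j \<in> S then c j * v j else 0))
       = (\<lambda>j. if j \<in> S then z n j else 0)" by (auto simp: z_def algebra_simps)
    ultimately have "(\<Sum>j. if j \<in> S then z n j else 0) = L2_inner N g (k n) - (\<Sum>j. if j \<in> S then c j * v j else 0)"
      by (simp add: sums_iff)
    then show "L2_inner N g (k n) = (\<Sum>j. if j \<in> S then z n j else 0) + (\<Sum>j. if j \<in> S then c j * v j else 0)"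
      by simp
  qed
  have "(\<lambda>n. \<Sum>j. z n j) \<longlonglongrightarrow> 0"
  proof (rule gliding_hump)
    fix n
    have "summable (\<lambda>j. cmod (c j * L2_inner N (e j) (k n)) + cmod (c j * v j))"
      by (rule summable_add[OF ck cv])
    then show "summable (\<lambda>j. cmod (z n j))"
      by (rule summable_comparison_test'[where N = 0])
        (simp add: z_def right_diff_distrib norm_triangle_ineq4)
  next
    fix j
    have "(\<lambda>n. c j * (L2_inner N (e j) (k n) - v j)) \<longlonglongrightarrow> c j * (v j - v j)"
      by (intro tendsto_intros ev)
    then show "(\<lambda>n. z n j) \<longlonglongrightarrow> 0" by (simp add: z_def)
  next
    fix S
    \<comment> \<open>Any subset of a square-summable family is square-summable, so the partial
      series over \<open>S\<close> is realised by a function to which \<open>conv\<close>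
      applies.\<close>
    have "summable (\<lambda>j. (cmod (if j \<in> S then c j else 0))\<^sup>2)"
      by (rule summable_comparison_test'[OF c, of 0]) auto
    then obtain g where g: "L2_sums N (\<lambda>j x. (if j \<in> S then c j else 0) * e j x) g"
      using Riesz_Fischer[OF e, of "\<lambda>j. if j \<in> S then c j else 0"] by blast
    show "convergent (\<lambda>n. \<Sum>j. if j \<in> S then z n j else 0)"
      using conv[OF g] unfolding split[OF g] convergent_add_const_right_iff .
  qed
  then have "(\<lambda>n. (\<Sum>j. z n j) + (\<Sum>j. c j * v j)) \<longlonglongrightarrow> 0 + (\<Sum>j. c j * v j)"
    by (intro tendsto_intros)
  moreover have "L2_sums N (\<lambda>j x. (if j \<in> UNIV then c j else 0) * e j x) f" using f by simp
  ultimately show ?thesis using split[of UNIV f] by simp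
qed

text \<open>Adjoints are closed: their defining identity is continuous in both components of the
  pair.\<close>

lemma op_adjoint_L2_sums:
  assumes f: "L2_sums N F f" and h: "L2_sums N H h" and T: "\<And>j. (F j, H j) \<in> op_adjoint N T"
    and TL: "T \<subseteq> L2 N \<times> L2 N"
  shows "(f, h) \<in> op_adjoint N T"
proof -
  have "L2_inner N v f = L2_inner N u h" if "(u, v) \<in> T" for u v
  proof -
    have uv: "u \<in> L2 N" "v \<in> L2 N" using that TL by auto
    have "L2_inner N v (F j) = L2_inner N u (H j)" for j
      using T[of j] that by (auto simp: op_adjoint_def)
    then show ?thesis
      using L2_sums_inner_right[OF f uv(2)] L2_sums_inner_right[OF h uv(1)] by (simp add: sums_iff)
  qed
  then show ?thesis using f h by (auto simp: op_adjoint_def L2_sums_def)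
qed

section \<open>Eigenfunctions of the point scatterer\<close>

text \<open>Only the range of \<Phi> is known to lie in the basis, not that \<Phi> is injective.
  Orthogonality is therefore taken from the distinct eigenvalues of a symmetric operator, and only
  the norms from the basis.\<close>

lemma eigen_sequence_orthonormal:
  fixes E :: "nat \<Rightarrow> real"
  assumes T: "T = op_adjoint N T" and B: "orthonormal_basis N B" "range \<Phi> \<subseteq> B"
    and E: "strict_mono E" and eig: "\<And>j. (\<Phi> j, \<lambda>x. complex_of_real (E j) * \<Phi> j x) \<in> T"
  shows "orthonormal_seq N \<Phi>"
  unfolding orthonormal_seq_def
proof (intro conjI allI)
  show "\<Phi> j \<in> L2 N" for j using B by (auto simp: orthonormal_basis_def)
  show "L2_inner N (\<Phi> i) (\<Phi> j) = (if i = j then 1 else 0)" for i j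
  proof (cases "i = j")
    case True
    moreover have "\<Phi> j \<in> B" using B(2) by blast
    ultimately show ?thesis using B(1) by (simp add: orthonormal_basis_def)
  next
    case False
    have "(\<Phi> j, \<lambda>x. complex_of_real (E j) * \<Phi> j x) \<in> op_adjoint N T" using eig T by simp
    then have "L2_inner N (\<lambda>x. complex_of_real (E i) * \<Phi> i x) (\<Phi> j)
        = L2_inner N (\<Phi> i) (\<lambda>x. complex_of_real (E j) * \<Phi> j x)"
      using eig[of i] by (auto simp: op_adjoint_def)
    then have "(complex_of_real (E i) - complex_of_real (E j)) * L2_inner N (\<Phi> i) (\<Phi> j) = 0"
      unfolding L2_inner_scale L2_inner_scale_right by (simp add: algebra_simps)
    moreover have "E i \<noteq> E j" using E False by (simp add: strict_mono_eq)
    ultimately show ?thesis using False by simp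
  qed
qed

text \<open>What remains of the surface here is that functions in the domain of \<open>T\<close>,
  the negative Laplacian, have values at \<open>p\<close>, and that pairing with \<open>k\<close>
  recovers these values in the limit, which makes them unique.\<close>

locale point_evaluation =
  fixes X :: "'a topology" and N :: "'a measure" and p :: 'a and T :: "'a op"
    and B :: "('a \<Rightarrow> complex) set" and \<Phi> :: "nat \<Rightarrow> 'a \<Rightarrow> complex" and E :: "nat \<Rightarrow> real"
    and k :: "nat \<Rightarrow> 'a \<Rightarrow> complex"
  assumes self_adj: "T = op_adjoint N T"
    and valued: "\<And>f. f \<in> Domain T \<Longrightarrow> \<exists>z. has_value_at X N p f z"
    and basis: "orthonormal_basis N B"
    and basis_eigen: "\<And>b. b \<in> B \<Longrightarrow> \<exists>\<epsilon>::real. (b, \<lambda>x. complex_of_real \<epsilon> * b x) \<in> T"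
    and basis_value: "\<And>b. b \<in> B \<Longrightarrow> has_value_at X N p b (b p)"
    and Phi_range: "range \<Phi> = {b \<in> B. b p \<noteq> 0}" and E_mono: "strict_mono E"
    and Phi_eigen: "\<And>j. (\<Phi> j, \<lambda>x. complex_of_real (E j) * \<Phi> j x) \<in> T"
    and weights: "summable (\<lambda>j. (cmod (\<Phi> j p))\<^sup>2 / ((E j)\<^sup>2 + 1))"
    and k_L2: "\<And>n. k n \<in> L2 N"
    and k_value: "\<And>f z. f \<in> L2 N \<Longrightarrow> has_value_at X N p f z \<Longrightarrow> (\<lambda>n. L2_inner N f (k n)) \<longlonglongrightarrow> z"
begin

lemma T_L2: "T \<subseteq> L2 N \<times> L2 N"
  by (subst self_adj) (auto simp: op_adjoint_def)

lemma T_symmetric: "(u, v) \<in> T \<Longrightarrow> (f, h) \<in> T \<Longrightarrow> L2_inner N v f = L2_inner N u h"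
  using self_adj by (fastforce simp: op_adjoint_def)

lemma Phi_orthonormal: "orthonormal_seq N \<Phi>"
  using eigen_sequence_orthonormal[OF self_adj basis _ E_mono Phi_eigen] Phi_range by blast

lemma Phi_value: "has_value_at X N p (\<Phi> j) (\<Phi> j p)"
  using basis_value Phi_range by blast

text \<open>Square-summability of the coefficients with and without the eigenvalues puts the sum
  into the domain of the closed operator \<open>T\<close>. The same holds for each subseries, which
  thus has a value at \<open>p\<close>; this is the convergence that
  \<open>series_limit_at_point\<close> asks for.\<close>

lemma series_value:
  fixes \<epsilon> :: "nat \<Rightarrow> real" and c :: "nat \<Rightarrow> complex"
  assumes e: "orthonormal_seq N e" and eig: "\<And>j. (e j, \<lambda>x. complex_of_real (\<epsilon> j) * e j x) \<in> T"
    and v: "\<And>j. has_value_at X N p (e j) (v j)"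
    and c: "summable (\<lambda>j. (cmod (c j))\<^sup>2)" "summable (\<lambda>j. (cmod (complex_of_real (\<epsilon> j) * c j))\<^sup>2)"
    and cv: "summable (\<lambda>j. cmod (c j * v j))"
  obtains f h where "L2_sums N (\<lambda>j x. c j * e j x) f" "(f, h) \<in> T" "has_value_at X N p f (\<Sum>j. c j * v j)"
proof -
  have eL: "e j \<in> L2 N" for j using e by (simp add: orthonormal_seq_def)
  \<comment> \<open>Stated for any coefficients dominated by \<open>c\<close>, so as to cover the
    full series and all its subseries at once.\<close>
  have in_T: "\<exists>h. (f, h) \<in> T" if d: "\<And>j. cmod (d j) \<le> cmod (c j)" and f: "L2_sums N (\<lambda>j x. d j * e j x) f"
    for d :: "nat \<Rightarrow> complex" and f
  proof -
    have "summable (\<lambda>j. (cmod (\<epsilon> j * d j))\<^sup>2)"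
      by (rule summable_comparison_test'[OF c(2), of 0])
        (auto simp: norm_mult intro!: power_mono mult_left_mono d)
    then obtain h where h: "L2_sums N (\<lambda>j x. (\<epsilon> j * d j) * e j x) h"
      using Riesz_Fischer[OF e, of "\<lambda>j. \<epsilon> j * d j"] by blast
    have "(f, h) \<in> op_adjoint N T"
    proof (rule op_adjoint_L2_sums[OF f h _ T_L2])
      fix j
      show "(\<lambda>x. d j * e j x, \<lambda>x. (\<epsilon> j * d j) * e j x) \<in> op_adjoint N T"
        unfolding op_adjoint_def
      proof (clarsimp, intro conjI ballI L2_scale eL, clarify)
        fix u w assume "(u, w) \<in> T"
        from T_symmetric[OF this eig[of j]]
        show "L2_inner N w (\<lambda>x. d j * e j x) = L2_inner N u (\<lambda>x. \<epsilon> j * d j * e j x)"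
          unfolding L2_inner_scale_right by simp
      qed
    qed
    then show ?thesis using self_adj by auto
  qed
  obtain f where f: "L2_sums N (\<lambda>j x. c j * e j x) f" using Riesz_Fischer[OF e c(1)] by blast
  obtain h where h: "(f, h) \<in> T" using in_T[of c, OF order_refl f] by blast
  obtain z where z: "has_value_at X N p f z" using valued h by blast
  have "f \<in> L2 N" using f by (simp add: L2_sums_def)
  have "(\<lambda>n. L2_inner N f (k n)) \<longlonglongrightarrow> (\<Sum>j. c j * v j)"
  proof (rule series_limit_at_point[OF e k_L2 k_value[OF eL v] c(1) cv _ f])
    fix S g assume g: "L2_sums N (\<lambda>j x. (if j \<in> S then c j else 0) * e j x) g"
    have "\<exists>h. (g, h) \<in> T" by (rule in_T[OF _ g]) auto
    then obtain y where "has_value_at X N p g y" using valued by blast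
    then show "convergent (\<lambda>n. L2_inner N g (k n))"
      using k_value g unfolding convergent_def L2_sums_def by blast
  qed
  then have "z = (\<Sum>j. c j * v j)" using k_value[OF \<open>f \<in> L2 N\<close> z] LIMSEQ_unique by blast
  with f h z that show thesis by blast
qed

lemma eigen_coefficient:
  assumes "(u, v) \<in> T" "(e, \<lambda>x. complex_of_real \<epsilon> * e x) \<in> T"
  shows "L2_inner N v e = complex_of_real \<epsilon> * L2_inner N u e"
  using T_symmetric[OF assms] unfolding L2_inner_scale_right by simp

lemma coefficients_summable:
  fixes \<epsilon> :: "nat \<Rightarrow> real"
  assumes u: "(u, v) \<in> T" and e: "orthonormal_seq N e"
    and eig: "\<And>j. (e j, \<lambda>x. complex_of_real (\<epsilon> j) * e j x) \<in> T"
  shows "summable (\<lambda>j. (cmod (L2_inner N u (e j)))\<^sup>2)"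
    "summable (\<lambda>j. (cmod (complex_of_real (\<epsilon> j) * L2_inner N u (e j)))\<^sup>2)"
proof -
  have "u \<in> L2 N" "v \<in> L2 N" using u T_L2 by auto
  from Bessel[OF e this(1)] show "summable (\<lambda>j. (cmod (L2_inner N u (e j)))\<^sup>2)" .
  from Bessel[OF e \<open>v \<in> L2 N\<close>]
  show "summable (\<lambda>j. (cmod (complex_of_real (\<epsilon> j) * L2_inner N u (e j)))\<^sup>2)"
    unfolding eigen_coefficient[OF u eig] .
qed

text \<open>The basis is an arbitrary set, so countability must come from Bessel's inequality: for
  each \<open>n\<close> only finitely many squared coefficients exceed
  \<open>1 / Suc n\<close>.\<close>

lemma countable_support:
  assumes u: "u \<in> L2 N"
  shows "countable {b \<in> B. L2_inner N u b \<noteq> 0}"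
proof -
  define S where "S n = {b \<in> B. (cmod (L2_inner N u b))\<^sup>2 > 1 / Suc n}" for n :: nat
  have "finite (S n)" for n
  proof (rule ccontr)
    assume inf: "infinite (S n)"
    define m where "m = nat \<lceil>(L2_norm N u)\<^sup>2 * Suc n\<rceil> + 1"
    obtain F where F: "F \<subseteq> S n" "finite F" "card F = m" using infinite_arbitrarily_large[OF inf] by blast
    have "real m * (1 / Suc n) = (\<Sum>b\<in>F. 1 / Suc n)" using F by simp
    also have "\<dots> \<le> (\<Sum>b\<in>F. (cmod (L2_inner N u b))\<^sup>2)"
      using F by (intro sum_mono) (auto simp: S_def less_imp_le)
    also have "\<dots> \<le> (L2_norm N u)\<^sup>2"
    proof (rule Bessel_finite[OF F(2) _ _ u])
      have FB: "F \<subseteq> B" using F(1) by (auto simp: S_def)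
      show "b \<in> L2 N" if "b \<in> F" for b
        using FB that basis by (auto simp: orthonormal_basis_def)
      show "L2_inner N b c = (if b = c then 1 else 0)" if "b \<in> F" "c \<in> F" for b c
        using subsetD[OF FB that(1)] subsetD[OF FB that(2)] basis
        unfolding orthonormal_basis_def by blast
    qed
    finally have "real m \<le> (L2_norm N u)\<^sup>2 * Suc n" by (simp add: field_simps)
    moreover have "real m \<ge> (L2_norm N u)\<^sup>2 * Suc n + 1" unfolding m_def by linarith
    ultimately show False by simp
  qed
  moreover have "{b \<in> B. L2_inner N u b \<noteq> 0} \<subseteq> (\<Union>n. S n)"
  proof
    fix b assume "b \<in> {b \<in> B. L2_inner N u b \<noteq> 0}"
    moreover from this have "(cmod (L2_inner N u b))\<^sup>2 > 0" by simp
    then obtain n where "inverse (real (Suc n)) < (cmod (L2_inner N u b))\<^sup>2" using reals_Archimedean by blast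
    ultimately show "b \<in> (\<Union>n. S n)" by (auto simp: S_def inverse_eq_divide)
  qed
  moreover have "countable (\<Union>n. S n)" using \<open>\<And>n. finite (S n)\<close> by (intro countable_UN[OF countableI_type] countable_finite)
  ultimately show ?thesis using countable_subset by blast
qed

text \<open>In the expansion of \<open>u\<close> over the full basis, an element of the range of
  \<Phi> has coefficient 0 and any other element vanishes at \<open>p\<close>. The series for the
  value is thus 0 term by term.\<close>

lemma value_zero_of_orthogonal:
  assumes u: "(u, v) \<in> T" and orth: "\<And>j. L2_inner N u (\<Phi> j) = 0"
  shows "has_value_at X N p u 0"
proof -
  have uL: "u \<in> L2 N" using u T_L2 by auto
  text \<open>Joining the \<open>\<Phi> j\<close> makes the index set infinite, so that it can be enumerated by the naturals.\<close>
  define S where "S = {b \<in> B. L2_inner N u b \<noteq> 0} \<union> range \<Phi>"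
  have SB: "S \<subseteq> B" using Phi_range by (auto simp: S_def)
  have "inj \<Phi>"
  proof
    fix i j assume "\<Phi> i = \<Phi> j"
    then show "i = j" using Phi_orthonormal unfolding orthonormal_seq_def by (metis one_neq_zero)
  qed
  then have "infinite S" using range_inj_infinite[of \<Phi>] by (simp add: S_def)
  moreover have "countable S" using countable_support[OF uL] by (simp add: S_def)
  ultimately have bij: "bij_betw (from_nat_into S) UNIV S" by (rule bij_betw_from_nat_into[rotated])
  define e where "e = from_nat_into S"
  have e_inj: "inj e" and e_range: "range e = S" using bij by (auto simp: e_def bij_betw_def)
  then have eB: "e n \<in> B" for n using SB by blast
  have e: "orthonormal_seq N e"
    unfolding orthonormal_seq_def using basis eB e_inj by (auto simp: orthonormal_basis_def inj_eq)
  obtain \<epsilon> :: "nat \<Rightarrow> real" where eig: "\<And>n. (e n, \<lambda>x. complex_of_real (\<epsilon> n) * e n x) \<in> T"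
    using basis_eigen[OF eB] by metis
  have zero: "L2_inner N u (e n) * e n p = 0" for n
  proof (cases "e n \<in> range \<Phi>")
    case True
    then show ?thesis using orth by auto
  next
    case False
    then show ?thesis using eB Phi_range by auto
  qed
  obtain f h where f: "L2_sums N (\<lambda>j x. L2_inner N u (e j) * e j x) f" "(f, h) \<in> T"
    "has_value_at X N p f (\<Sum>j. L2_inner N u (e j) * e j p)"
  proof (rule series_value[OF e eig basis_value[OF eB] coefficients_summable[OF u e eig]])
    show "summable (\<lambda>j. cmod (L2_inner N u (e j) * e j p))" unfolding zero by simp
  qed
  have fL: "f \<in> L2 N" using f(1) by (simp add: L2_sums_def)
  have "L2_inner N (\<lambda>x. f x - u x) b = 0" if "b \<in> B" for b
  proof -
    have bL: "b \<in> L2 N" using that basis by (auto simp: orthonormal_basis_def)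
    have "L2_inner N f b = L2_inner N u b"
    proof (cases "b \<in> S")
      case True
      then obtain n where "b = e n" using e_range by blast
      then show ?thesis using L2_sums_orthonormal_coeff[OF e f(1)] by simp
    next
      case False
      then have "L2_inner N (e j) b = 0" for j
        using basis eB[of j] e_range that unfolding orthonormal_basis_def by (metis rangeI)
      then have "(\<lambda>j. 0) sums L2_inner N f b"
        using L2_sums_inner[OF f(1) bL] by (simp add: L2_inner_scale)
      then show ?thesis using False that by (auto simp: S_def sums_unique2[OF _ sums_zero])
    qed
    then show ?thesis using fL uL bL by (simp add: L2_inner_diff)
  qed
  then have "AE x in N. f x - u x = 0"
    using basis L2_diff[OF fL uL] unfolding orthonormal_basis_def by blast
  then have "AE x in N. f x = u x" by eventually_elim simp
  with f(3) show ?thesis unfolding zero by (simp add: has_value_at_cong_AE)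
qed

text \<open>Let \<open>f\<close> be the part of \<open>u\<close> along the \<Phi> j. The rest
  \<open>u - f\<close> lies in the domain and is orthogonal to all \<Phi> j, so its value is 0 and
  \<open>f\<close> has the value of \<open>u\<close>.\<close>

lemma value_expansion:
  assumes u: "(u, v) \<in> T" and z: "has_value_at X N p u z"
  shows "(\<lambda>j. L2_inner N u (\<Phi> j) * \<Phi> j p) sums z"
proof -
  let ?c = "\<lambda>j. L2_inner N u (\<Phi> j)"
  note c = coefficients_summable[OF u Phi_orthonormal Phi_eigen]
  have cv: "summable (\<lambda>j. cmod (?c j * \<Phi> j p))"
  proof (rule summable_comparison_test'[OF summable_add[OF summable_add[OF c] weights]])
    fix j
    define x y s where "x = cmod (?c j)" and "y = cmod (\<Phi> j p)" and "s = (E j)\<^sup>2 + 1"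
    have s: "s > 0" unfolding s_def by (smt (verit) zero_le_power2)
    \<comment> \<open>Weighted inequality of the means: the factor \<open>s\<close> is paid for by
      the coefficients of \<open>u\<close> and \<open>v\<close>, and \<open>1 / s\<close> by
      \<open>weights\<close>.\<close>
    have "0 \<le> s * (x - y / s)\<^sup>2 + x * y" using s by (simp add: x_def y_def)
    also have "\<dots> = x\<^sup>2 * s + y\<^sup>2 / s - x * y"
      using s by (simp add: power2_eq_square field_simps)
    finally show "norm (cmod (?c j * \<Phi> j p))
        \<le> (cmod (?c j))\<^sup>2 + (cmod (complex_of_real (E j) * ?c j))\<^sup>2 + (cmod (\<Phi> j p))\<^sup>2 / ((E j)\<^sup>2 + 1)"
      by (simp add: x_def y_def s_def norm_mult power_mult_distrib algebra_simps)
  qed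
  obtain f h where f: "L2_sums N (\<lambda>j x. ?c j * \<Phi> j x) f" "(f, h) \<in> T"
    "has_value_at X N p f (\<Sum>j. ?c j * \<Phi> j p)"
    using series_value[OF Phi_orthonormal Phi_eigen Phi_value c cv] by blast
  have L2: "u \<in> L2 N" "f \<in> L2 N" using u f(2) T_L2 by auto
  have \<Phi>L: "\<Phi> j \<in> L2 N" for j using Phi_orthonormal by (simp add: orthonormal_seq_def)
  have "(\<lambda>x. u x - f x, \<lambda>x. v x - h x) \<in> T"
    using op_adjoint_diff[of u v N T f h] u f(2) T_L2 self_adj by simp
  moreover have "L2_inner N (\<lambda>x. u x - f x) (\<Phi> j) = 0" for j
    using L2 \<Phi>L L2_sums_orthonormal_coeff[OF Phi_orthonormal f(1)] by (simp add: L2_inner_diff)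
  ultimately have "has_value_at X N p (\<lambda>x. u x - f x) 0" by (rule value_zero_of_orthogonal)
  from k_value[OF L2_diff[OF L2] this] have "(\<lambda>n. L2_inner N u (k n) - L2_inner N f (k n)) \<longlonglongrightarrow> 0"
    using L2 k_L2 by (simp add: L2_inner_diff)
  moreover have "(\<lambda>n. L2_inner N u (k n) - L2_inner N f (k n)) \<longlonglongrightarrow> z - (\<Sum>j. ?c j * \<Phi> j p)"
    by (intro tendsto_diff k_value L2 z f(3))
  ultimately have "z - (\<Sum>j. ?c j * \<Phi> j p) = 0" using LIMSEQ_unique by blast
  moreover have "(\<lambda>j. ?c j * \<Phi> j p) sums (\<Sum>j. ?c j * \<Phi> j p)"
    using summable_norm_cancel[OF cv] by (rule summable_sums)
  ultimately show ?thesis by simp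
qed

text \<open>Removing the prescribed multiples of \<open>gp\<close> and \<open>gm\<close> from
  \<open>G\<close> leaves a function \<open>f\<close> whose value at \<open>p\<close> is
  \<open>s\<close> times the secular function at \<open>l\<close>, hence 0: this is the boundary
  condition. For the eigenvalue equation, the defect when pairing with \<open>(u, v)\<close> in
  \<open>T\<close> is \<open>s\<close> times the value of \<open>u\<close> at \<open>p\<close>,
  which is 0 on the restricted domain. The free factor \<open>s\<close> serves to normalise
  \<open>G\<close>.\<close>

lemma resolvent_eigenfunction:
  fixes l t s \<delta> :: real and ap am :: complex
  assumes far: "\<And>j. \<bar>E j - l\<bar> \<ge> \<delta>" and \<delta>: "\<delta> > 0"
    and root: "(\<lambda>j. (cmod (\<Phi> j p))\<^sup>2 * (1 / (E j - l) - (E j - t) / ((E j)\<^sup>2 + 1))) sums 0"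
    and gp: "green_sum N p \<Phi> E \<i> gp" and gm: "green_sum N p \<Phi> E (- \<i>) gm"
    and a: "\<And>e::real. ap / (e - \<i>) + am / (e + \<i>) = complex_of_real ((e - t) / (e\<^sup>2 + 1))"
  obtains G f h where
    "L2_sums N (\<lambda>j x. complex_of_real (s / (E j - l)) * cnj (\<Phi> j p) * \<Phi> j x) G"
    "(G, \<lambda>x. complex_of_real l * G x) \<in> op_adjoint N {(f, h) \<in> T. has_value_at X N p f 0}"
    "(f, h) \<in> T" "has_value_at X N p f 0"
    "AE x in N. G x = f x + (s * ap) * gp x + (s * am) * gm x"
proof -
  have \<Phi>L: "\<Phi> j \<in> L2 N" for j using Phi_orthonormal by (simp add: orthonormal_seq_def)
  have w: "(cmod (\<Phi> j p))\<^sup>2 > 0" for j using Phi_range by auto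
  have El: "E j \<noteq> l" for j using far[of j] \<delta> by auto
  define c where "c j = complex_of_real (s / (E j - l)) * cnj (\<Phi> j p)" for j
  define q where "q j = 1 / (E j - l) - (E j - t) / ((E j)\<^sup>2 + 1)" for j
  \<comment> \<open>The coefficients of the regular part \<open>f\<close>: those of \<open>G\<close>
    with the secular term in place of the resolvent.\<close>
  define d where "d j = complex_of_real (s * q j) * cnj (\<Phi> j p)" for j
  have "summable (\<lambda>j. s\<^sup>2 * ((cmod (\<Phi> j p))\<^sup>2 / (E j - l)\<^sup>2))"
    using summable_resolvent_sq[OF w weights far \<delta>] by (rule summable_mult)
  moreover have "s\<^sup>2 * ((cmod (\<Phi> j p))\<^sup>2 / (E j - l)\<^sup>2) = (cmod (c j))\<^sup>2" for j
    by (simp add: c_def norm_mult norm_divide power_mult_distrib power_divide del: of_real_divide)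
  ultimately have "summable (\<lambda>j. (cmod (c j))\<^sup>2)" by simp
  then obtain G where G: "L2_sums N (\<lambda>j x. c j * \<Phi> j x) G"
    using Riesz_Fischer[OF Phi_orthonormal] by blast
  have GL: "G \<in> L2 N" using G by (simp add: L2_sums_def)
  define M where "M = (1 + \<bar>l\<bar>\<^sup>2) / \<delta> + \<bar>t\<bar> + \<bar>l\<bar>"
  have q: "\<bar>q j\<bar> \<le> M / ((E j)\<^sup>2 + 1)" for j
    unfolding q_def M_def by (rule secular_term_bound[OF far \<delta>]) simp
  have sq: "((E j)\<^sup>2 + 1) * (q j)\<^sup>2 \<le> M\<^sup>2 * (1 / ((E j)\<^sup>2 + 1))" for j
  proof -
    define y where "y = (E j)\<^sup>2 + 1"
    have y: "y > 0" unfolding y_def by (smt (verit) zero_le_power2)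
    have "(q j)\<^sup>2 \<le> (M / y)\<^sup>2" using power_mono[OF q[of j], of 2] by (simp add: y_def)
    then have "y * (q j)\<^sup>2 \<le> y * (M / y)\<^sup>2" using y by (intro mult_left_mono) auto
    also have "\<dots> = M\<^sup>2 * (1 / y)" using y by (simp add: power2_eq_square)
    finally show ?thesis by (simp add: y_def)
  qed
  have d_sq: "summable (\<lambda>j. ((E j)\<^sup>2 + 1) * (cmod (d j))\<^sup>2)"
  proof (rule summable_comparison_test'[OF summable_mult[OF weights]])
    fix j
    have "(cmod (d j))\<^sup>2 = s\<^sup>2 * (cmod (\<Phi> j p))\<^sup>2 * (q j)\<^sup>2"
      by (simp add: d_def norm_mult power_mult_distrib del: of_real_mult)
    then have "((E j)\<^sup>2 + 1) * (cmod (d j))\<^sup>2 = s\<^sup>2 * (cmod (\<Phi> j p))\<^sup>2 * (((E j)\<^sup>2 + 1) * (q j)\<^sup>2)"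
      by simp
    also have "\<dots> \<le> s\<^sup>2 * (cmod (\<Phi> j p))\<^sup>2 * (M\<^sup>2 * (1 / ((E j)\<^sup>2 + 1)))"
      by (intro mult_left_mono sq) auto
    finally show "norm (((E j)\<^sup>2 + 1) * (cmod (d j))\<^sup>2) \<le> (s\<^sup>2 * M\<^sup>2) * ((cmod (\<Phi> j p))\<^sup>2 / ((E j)\<^sup>2 + 1))"
      by (simp add: abs_mult mult_ac)
  qed
  have d1: "summable (\<lambda>j. (cmod (d j))\<^sup>2)"
    by (rule summable_comparison_test'[OF d_sq, of 0]) (simp add: distrib_right)
  have d2: "summable (\<lambda>j. (cmod (complex_of_real (E j) * d j))\<^sup>2)"
    by (rule summable_comparison_test'[OF d_sq, of 0]) (simp add: distrib_right norm_mult power_mult_distrib)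
  have d\<Phi>: "d j * \<Phi> j p = complex_of_real (s * ((cmod (\<Phi> j p))\<^sup>2 * q j))" for j
  proof -
    have "d j * \<Phi> j p = complex_of_real (s * q j) * (\<Phi> j p * cnj (\<Phi> j p))" by (simp add: d_def)
    then show ?thesis unfolding complex_norm_square[symmetric] by simp
  qed
  have d3: "summable (\<lambda>j. cmod (d j * \<Phi> j p))"
  proof (rule summable_comparison_test'[OF summable_mult[OF weights]])
    fix j
    have "cmod (d j * \<Phi> j p) = \<bar>s\<bar> * (cmod (\<Phi> j p))\<^sup>2 * \<bar>q j\<bar>"
      unfolding d\<Phi> norm_of_real by (simp add: abs_mult)
    also have "\<dots> \<le> \<bar>s\<bar> * (cmod (\<Phi> j p))\<^sup>2 * (M / ((E j)\<^sup>2 + 1))"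
      by (intro mult_left_mono q) auto
    finally show "norm (cmod (d j * \<Phi> j p)) \<le> (\<bar>s\<bar> * M) * ((cmod (\<Phi> j p))\<^sup>2 / ((E j)\<^sup>2 + 1))"
      by (simp add: mult_ac)
  qed
  have "(\<lambda>j. complex_of_real (s * ((cmod (\<Phi> j p))\<^sup>2 * q j))) sums complex_of_real (s * 0)"
    unfolding sums_of_real_iff q_def by (intro sums_mult root)
  then have d0: "(\<Sum>j. d j * \<Phi> j p) = 0" unfolding d\<Phi> by (simp add: sums_iff)
  obtain f h where f: "L2_sums N (\<lambda>j x. d j * \<Phi> j x) f" "(f, h) \<in> T" "has_value_at X N p f 0"
    using series_value[OF Phi_orthonormal Phi_eigen Phi_value d1 d2 d3] unfolding d0 by blast
  have fL: "f \<in> L2 N" and gL: "gp \<in> L2 N" "gm \<in> L2 N"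
    using f(1) gp gm by (auto simp: L2_sums_def green_sum_def)
  have AE: "AE x in N. G x = f x + (s * ap) * gp x + (s * am) * gm x"
  proof (rule L2_eq_AE_of_inner)
    show "(\<lambda>x. f x + s * ap * gp x + s * am * gm x) \<in> L2 N"
      by (intro L2_add L2_scale fL gL)
    fix y assume y: "y \<in> L2 N"
    let ?P = "\<lambda>j. L2_inner N (\<Phi> j) y"
    have "(\<lambda>j. d j * ?P j + (s * ap) * (cnj (\<Phi> j p) / (complex_of_real (E j) - \<i>) * ?P j)
          + (s * am) * (cnj (\<Phi> j p) / (complex_of_real (E j) - - \<i>) * ?P j))
        sums (L2_inner N f y + (s * ap) * L2_inner N gp y + (s * am) * L2_inner N gm y)"
      using L2_sums_inner[OF f(1) y] L2_sums_inner[OF gp[unfolded green_sum_def] y]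
        L2_sums_inner[OF gm[unfolded green_sum_def] y]
      unfolding L2_inner_scale by (intro sums_add sums_mult)
    moreover have "d j * ?P j + (s * ap) * (cnj (\<Phi> j p) / (complex_of_real (E j) - \<i>) * ?P j)
          + (s * am) * (cnj (\<Phi> j p) / (complex_of_real (E j) - - \<i>) * ?P j) = c j * ?P j" for j
    proof -
      have "d j * ?P j + (s * ap) * (cnj (\<Phi> j p) / (complex_of_real (E j) - \<i>) * ?P j)
          + (s * am) * (cnj (\<Phi> j p) / (complex_of_real (E j) - - \<i>) * ?P j)
        = (d j + s * cnj (\<Phi> j p) * (ap / (E j - \<i>) + am / (E j + \<i>))) * ?P j"
        by (simp add: algebra_simps)
      also have "d j + s * cnj (\<Phi> j p) * (ap / (E j - \<i>) + am / (E j + \<i>))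
          = s * cnj (\<Phi> j p) * complex_of_real (q j + (E j - t) / ((E j)\<^sup>2 + 1))"
        unfolding a d_def of_real_add of_real_mult by (simp only: algebra_simps)
      also have "\<dots> = c j" unfolding c_def q_def by simp
      finally show ?thesis .
    qed
    moreover have "(\<lambda>j. c j * ?P j) sums L2_inner N G y"
      using L2_sums_inner[OF G y] unfolding L2_inner_scale .
    ultimately have "L2_inner N G y = L2_inner N f y + (s * ap) * L2_inner N gp y + (s * am) * L2_inner N gm y"
      using sums_unique2 by simp
    then show "L2_inner N G y = L2_inner N (\<lambda>x. f x + s * ap * gp x + s * am * gm x) y"
      using fL gL y by (simp add: L2_inner_add L2_add L2_scale L2_inner_scale)
  qed (rule GL)
  have adj: "(G, \<lambda>x. complex_of_real l * G x) \<in> op_adjoint N {(f, h) \<in> T. has_value_at X N p f 0}"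
  proof -
    have "L2_inner N v G = L2_inner N u (\<lambda>x. complex_of_real l * G x)"
      if uv: "(u, v) \<in> T" "has_value_at X N p u 0" for u v
    proof -
      have L2: "u \<in> L2 N" "v \<in> L2 N" using uv(1) T_L2 by auto
      have "(\<lambda>j. cnj (c j) * L2_inner N v (\<Phi> j) - l * (cnj (c j) * L2_inner N u (\<Phi> j)))
          sums (L2_inner N v G - l * L2_inner N u G)"
        using L2_sums_inner_right[OF G L2(2)] L2_sums_inner_right[OF G L2(1)]
        unfolding L2_inner_scale_right by (intro sums_diff sums_mult)
      moreover have "cnj (c j) * L2_inner N v (\<Phi> j) - l * (cnj (c j) * L2_inner N u (\<Phi> j))
          = s * (L2_inner N u (\<Phi> j) * \<Phi> j p)" for j
      proof -
        have "cnj (c j) * L2_inner N v (\<Phi> j) - l * (cnj (c j) * L2_inner N u (\<Phi> j))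
          = cnj (c j) * complex_of_real (E j - l) * L2_inner N u (\<Phi> j)"
          unfolding eigen_coefficient[OF uv(1) Phi_eigen] by (simp add: algebra_simps)
        \<comment> \<open>The factor \<open>E j - l\<close> cancels the resolvent, leaving the
          series of \<open>value_expansion\<close>.\<close>
        also have "cnj (c j) * complex_of_real (E j - l) = complex_of_real s * \<Phi> j p"
        proof -
          have "complex_of_real (s / (E j - l)) * complex_of_real (E j - l) = complex_of_real s"
            using El[of j] unfolding of_real_mult[symmetric] by simp
          moreover have "cnj (c j) * complex_of_real (E j - l)
              = (complex_of_real (s / (E j - l)) * complex_of_real (E j - l)) * \<Phi> j p"
            unfolding c_def complex_cnj_mult complex_cnj_cnj complex_cnj_complex_of_real by (simp only: mult_ac)
          ultimately show ?thesis by (simp only:)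
        qed
        finally show ?thesis by (simp add: mult_ac)
      qed
      moreover have "(\<lambda>j. s * (L2_inner N u (\<Phi> j) * \<Phi> j p)) sums (complex_of_real s * 0)"
        by (intro sums_mult value_expansion[OF uv])
      ultimately have "L2_inner N v G - l * L2_inner N u G = 0" using sums_unique2 by fastforce
      then show ?thesis unfolding L2_inner_scale_right by simp
    qed
    then show ?thesis using GL by (auto simp: op_adjoint_def L2_scale)
  qed
  show thesis using that[OF _ adj f(2,3) AE] G unfolding c_def by blast
qed

end

text \<open>With \<omega> = exp(i \<Theta>), taking a = 1/(1 - \<omega>) makes the coefficient of
  \<open>e\<close> in the numerator equal to 1. The quotient (1 + \<omega>)/(1 - \<omega>) is purely
  imaginary, namely i cot(\<Theta>/2), so \<open>t\<close> is real. The range of \<Theta> excludes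
  \<omega> = 1.\<close>

lemma boundary_condition_coefficients:
  fixes \<Theta> :: real
  assumes "0 < \<Theta>" "\<Theta> < 2 * pi"
  shows "\<exists>(a::complex) (t::real). \<forall>e::real.
    a / (e - \<i>) + (- exp (\<i> * \<Theta>) * a) / (e + \<i>) = complex_of_real ((e - t) / (e\<^sup>2 + 1))"
proof -
  define u v where "u = cos \<Theta>" and "v = sin \<Theta>"
  have uv: "u\<^sup>2 + v\<^sup>2 = 1" by (simp add: u_def v_def)
  have "u \<noteq> 1"
  proof
    assume "u = 1"
    then obtain n :: int where n: "\<Theta> = n * (2 * pi)" unfolding u_def cos_one_2pi_int by auto
    then have "0 < real_of_int n" using assms pi_gt_zero by (simp add: zero_less_mult_iff)
    moreover have "real_of_int n < 1" using n assms(2) pi_gt_zero by (simp add: mult_less_cancel_right1)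
    ultimately show False by simp
  qed
  then have u: "1 - u \<noteq> 0" by simp
  define \<omega> where "\<omega> = exp (\<i> * complex_of_real \<Theta>)"
  have \<omega>: "\<omega> = Complex u v" by (simp add: \<omega>_def u_def v_def complex_eq_iff exp_eq_polar mult.commute cis_conv_exp[symmetric])
  define t where "t = v / (1 - u)"
  have "(1 - u) * (1 + u) = v * v" using uv by (simp add: algebra_simps power2_eq_square)
  then have "1 + u = t * v" using u by (simp add: t_def field_simps)
  moreover have "v = t * (1 - u)" using u by (simp add: t_def)
  ultimately have rel: "1 + \<omega> = \<i> * t * (1 - \<omega>)" unfolding \<omega> by (simp add: complex_eq_iff)
  have \<omega>1: "1 - \<omega> \<noteq> 0" using u unfolding \<omega> by (simp add: complex_eq_iff)
  define a where "a = 1 / (1 - \<omega>)"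
  have a1: "a * (1 - \<omega>) = 1" using \<omega>1 by (simp add: a_def)
  have a2: "a * (1 + \<omega>) = \<i> * t" unfolding rel using \<omega>1 by (simp add: a_def)
  have "a / (e - \<i>) + (- \<omega> * a) / (e + \<i>) = complex_of_real ((e - t) / (e\<^sup>2 + 1))" for e :: real
  proof -
    have nz: "complex_of_real e - \<i> \<noteq> 0" "complex_of_real e + \<i> \<noteq> 0" by (auto simp: complex_eq_iff)
    have "a / (e - \<i>) + (- \<omega> * a) / (e + \<i>) = (a * (e + \<i>) - \<omega> * a * (e - \<i>)) / ((e - \<i>) * (e + \<i>))"
      using nz by (simp add: divide_simps)
    also have "a * (e + \<i>) - \<omega> * a * (e - \<i>) = (a * (1 - \<omega>)) * e + (a * (1 + \<omega>)) * \<i>"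
      by (simp add: algebra_simps)
    also have "\<dots> = complex_of_real (e - t)" unfolding a1 a2 by (simp add: complex_eq_iff)
    also have "(e - \<i>) * (e + \<i>) = complex_of_real (e\<^sup>2 + 1)" by (simp add: algebra_simps power2_eq_square)
    finally show ?thesis by simp
  qed
  then show ?thesis unfolding \<omega>_def by blast
qed

section \<open>Assembly: an eigenfunction with large overlap\<close>

theorem proposition1p3:
  fixes X :: "'a topology" and A :: "'a chart set" and g :: "'a chart \<Rightarrow> real^2 \<Rightarrow> real^2^2"
    and M :: "'a set" and vol :: "'a measure" and L :: "'a op" and p :: 'a
    and B :: "('a \<Rightarrow> complex) set" and \<Phi> :: "nat \<Rightarrow> 'a \<Rightarrow> complex" and E :: "nat \<Rightarrow> real"
    and gp gm \<psi> :: "'a \<Rightarrow> complex" and \<Theta> \<mu> :: real and a b c d :: nat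
  assumes "compact_surface X A g M"
    and "riemannian_measure X A g M vol"
    and "self_adjoint_laplacian X A g M vol L"
    and "p \<in> M"
    and "\<And>f. f \<in> Domain L \<Longrightarrow> \<exists>z. has_value_at X vol p f z"
    and "adapted_eigenbasis X vol L p B"
    and "nonvanishing_part vol L p B \<Phi> E"
    and "weyl_law p \<Phi> E"
    and "green_sum vol p \<Phi> E \<i> gp"
    and "green_sum vol p \<Phi> E (- \<i>) gm"
    and "0 < \<Theta>" and "\<Theta> < 2 * pi"
    and "b = Suc a" and "c = Suc b" and "d = Suc c"
    and "\<mu> \<in> {E b..E c}"
    and "(cmod (\<Phi> b p))\<^sup>2 / (E b - \<mu>) + (cmod (\<Phi> c p))\<^sup>2 / (E c - \<mu>) = 0"
    and "\<psi> = (\<lambda>x. cnj (\<Phi> b p) / complex_of_real (E b - \<mu>) * \<Phi> b x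
                 + cnj (\<Phi> c p) / complex_of_real (E c - \<mu>) * \<Phi> c x)"
  shows "\<exists>\<phi> \<nu>. \<nu> \<in> {E a<..<E d} \<and>
           eigenfunction vol (op_HTheta X vol L p gp gm \<Theta>) \<nu> \<phi> \<and> L2_norm vol \<phi> = 1 \<and>
           (let q = 1 - (E c - E b)\<^sup>2 / (4 * (min (E d - E c) (E b - E a))\<^sup>2)
            in q \<ge> 0 \<longrightarrow> cmod (L2_inner vol \<phi> \<psi>) \<ge> L2_norm vol \<psi> / sqrt 3 * sqrt q)"
proof -
  note geometry = assms(1,2) and abcd = assms(13-15) and \<mu>_eq = assms(17) and \<psi>_def = assms(18)
  define T where "T = op_neg L"
  define w where "w j = (cmod (\<Phi> j p))\<^sup>2" for j
  \<comment> \<open>The coefficients of \<psi> with the common factor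
    \<open>cnj (\<Phi> j p)\<close> removed, extended by 0.\<close>
  define r where "r j = (if j \<in> {b, c} then 1 / (E j - \<mu>) else 0)" for j
  define Q where "Q = 1 - (E c - E b)\<^sup>2 / (4 * (min (E d - E c) (E b - E a))\<^sup>2)"
  have T: "T = op_adjoint vol T"
    using assms(3) unfolding T_def self_adjoint_laplacian_def self_adjoint_def by (intro op_neg_self_adjoint) blast
  have basis: "orthonormal_basis vol B"
    and basis_eigen: "\<And>b. b \<in> B \<Longrightarrow> \<exists>\<epsilon>::real. (b, \<lambda>x. complex_of_real \<epsilon> * b x) \<in> T"
    and basis_value: "\<And>b. b \<in> B \<Longrightarrow> has_value_at X vol p b (b p)"
    using assms(6) unfolding adapted_eigenbasis_def eigenfunction_def T_def by blast+
  have Phi_range: "range \<Phi> = {b \<in> B. b p \<noteq> 0}" and E: "strict_mono E"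
    and Phi_eigen: "\<And>j. (\<Phi> j, \<lambda>x. complex_of_real (E j) * \<Phi> j x) \<in> T"
    using assms(7) unfolding nonvanishing_part_def eigenfunction_def T_def by blast+
  have orth: "orthonormal_seq vol \<Phi>"
    using eigen_sequence_orthonormal[OF T basis _ E Phi_eigen] Phi_range by blast
  have \<Phi>L: "\<Phi> j \<in> L2 vol" for j using orth by (simp add: orthonormal_seq_def)
  have w: "w j > 0" for j using Phi_range by (auto simp: w_def)
  have Elt: "E a < E b" "E b < E c" "E c < E d" using E abcd by (auto simp: strict_mono_Suc_iff)
  have "Q \<le> 1" by (simp add: Q_def)
  have \<mu>: "E b < \<mu>" "\<mu> < E c"
  proof -
    have "w b / (E b - \<mu>) + w c / (E c - \<mu>) = 0" using \<mu>_eq by (simp add: w_def)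
    \<comment> \<open>Division by zero yields 0, so at an endpoint one term would vanish while the
      other stays nonzero.\<close>
    then have "\<mu> \<noteq> E b" "\<mu> \<noteq> E c" using w[of b] w[of c] Elt by auto
    then show "E b < \<mu>" "\<mu> < E c" using assms(16) by auto
  qed
  define \<beta> where "\<beta> j = cnj (\<Phi> j p) / complex_of_real (E j - \<mu>)" for j
  have bc: "b \<noteq> c" using abcd by simp
  have \<psi>: "\<psi> = (\<lambda>x. \<Sum>j\<in>{b, c}. \<beta> j * \<Phi> j x)" unfolding \<psi>_def \<beta>_def using bc by simp
  have \<beta>sq: "(cmod (\<beta> j))\<^sup>2 = w j * (r j)\<^sup>2" if "j \<in> {b, c}" for j
  proof -
    have "cmod (\<beta> j) = cmod (\<Phi> j p) / \<bar>E j - \<mu>\<bar>"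
      unfolding \<beta>_def norm_divide norm_of_real by simp
    then show ?thesis using that by (simp add: w_def r_def power_divide)
  qed
  have "(L2_norm vol \<psi>)\<^sup>2 = (\<Sum>j\<in>{b, c}. (cmod (\<beta> j))\<^sup>2)"
    unfolding \<psi> using orth by (intro orthonormal_norm_sum) (auto simp: orthonormal_seq_def)
  also have "\<dots> = w b * (r b)\<^sup>2 + w c * (r c)\<^sup>2" using bc \<beta>sq by simp
  finally have \<psi>sq: "(L2_norm vol \<psi>)\<^sup>2 = w b * (r b)\<^sup>2 + w c * (r c)\<^sup>2" .
  have \<psi>L: "\<psi> \<in> L2 vol" unfolding \<psi> by (intro L2_sum L2_scale \<Phi>L)
  have inner_\<psi>: "L2_inner vol f \<psi> = cnj (\<beta> b) * L2_inner vol f (\<Phi> b) + cnj (\<beta> c) * L2_inner vol f (\<Phi> c)"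
    if "f \<in> L2 vol" for f
    unfolding \<psi> using bc that by (simp add: L2_inner_add_right L2_scale L2_inner_scale_right \<Phi>L)
  \<comment> \<open>Both cases below deliver the overlap in squared form; the square roots are taken
    once, here.\<close>
  have goal: ?thesis
    if \<nu>: "E a < \<nu>" "\<nu> < E d" and eig: "(\<phi>, \<lambda>x. complex_of_real \<nu> * \<phi> x) \<in> op_HTheta X vol L p gp gm \<Theta>"
      and norm: "L2_norm vol \<phi> = 1"
      and overlap: "Q \<ge> 0 \<Longrightarrow> Q * (L2_norm vol \<psi>)\<^sup>2 \<le> 3 * (cmod (L2_inner vol \<phi> \<psi>))\<^sup>2" for \<nu> \<phi>
  proof (intro exI conjI)
    show "eigenfunction vol (op_HTheta X vol L p gp gm \<Theta>) \<nu> \<phi>"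
      unfolding eigenfunction_def using eig norm by simp
    have "L2_norm vol \<psi> / sqrt 3 * sqrt Q \<le> cmod (L2_inner vol \<phi> \<psi>)" if "Q \<ge> 0"
    proof (rule power2_le_imp_le)
      have "(L2_norm vol \<psi> / sqrt 3 * sqrt Q)\<^sup>2 = Q * (L2_norm vol \<psi>)\<^sup>2 / 3"
        using that by (simp add: power_mult_distrib power_divide)
      also have "\<dots> \<le> (cmod (L2_inner vol \<phi> \<psi>))\<^sup>2" using overlap[OF that] by simp
      finally show "(L2_norm vol \<psi> / sqrt 3 * sqrt Q)\<^sup>2 \<le> (cmod (L2_inner vol \<phi> \<psi>))\<^sup>2" .
    qed simp
    then show "let q = 1 - (E c - E b)\<^sup>2 / (4 * (min (E d - E c) (E b - E a))\<^sup>2)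
            in q \<ge> 0 \<longrightarrow> cmod (L2_inner vol \<phi> \<psi>) \<ge> L2_norm vol \<psi> / sqrt 3 * sqrt q"
      unfolding Let_def Q_def[symmetric] by blast
  qed (use \<nu> norm in auto)
  have H0: "op_H0 X vol L p = {(f, h) \<in> T. has_value_at X vol p f 0}"
    by (simp add: op_H0_def T_def)
  show ?thesis
  proof (cases "\<exists>W. openin X W \<and> p \<in> W \<and> (AE x in vol. x \<notin> W)")
    case True
    text \<open>Excluding null neighbourhoods of \<open>p\<close> would need the local structure of the surface. It is
      simpler to note that then every value at \<open>p\<close> is admissible, so that \<open>H_0\<close> is the full
      self-adjoint operator, and one of \<open>\<Phi> b\<close>, \<open>\<Phi> c\<close> is the required eigenfunction.\<close>
    then have "has_value_at X vol p f 0" for f using has_value_at_null by metis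
    then have H0T: "op_H0 X vol L p = T" unfolding H0 by auto
    \<comment> \<open>One of the two orthogonal components carries at least half of the squared norm
      of \<psi>, which is more than the third required when \<open>Q \<le> 1\<close>.\<close>
    have max2: "x + y \<le> 2 * x \<or> x + y \<le> 2 * y" for x y :: real by linarith
    obtain j where j: "j \<in> {b, c}" "w b * (r b)\<^sup>2 + w c * (r c)\<^sup>2 \<le> 2 * (w j * (r j)\<^sup>2)"
      using max2[of "w b * (r b)\<^sup>2" "w c * (r c)\<^sup>2"] by blast
    show ?thesis
    proof (rule goal)
      show "E a < E j" "E j < E d" using j(1) Elt by auto
      have "(\<Phi> j, \<lambda>x. complex_of_real (E j) * \<Phi> j x) \<in> op_adjoint vol T" using T Phi_eigen by simp
      moreover have "\<Phi> j \<in> Domain T" using Phi_eigen by blast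
      \<comment> \<open>The boundary condition holds with both singular coefficients equal to
        0.\<close>
      ultimately show "(\<Phi> j, \<lambda>x. complex_of_real (E j) * \<Phi> j x) \<in> op_HTheta X vol L p gp gm \<Theta>"
        unfolding op_HTheta_def H0T by (auto intro!: exI[of _ "\<Phi> j"] exI[of _ 0])
      have "(L2_norm vol (\<Phi> j))\<^sup>2 = 1"
        using orth L2_inner_self[of vol "\<Phi> j"] unfolding orthonormal_seq_def by (metis of_real_eq_1_iff)
      then show "L2_norm vol (\<Phi> j) = 1" using L2_norm_nonneg[of vol "\<Phi> j"] by (simp add: power2_eq_1_iff)
      have "L2_inner vol (\<Phi> j) \<psi> = cnj (\<beta> j)"
        using inner_\<psi>[OF \<Phi>L] orth j(1) bc unfolding orthonormal_seq_def by auto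
      then have "(cmod (L2_inner vol (\<Phi> j) \<psi>))\<^sup>2 = w j * (r j)\<^sup>2" using \<beta>sq[OF j(1)] by simp
      then have "(L2_norm vol \<psi>)\<^sup>2 \<le> 2 * (cmod (L2_inner vol (\<Phi> j) \<psi>))\<^sup>2" using j(2) \<psi>sq by simp
      moreover have "Q * (L2_norm vol \<psi>)\<^sup>2 \<le> 1 * (L2_norm vol \<psi>)\<^sup>2"
        using \<open>Q \<le> 1\<close> by (intro mult_right_mono) auto
      ultimately show "Q * (L2_norm vol \<psi>)\<^sup>2 \<le> 3 * (cmod (L2_inner vol (\<Phi> j) \<psi>))\<^sup>2"
        using zero_le_power2[of "cmod (L2_inner vol (\<Phi> j) \<psi>)"] by linarith
    qed
  next
    case False
    have gp: "green_sum vol p \<Phi> E \<i> gp" and gm: "green_sum vol p \<Phi> E (- \<i>) gm" using assms(9,10) by auto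
    \<comment> \<open>The weights are the squared coefficients of \<open>gp\<close>, so their
      summability is Bessel's inequality for a square-integrable function.\<close>
    have "summable (\<lambda>j. (cmod (L2_inner vol gp (\<Phi> j)))\<^sup>2)"
      using Bessel[OF orth] gp by (simp add: green_sum_def L2_sums_def)
    moreover have "(cmod (L2_inner vol gp (\<Phi> j)))\<^sup>2 = w j / ((E j)\<^sup>2 + 1)" for j
    proof -
      have "(cmod (complex_of_real (E j) - \<i>))\<^sup>2 = (E j)\<^sup>2 + 1" unfolding cmod_power2 by simp
      then show ?thesis
        unfolding L2_sums_orthonormal_coeff[OF orth gp[unfolded green_sum_def]]
        by (simp add: norm_divide power_divide w_def)
    qed
    ultimately have sw: "summable (\<lambda>j. w j / ((E j)\<^sup>2 + 1))" by simp
    have "riemannian_surface X A g"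
      using geometry by (simp add: compact_surface_def)
    then have "first_countable X"
      by (simp add: riemannian_surface.second_countable second_countable_imp_first_countable)
    moreover have "space vol = M" "sets vol = sigma_sets M {W \<inter> M | W. openin X W}"
      using geometry by (auto simp: riemannian_measure_def)
    \<comment> \<open>Any \<Phi> j would do here: a square-integrable function with nonzero value at
      \<open>p\<close> is what makes small neighbourhoods have finite measure.\<close>
    moreover have "has_value_at X vol p (\<Phi> a) (\<Phi> a p)" "\<Phi> a p \<noteq> 0"
      using basis_value Phi_range by blast+
    ultimately obtain k where "\<And>n. k n \<in> L2 vol"
      "\<And>f z. f \<in> L2 vol \<Longrightarrow> has_value_at X vol p f z \<Longrightarrow> (\<lambda>n. L2_inner vol f (k n)) \<longlonglongrightarrow> z"
      using averaging_functionals[of X vol M "\<Phi> a" p "\<Phi> a p"] False \<Phi>L by blast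
    then interpret point_evaluation X vol p T B \<Phi> E k
      using T basis basis_eigen basis_value Phi_range E Phi_eigen sw assms(5)
      by unfold_locales (auto simp: T_def Domain_op_neg w_def)
    obtain \<alpha> :: complex and t :: real
      where \<alpha>: "\<And>e::real. \<alpha> / (e - \<i>) + (- exp (\<i> * \<Theta>) * \<alpha>) / (e + \<i>) = complex_of_real ((e - t) / (e\<^sup>2 + 1))"
      using boundary_condition_coefficients[OF assms(11,12)] by blast
    have "\<forall>n. \<exists>l. E n < l \<and> l < E (Suc n) \<and>
        (\<lambda>j. w j * (1 / (E j - l) - (E j - t) / ((E j)\<^sup>2 + 1))) sums 0"
      by (intro allI secular_root[OF w E sw])
    from choice[OF this] obtain l where l: "\<And>n. E n < l n" "\<And>n. l n < E (Suc n)"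
      and root: "\<And>n. (\<lambda>j. w j * (1 / (E j - l n) - (E j - t) / ((E j)\<^sup>2 + 1))) sums 0"
      by blast
    define \<delta> where "\<delta> n = min (l n - E n) (E (Suc n) - l n)" for n
    have \<delta>: "\<delta> n > 0" for n using l by (simp add: \<delta>_def)
    have far: "\<bar>E j - l n\<bar> \<ge> \<delta> n" for j n
    proof (cases "j \<le> n")
      case True
      then have "E j \<le> E n" using E by (simp add: strict_mono_less_eq)
      then show ?thesis using l[of n] by (auto simp: \<delta>_def)
    next
      case False
      then have "E (Suc n) \<le> E j" using E by (simp add: strict_mono_less_eq)
      then show ?thesis using l[of n] by (auto simp: \<delta>_def)
    qed
    have El: "E j \<noteq> l n" for j n using far[of n j] \<delta>[of n] by auto
    have l_less: "l i < l j" if "i < j" for i j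
    proof -
      have "E (Suc i) \<le> E j" using E that by (simp add: strict_mono_less_eq)
      then show ?thesis using l[of i] l[of j] by simp
    qed
    \<comment> \<open>\<open>Nn n\<close> is the squared norm of the resolvent sum at
      \<open>l n\<close> and \<open>Cn n\<close> its inner product with \<psi>, both before
      normalisation.\<close>
    define Nn where "Nn n = (\<Sum>j. w j / (E j - l n)\<^sup>2)" for n
    have nrm: "(\<lambda>j. w j / (E j - l n)\<^sup>2) sums Nn n" for n
      unfolding Nn_def by (intro summable_sums summable_resolvent_sq[OF w sw far \<delta>])
    define Cn where "Cn n = w b * r b / (E b - l n) + w c * r c / (E c - l n)" for n
    have r0: "w b * r b + w c * r c = 0" using \<mu>_eq by (simp add: r_def w_def)
    have "\<exists>n\<in>{a, b, c}. Q * (w b * (r b)\<^sup>2 + w c * (r c)\<^sup>2) \<le> 3 * ((Cn n)\<^sup>2 / Nn n)"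
      unfolding Q_def
    proof (rule overlap_lower_bound[OF abcd w E _ _ r0 _ nrm Cn_def])
      show "E n < l n \<and> l n < E (Suc n)" for n using l by blast
      show "r j = 0" if "j \<notin> {b, c}" for j using that by (simp add: r_def)
      show "(\<lambda>j. w j / ((E j - l n) * (E j - l n'))) sums 0" if "n \<noteq> n'" for n n'
        using l_less[of n n'] l_less[of n' n] that
        by (intro secular_orthogonality[OF root root _ El El]) linarith
    qed
    then obtain n where n: "n \<in> {a, b, c}" "Q * (L2_norm vol \<psi>)\<^sup>2 \<le> 3 * ((Cn n)\<^sup>2 / Nn n)"
      unfolding \<psi>sq by blast
    have Npos: "Nn n > 0" unfolding Nn_def
      using w El by (intro suminf_pos summable_resolvent_sq[OF w sw far \<delta>]) simp
    define s where "s = 1 / sqrt (Nn n)"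
    have s2: "s\<^sup>2 = 1 / Nn n" using Npos by (simp add: s_def power_divide)
    obtain G f h where G: "L2_sums vol (\<lambda>j x. complex_of_real (s / (E j - l n)) * cnj (\<Phi> j p) * \<Phi> j x) G"
      and adj: "(G, \<lambda>x. complex_of_real (l n) * G x) \<in> op_adjoint vol {(f, h) \<in> T. has_value_at X vol p f 0}"
      and f: "(f, h) \<in> T" "has_value_at X vol p f 0"
      and AE: "AE x in vol. G x = f x + (s * \<alpha>) * gp x + (s * (- exp (\<i> * \<Theta>) * \<alpha>)) * gm x"
      using resolvent_eigenfunction[OF far \<delta> root[unfolded w_def] gp gm \<alpha>] by blast
    show ?thesis
    proof (rule goal)
      have "E a \<le> E n" "E (Suc n) \<le> E d" using n(1) abcd E by (auto simp: strict_mono_less_eq)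
      then show "E a < l n" "l n < E d" using l[of n] by auto
      have "f \<in> Domain {(f, h) \<in> T. has_value_at X vol p f 0}" using f by blast
      moreover have "complex_of_real s * (- exp (\<i> * \<Theta>) * \<alpha>) = - exp (\<i> * \<Theta>) * (s * \<alpha>)" by simp
      ultimately show "(G, \<lambda>x. complex_of_real (l n) * G x) \<in> op_HTheta X vol L p gp gm \<Theta>"
        unfolding op_HTheta_def H0 using adj AE by blast
      have "(\<lambda>j. s\<^sup>2 * (w j / (E j - l n)\<^sup>2)) sums (s\<^sup>2 * Nn n)" by (intro sums_mult nrm)
      moreover have "(cmod (complex_of_real (s / (E j - l n)) * cnj (\<Phi> j p)))\<^sup>2 = s\<^sup>2 * (w j / (E j - l n)\<^sup>2)" for j
        unfolding norm_mult norm_of_real by (simp add: power_mult_distrib power_divide w_def)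
      ultimately have "(L2_norm vol G)\<^sup>2 = s\<^sup>2 * Nn n"
        using L2_sums_Parseval[OF orth G] sums_unique2 by simp
      then have "(L2_norm vol G)\<^sup>2 = 1" using s2 Npos by simp
      then show "L2_norm vol G = 1" using L2_norm_nonneg[of vol G] by (simp add: power2_eq_1_iff)
      have GL: "G \<in> L2 vol" using G by (simp add: L2_sums_def)
      have "cnj (\<beta> j) * L2_inner vol G (\<Phi> j) = complex_of_real (s * (w j * r j / (E j - l n)))" if "j \<in> {b, c}" for j
      proof -
        have "cnj (\<beta> j) * L2_inner vol G (\<Phi> j)
            = complex_of_real (1 / (E j - \<mu>) * (s / (E j - l n))) * (\<Phi> j p * cnj (\<Phi> j p))"
          unfolding L2_sums_orthonormal_coeff[OF orth G] \<beta>_def by simp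
        also have "\<dots> = complex_of_real (1 / (E j - \<mu>) * (s / (E j - l n)) * w j)"
          unfolding complex_norm_square[symmetric] w_def by simp
        also have "1 / (E j - \<mu>) * (s / (E j - l n)) * w j = s * (w j * r j / (E j - l n))"
          using that by (simp add: r_def)
        finally show ?thesis .
      qed
      then have "L2_inner vol G \<psi> = complex_of_real (s * Cn n)"
        unfolding inner_\<psi>[OF GL] Cn_def by (simp add: distrib_left)
      then have "(cmod (L2_inner vol G \<psi>))\<^sup>2 = s\<^sup>2 * (Cn n)\<^sup>2"
        by (simp only: norm_of_real power2_abs power_mult_distrib)
      then show "Q * (L2_norm vol \<psi>)\<^sup>2 \<le> 3 * (cmod (L2_inner vol G \<psi>))\<^sup>2"
        using n(2) s2 by simp
    qed
  qed
qed

end
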